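(* Let $p$ be an odd prime. Let $A,B$ be positive definite even $4\times4$ integral symmetric matrices with $\det A=\det B=p^2$ and with $pA^{-1}$ and $pB^{-1}$ both even. Let $Q=A\oplus B$ (an $8\times8$ matrix). Then all Fourier coefficients of $\mathrm{Tr}(\vartheta^Q)\in M_2^4(K(p))$ are (integral) multiples of $4$.
   Context: A symmetric integral matrix is even if its diagonal entries are even. $\vartheta^Q(\Omega)=\sum_{N\in\mathbb Z^{8\times2}}e(\tfrac12\mathrm{tr}(N'QN\,\Omega))\in M_2^4(\Gamma_0(p))$, $e(z)=e^{2\pi iz}$, $\Gamma_0(p)=\{\begin{pmatrix}A&B\\C&D\end{pmatrix}\in\mathrm{Sp}_2(\mathbb Z):C\equiv0\bmod p\}$. $K(p)=\mathrm{Sp}_2(\mathbb Q)\cap\begin{pmatrix} * & * & */p & *\\ p* & * & * & *\\ p* & p* & * & p*\\ p* & * & * & *\end{pmatrix}$ ($*\in\mathbb Z$). $\mathrm{Tr}:M_2^k(\Gamma_0(p))\to M_2^k(K(p))$ is $f|\mathrm{Tr}=\sum_{\beta\bmod p}f|t\begin{pmatrix}\beta/p&0\\0&0\end{pmatrix}+(f|E_1)|\tilde\mu+\sum_{\alpha,\beta\bmod p}(f|E_1)|t\begin{pmatrix}\beta/p&0\\0&\alpha\end{pmatrix}+\sum_{\alpha\bmod p}(f|F_p)|\mu\,t\begin{pmatrix}0&0\\0&\alpha\end{pmatrix}$, with slash $(f|_k\gamma)(\Omega)=\mu(\gamma)^{2k-3}\det(C\Omega+D)^{-k}f((A\Omega+B)(C\Omega+D)^{-1})$,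 $t(S)=\begin{pmatrix}I_2&S\\0&I_2\end{pmatrix}$, $E_1=\begin{pmatrix}1&0&0&0\\0&0&0&1\\0&0&1&0\\0&-1&0&0\end{pmatrix}$, $F_p=\frac1{\sqrt p}\begin{pmatrix}0&I_2\\-pI_2&0\end{pmatrix}$, $\mu=\frac1{\sqrt p}\begin{pmatrix}0&1&0&0\\-p&0&0&0\\0&0&0&p\\0&0&-1&0\end{pmatrix}$, $\tilde\mu=\begin{pmatrix}0&1&0&0\\-p&0&0&0\\0&0&0&1\\0&0&-1/p&0\end{pmatrix}$. Fourier coefficients $a(T)$ are those in $F(\Omega)=\sum_Ta(T)e(\mathrm{tr}(T\Omega))$. *)

theory Defs
  imports "HOL-Analysis.Analysis" "HOL-Computational_Algebra.Primes"
begin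

definition even_mat :: "real^'n^'n \<Rightarrow> bool" where
  "even_mat M \<longleftrightarrow> transpose M = M \<and> (\<forall>i j. M $ i $ j \<in> \<int>) \<and> (\<forall>i. \<exists>m::int. M $ i $ i = of_int (2 * m))"

definition pos_def_mat :: "real^'n^'n \<Rightarrow> bool" where
  "pos_def_mat M \<longleftrightarrow> transpose M = M \<and> (\<forall>x. x \<noteq> 0 \<longrightarrow> x \<bullet> (M *v x) > 0)"

definition pos_semidef_mat :: "real^'n^'n \<Rightarrow> bool" where
  "pos_semidef_mat M \<longleftrightarrow> transpose M = M \<and> (\<forall>x. x \<bullet> (M *v x) \<ge> 0)"

definition block_mat ::
  "'a^'m^'m \<Rightarrow> 'a^'n^'m \<Rightarrow> 'a^'m^'n \<Rightarrow> 'a^'n^'n \<Rightarrow> 'a^('m + 'n)^('m + 'n)" where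
  "block_mat A B C D = (\<chi> i j.
     case i of
       Inl r \<Rightarrow> (case j of Inl c \<Rightarrow> A $ r $ c | Inr c \<Rightarrow> B $ r $ c)
     | Inr r \<Rightarrow> (case j of Inl c \<Rightarrow> C $ r $ c | Inr c \<Rightarrow> D $ r $ c))"

definition direct_sum_mat :: "real^'m^'m \<Rightarrow> real^'n^'n \<Rightarrow> real^('m + 'n)^('m + 'n)" where
  "direct_sum_mat A B = block_mat A 0 0 B"

definition mat2 :: "'a::zero \<Rightarrow> 'a \<Rightarrow> 'a \<Rightarrow> 'a \<Rightarrow> 'a^2^2" where
  "mat2 a b c d = vector [vector [a, b], vector [c, d]]"

abbreviation cmat :: "real^'n^'m \<Rightarrow> complex^'n^'m" where
  "cmat \<equiv> map_matrix complex_of_real"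

definition e2pi :: "complex \<Rightarrow> complex" where
  "e2pi z = exp (2 * of_real pi * \<i> * z)"

definition siegel_upper_half :: "(complex^2^2) set" where
  "siegel_upper_half = {\<Omega>. transpose \<Omega> = \<Omega> \<and> pos_def_mat (map_matrix Im \<Omega>)}"

definition theta_series :: "real^'n^'n \<Rightarrow> complex^2^2 \<Rightarrow> complex" where
  "theta_series Q \<Omega> = (\<Sum>\<^sub>\<infinity>N\<in>(UNIV :: (int^2^'n) set).
     let N' = map_matrix complex_of_int N
     in e2pi (1/2 * trace (transpose N' ** cmat Q ** N' ** \<Omega>)))"

text \<open>Matrices of size four acting on the Siegel upper half space are indexed by
  \<^typ>\<open>2 + 2\<close>, so that the four blocks are the four combinations of \<^const>\<open>Inl\<close> and \<^const>\<open>Inr\<close>.\<close>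

type_synonym mat4 = "real^(2 + 2)^(2 + 2)"

definition blkA :: "mat4 \<Rightarrow> real^2^2" where "blkA \<gamma> = (\<chi> i j. \<gamma> $ Inl i $ Inl j)"
definition blkB :: "mat4 \<Rightarrow> real^2^2" where "blkB \<gamma> = (\<chi> i j. \<gamma> $ Inl i $ Inr j)"
definition blkC :: "mat4 \<Rightarrow> real^2^2" where "blkC \<gamma> = (\<chi> i j. \<gamma> $ Inr i $ Inl j)"
definition blkD :: "mat4 \<Rightarrow> real^2^2" where "blkD \<gamma> = (\<chi> i j. \<gamma> $ Inr i $ Inr j)"

definition symp_J :: mat4 where
  "symp_J = block_mat 0 (mat 1) (- mat 1) 0"

definition similitude :: "mat4 \<Rightarrow> real" where
  "similitude \<gamma> = (THE m. transpose \<gamma> ** symp_J ** \<gamma> = m *\<^sub>R symp_J)"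

definition slash :: "int \<Rightarrow> (complex^2^2 \<Rightarrow> complex) \<Rightarrow> mat4 \<Rightarrow> complex^2^2 \<Rightarrow> complex" where
  "slash k f \<gamma> \<Omega> =
     (let N = cmat (blkA \<gamma>) ** \<Omega> + cmat (blkB \<gamma>);
          M = cmat (blkC \<gamma>) ** \<Omega> + cmat (blkD \<gamma>)
      in of_real (similitude \<gamma>) powi (2 * k - 3) * det M powi (- k) * f (N ** matrix_inv M))"

definition transl :: "real^2^2 \<Rightarrow> mat4" where
  "transl S = block_mat (mat 1) S 0 (mat 1)"

definition E1_mat :: mat4 where
  "E1_mat = block_mat (mat2 1 0 0 0) (mat2 0 0 0 1) (mat2 0 0 0 (- 1)) (mat2 1 0 0 0)"

definition F_mat :: "nat \<Rightarrow> mat4" where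
  "F_mat p = (1 / sqrt (real p)) *\<^sub>R block_mat 0 (mat 1) (- (real p *\<^sub>R mat 1)) 0"

definition mu_mat :: "nat \<Rightarrow> mat4" where
  "mu_mat p = (1 / sqrt (real p)) *\<^sub>R
     block_mat (mat2 0 1 (- real p) 0) 0 0 (mat2 0 (real p) (- 1) 0)"

definition mu_tilde_mat :: "nat \<Rightarrow> mat4" where
  "mu_tilde_mat p = block_mat (mat2 0 1 (- real p) 0) 0 0 (mat2 0 1 (- 1 / real p) 0)"

definition trace_op ::
  "int \<Rightarrow> nat \<Rightarrow> (complex^2^2 \<Rightarrow> complex) \<Rightarrow> complex^2^2 \<Rightarrow> complex" where
  "trace_op k p f \<Omega> =
     (\<Sum>\<beta><p. slash k f (transl (mat2 (real \<beta> / real p) 0 0 0)) \<Omega>)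
   + slash k (slash k f E1_mat) (mu_tilde_mat p) \<Omega>
   + (\<Sum>\<alpha><p. \<Sum>\<beta><p. slash k (slash k f E1_mat) (transl (mat2 (real \<beta> / real p) 0 0 (real \<alpha>))) \<Omega>)
   + (\<Sum>\<alpha><p. slash k (slash k f (F_mat p)) (mu_mat p ** transl (mat2 0 0 0 (real \<alpha>))) \<Omega>)"

definition paramodular_shape :: "nat \<Rightarrow> mat4" where
  "paramodular_shape p =
     block_mat (mat2 1 1 (real p) 1) (mat2 (1 / real p) 1 1 1)
               (mat2 (real p) (real p) (real p) 1) (mat2 1 (real p) 1 1)"

definition paramodular :: "nat \<Rightarrow> mat4 set" where
  "paramodular p = {\<gamma>. transpose \<gamma> ** symp_J ** \<gamma> = symp_J \<and>
     (\<forall>i j. \<exists>m::int. \<gamma> $ i $ j = paramodular_shape p $ i $ j * of_int m)}"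

text \<open>The Fourier series of a modular form for \<open>\<Gamma>\<close> is indexed by the positive semidefinite
  elements of the dual, under the trace pairing, of the lattice of translations in \<open>\<Gamma>\<close>.\<close>

definition fourier_index :: "mat4 set \<Rightarrow> (real^2^2) set" where
  "fourier_index \<Gamma> = {T. pos_semidef_mat T \<and>
     (\<forall>S. transpose S = S \<and> transl S \<in> \<Gamma> \<longrightarrow> trace (T ** S) \<in> \<int>)}"

definition has_fourier_expansion ::
  "mat4 set \<Rightarrow> (complex^2^2 \<Rightarrow> complex) \<Rightarrow> (real^2^2 \<Rightarrow> complex) \<Rightarrow> bool" where
  "has_fourier_expansion \<Gamma> F a \<longleftrightarrow>
     (\<forall>\<Omega>\<in>siegel_upper_half.
        ((\<lambda>T. a T * e2pi (trace (cmat T ** \<Omega>))) has_sum F \<Omega>) (fourier_index \<Gamma>))"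

end

theory Submission
  imports Defs "HOL-Probability.Probability" "HOL-Complex_Analysis.Complex_Analysis"
begin

text \<open>
  The theta series of \<open>A \<oplus> B\<close> is the product of those of \<open>A\<close> and \<open>B\<close>, so Poisson summation is needed in
  dimension four only. It turns every term of the trace into a sum over pairs \<open>(x, y)\<close> with \<open>x\<close> in the
  lattice \<open>L\<close> and \<open>y\<close> in the dual lattice \<open>L\<^sup>*\<close> of \<open>Q = A \<oplus> B\<close>, and the Fourier coefficient at \<open>T\<close> is
  \<open>p n\<^sub>1 + p\<^sup>2 n\<^sub>2 + n\<^sub>3 + p n\<^sub>4\<close>, where the \<open>n\<^sub>i\<close> count the pairs with Gram matrix \<open>2T\<close> and
  \<open>x \<in> L\<^sub>0, y \<in> L\<close>; \<open>x \<in> pL\<^sup>*, y \<in> L\<close>; \<open>x \<in> L\<^sub>0, y \<in> L\<^sup>*\<^sub>0\<close>; \<open>x \<in> pL\<^sup>*, y \<in> L\<^sup>*\<^sub>0\<close> respectively. Here \<open>L\<^sub>0\<close> consists of the \<open>x \<in> L\<close>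
  with \<open>p\<close> dividing \<open>Q(x)/2\<close>, and \<open>L\<^sup>*\<^sub>0\<close> of the \<open>y \<in> L\<^sup>*\<close> with \<open>Q(y)/2\<close> integral. Changing the signs of the components in one summand shows
  that modulo 4 only pairs living in a single summand matter. The discriminant form of a
  quaternary summand is anisotropic, because an even unimodular lattice of rank four does not exist; hence the four
  conditions agree for such pairs, and the coefficient is \<open>(p + 1)\<^sup>2 n\<close> modulo 4 for some \<open>n\<close>.
\<close>

text \<open>A summand has rank four, so Poisson summation multiplies its theta series by the fourth
  power of a square root: no branch survives, only a sign. This sign does double duty. For
  \<open>A\<close> and \<open>B\<close> together the two signs cancel, which makes all counts enter
  the trace with positive weights; for a single summand the sign contradicts the existence of an
  even unimodular overlattice, and this is the anisotropy. All sums are brought to one common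
  summand by recording the first vector in the coordinates of the lattice and the second one in
  those of its dual. The four terms of the trace then differ only in their index sets. The two sign
  changes act freely exactly on the pairs that are nonzero in both summands, hence the modulus four.
  The remaining pairs carry the total weight p + p^2 + 1 + p, and p is odd. Since the statement
  speaks of every Fourier expansion, uniqueness of the coefficients is needed as well; points whose
  imaginary part is the identity matrix suffice for it.\<close>

no_notation fps_nth (infixl "$" 75)
no_notation Infinite_Set_Sum.abs_summable_on (infix "abs'_summable'_on" 50)

section \<open>Fourier uniqueness and the one-dimensional theta function\<close>

lemma summable_on_exp_neg_abs_int: "(\<lambda>k::int. exp (- real_of_int \<bar>k\<bar>)) summable_on UNIV"
proof -
  have geo: "(\<lambda>n::nat. exp (- real n)) summable_on UNIV"
  proof -
    have "summable (\<lambda>n::nat. (exp (-1::real)) ^ n)"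
      by (rule summable_geometric) simp
    then have "summable (\<lambda>n::nat. exp (- real n))"
      by (simp add: exp_of_nat_mult [symmetric])
    then show ?thesis
      by (intro norm_summable_imp_summable_on) simp
  qed
  have 1: "(\<lambda>k::int. exp (- real_of_int \<bar>k\<bar>)) summable_on range int"
    by (subst summable_on_reindex) (auto simp: o_def geo)
  have 2: "(\<lambda>k::int. exp (- real_of_int \<bar>k\<bar>)) summable_on range (\<lambda>n. - int n)"
    by (subst summable_on_reindex) (auto simp: o_def geo inj_def)
  have 3: "range int \<union> range (\<lambda>n. - int n) = UNIV"
    by (auto simp: image_iff) (metis int_cases2)
  show ?thesis
    using summable_on_union [OF 1 2] by (simp only: 3)
qed

lemma summable_on_gauss_int:
  assumes "d > 0"
  shows "(\<lambda>k::int. exp (- d * real_of_int k ^ 2 + M * \<bar>real_of_int k\<bar>)) summable_on UNIV"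
proof -
  \<comment> \<open>This is the maximum of (M + 1) x - d x^2, so that a factor exp(-x) is left over
    for the comparison.\<close>
  define C where "C = (M + 1)\<^sup>2 / (4 * d)"
  have bd: "exp (- d * real_of_int k ^ 2 + M * \<bar>real_of_int k\<bar>) \<le> exp C * exp (- real_of_int \<bar>k\<bar>)" for k
  proof -
    define x where "x = \<bar>real_of_int k\<bar>"
    have "0 \<le> (2 * d * x - (M + 1))\<^sup>2" by simp
    then have "0 \<le> (2 * d * x - (M + 1))\<^sup>2 / (4 * d)" using assms by simp
    also have "\<dots> = d * x\<^sup>2 - (M + 1) * x + C"
      unfolding C_def using assms by (simp add: field_simps power2_eq_square)
    finally have "- d * x\<^sup>2 + M * x \<le> C - x" by (simp add: algebra_simps)
    then show ?thesis
      by (simp add: x_def exp_add [symmetric])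
  qed
  have "(\<lambda>k::int. exp C * exp (- real_of_int \<bar>k\<bar>)) summable_on UNIV"
    by (intro summable_on_cmult_right summable_on_exp_neg_abs_int)
  then show ?thesis
    by (rule summable_on_comparison_test) (use bd in auto)
qed

text \<open>Jacobi's theta function in the normalisation \<tau> = i q: the upper half plane becomes
  Re q > 0, where \<open>csqrt\<close> is holomorphic.\<close>

definition theta_term :: "complex \<Rightarrow> complex \<Rightarrow> int \<Rightarrow> complex" where
  "theta_term q z k = exp (- of_real pi * q * of_int k ^ 2 + 2 * of_real pi * \<i> * z * of_int k)"

lemma norm_theta_term:
  "norm (theta_term q z k) = exp (- pi * Re q * real_of_int k ^ 2 - 2 * pi * Im z * real_of_int k)"
proof -
  have "Re (- of_real pi * q * of_int k ^ 2 + 2 * of_real pi * \<i> * z * of_int k)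
     = - pi * Re q * real_of_int k ^ 2 - 2 * pi * Im z * real_of_int k"
    by (simp add: power2_eq_square algebra_simps)
  then show ?thesis by (simp add: theta_term_def)
qed

lemma norm_theta_term_le:
  assumes "d \<le> Re q" "\<bar>Im z\<bar> \<le> M"
  shows "norm (theta_term q z k) \<le> exp (- (pi * d) * real_of_int k ^ 2 + (2 * pi * M) * \<bar>real_of_int k\<bar>)"
proof -
  have 1: "d * real_of_int k ^ 2 \<le> Re q * real_of_int k ^ 2"
    using assms by (intro mult_right_mono) auto
  have "- (Im z * real_of_int k) \<le> \<bar>Im z * real_of_int k\<bar>" by linarith
  also have "\<dots> \<le> M * \<bar>real_of_int k\<bar>"
    unfolding abs_mult using assms by (intro mult_right_mono) auto
  finally have 2: "- (Im z * real_of_int k) \<le> M * \<bar>real_of_int k\<bar>" .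
  have "pi * (- (Re q * real_of_int k ^ 2) + 2 * (- (Im z * real_of_int k)))
     \<le> pi * (- (d * real_of_int k ^ 2) + 2 * (M * \<bar>real_of_int k\<bar>))"
    using 1 2 by (intro mult_left_mono) auto
  then show ?thesis
    by (simp add: norm_theta_term algebra_simps)
qed

lemma abs_summable_theta_term:
  assumes "Re q > 0"
  shows "theta_term q z abs_summable_on UNIV"
  using assms
  by (intro Infinite_Sum.abs_summable_on_comparison_test'[OF summable_on_gauss_int[of "pi * Re q" "2 * pi * \<bar>Im z\<bar>"]])
     (simp, rule norm_theta_term_le, auto)

definition theta_sum :: "complex \<Rightarrow> complex \<Rightarrow> complex" where
  "theta_sum q z = (\<Sum>\<^sub>\<infinity>k. theta_term q z k)"

text \<open>Both arguments may vary because the continuation below is done first in z with q fixed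
  and then in q, where z / q moves too. On a closed ball the extreme values of Re f and |Im g| give
  one Gaussian majorant for all terms.\<close>

lemma holomorphic_on_theta_sum:
  assumes "open S" "f holomorphic_on S" "g holomorphic_on S" "\<And>t. t \<in> S \<Longrightarrow> Re (f t) > 0"
  shows "(\<lambda>t. theta_sum (f t) (g t)) holomorphic_on S"
proof -
  have "\<exists>r>0. (\<lambda>t. theta_sum (f t) (g t)) holomorphic_on ball t0 r" if t0: "t0 \<in> S" for t0
  proof -
    obtain r where r: "r > 0" "cball t0 r \<subseteq> S"
      using assms(1) t0 unfolding open_contains_cball by auto
    have cf: "continuous_on (cball t0 r) (\<lambda>t. Re (f t))" and cg: "continuous_on (cball t0 r) (\<lambda>t. \<bar>Im (g t)\<bar>)"
      using holomorphic_on_imp_continuous_on[OF holomorphic_on_subset[OF assms(2) r(2)]]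
        holomorphic_on_imp_continuous_on[OF holomorphic_on_subset[OF assms(3) r(2)]]
      by (auto intro!: continuous_on_Re continuous_on_rabs continuous_on_Im)
    have ne: "cball t0 r \<noteq> {}" using r by auto
    obtain t1 where t1: "t1 \<in> cball t0 r" "\<And>t. t \<in> cball t0 r \<Longrightarrow> Re (f t1) \<le> Re (f t)"
      using continuous_attains_inf[OF compact_cball ne cf] by blast
    obtain t2 where t2: "\<And>t. t \<in> cball t0 r \<Longrightarrow> \<bar>Im (g t)\<bar> \<le> \<bar>Im (g t2)\<bar>"
      using continuous_attains_sup[OF compact_cball ne cg] by blast
    have d: "Re (f t1) > 0" using t1 r assms(4) by auto
    have ul: "uniform_limit (cball t0 r) (\<lambda>X t. \<Sum>k\<in>X. theta_term (f t) (g t) k)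
       (\<lambda>t. \<Sum>\<^sub>\<infinity>k\<in>UNIV. theta_term (f t) (g t) k) (finite_subsets_at_top UNIV)"
    proof (rule Weierstrass_m_test_general)
      show "norm (theta_term (f t) (g t) k)
          \<le> exp (- (pi * Re (f t1)) * real_of_int k ^ 2 + (2 * pi * \<bar>Im (g t2)\<bar>) * \<bar>real_of_int k\<bar>)"
        if "t \<in> cball t0 r" for k t
        using t1(2) t2 that by (intro norm_theta_term_le)
      show "(\<lambda>k. exp (- (pi * Re (f t1)) * real_of_int k ^ 2 + (2 * pi * \<bar>Im (g t2)\<bar>) * \<bar>real_of_int k\<bar>))
          summable_on UNIV"
        using d by (intro summable_on_gauss_int) simp
    qed
    have hol: "(\<lambda>t. \<Sum>k\<in>X. theta_term (f t) (g t) k) holomorphic_on S" for X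
      unfolding theta_term_def using assms by (auto intro!: holomorphic_intros)
    have ev: "\<forall>\<^sub>F X in finite_subsets_at_top UNIV.
        continuous_on (cball t0 r) (\<lambda>t. \<Sum>k\<in>X. theta_term (f t) (g t) k) \<and>
        (\<lambda>t. \<Sum>k\<in>X. theta_term (f t) (g t) k) holomorphic_on ball t0 r"
    proof (intro always_eventually allI conjI)
      fix X
      show "continuous_on (cball t0 r) (\<lambda>t. \<Sum>k\<in>X. theta_term (f t) (g t) k)"
        by (rule holomorphic_on_imp_continuous_on[OF holomorphic_on_subset[OF hol r(2)]])
      show "(\<lambda>t. \<Sum>k\<in>X. theta_term (f t) (g t) k) holomorphic_on ball t0 r"
        by (rule holomorphic_on_subset[OF hol subset_trans[OF ball_subset_cball r(2)]])
    qed
    have "(\<lambda>t. \<Sum>\<^sub>\<infinity>k\<in>UNIV. theta_term (f t) (g t) k) holomorphic_on ball t0 r"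
      by (rule holomorphic_uniform_limit[OF ev ul]) auto
    then show ?thesis using r(1) unfolding theta_sum_def by auto
  qed
  then have "(\<lambda>t. theta_sum (f t) (g t)) analytic_on S"
    unfolding analytic_on_def by simp
  then show ?thesis by (rule analytic_imp_holomorphic)
qed

section \<open>Trigonometric kernels and vanishing Fourier coefficients\<close>

lemma cos_le_cos_abs_of_dist:
  fixes x \<delta> :: real
  assumes "0 \<le> \<delta>" "\<delta> \<le> \<bar>x\<bar>" "\<bar>x\<bar> \<le> 1/2"
  shows "0 \<le> cos (pi * x)" "cos (pi * x) \<le> cos (pi * \<delta>)"
proof -
  have eq: "cos (pi * x) = cos (pi * \<bar>x\<bar>)" by (cases "x \<ge> 0") auto
  have "pi * \<bar>x\<bar> \<le> pi / 2" using assms by simp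
  then show "0 \<le> cos (pi * x)" unfolding eq
    by (intro cos_ge_zero) (use pi_ge_zero in \<open>auto intro: order_trans[of _ 0]\<close>)
  show "cos (pi * x) \<le> cos (pi * \<delta>)" unfolding eq
    using assms \<open>pi * \<bar>x\<bar> \<le> pi / 2\<close> by (intro cos_monotone_0_pi_le) (auto intro: order_trans)
qed

text \<open>The square of cos(pi x) is (1 + e(x))^2 e(-x) / 4, and the binomial theorem expands its
  powers.\<close>

lemma cos_sq_power_trig_poly:
  "complex_of_real (cos (pi * x) ^ 2) ^ n
     = (\<Sum>j\<le>2*n. (of_nat ((2*n) choose j) / 4 ^ n) * e2pi (of_int (int j - int n) * of_real x))"
proof -
  have 1: "complex_of_real (cos (pi * x) ^ 2) = (1 + e2pi (of_real x)) ^ 2 * e2pi (- of_real x) / 4"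
  proof -
    define u where "u = exp (\<i> * of_real (pi * x))"
    have u: "e2pi (of_real x) = u ^ 2"
      unfolding u_def e2pi_def by (simp add: exp_of_nat_mult [symmetric] algebra_simps)
    have u': "e2pi (- of_real x) = inverse u ^ 2"
      unfolding u_def e2pi_def exp_minus [symmetric] by (simp add: exp_of_nat_mult [symmetric] algebra_simps)
    have "complex_of_real (cos (pi * x)) = cos (of_real (pi * x))"
      by (metis cos_of_real)
    also have "\<dots> = (u + inverse u) / 2"
      unfolding cos_exp_eq u_def by (simp add: exp_minus)
    finally have c: "complex_of_real (cos (pi * x)) = (u + inverse u) / 2" .
    have "u \<noteq> 0" by (simp add: u_def)
    then show ?thesis unfolding of_real_power c u u'
      by (simp add: field_simps power2_eq_square)
  qed
  have 2: "e2pi (- of_real x) ^ n = e2pi (- of_nat n * of_real x)"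
    unfolding e2pi_def exp_of_nat_mult [symmetric] by (simp add: algebra_simps)
  have 3: "e2pi (of_real x) ^ j * e2pi (- of_nat n * of_real x) = e2pi (of_int (int j - int n) * of_real x)" for j
    unfolding e2pi_def exp_of_nat_mult [symmetric] exp_add [symmetric] by (simp add: algebra_simps)
  have "complex_of_real (cos (pi * x) ^ 2) ^ n = (e2pi (of_real x) + 1) ^ (2 * n) * e2pi (- of_nat n * of_real x) / 4 ^ n"
    unfolding 1 power_divide power_mult_distrib 2 by (simp add: power_mult add.commute)
  also have "\<dots> = (\<Sum>j\<le>2*n. of_nat ((2*n) choose j) * (e2pi (of_real x) ^ j * e2pi (- of_nat n * of_real x)) / 4 ^ n)"
    unfolding binomial_ring by (simp only: sum_distrib_right sum_divide_distrib) (simp add: mult_ac)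
  finally show ?thesis unfolding 3 by simp
qed

text \<open>The kernels \<open>(cos\<^sup>2 \<pi>x)\<^sup>n\<close> are trigonometric polynomials which concentrate at \<open>0\<close>.\<close>

lemma fourier_uniqueness_at_0:
  fixes d :: "real \<Rightarrow> complex"
  assumes cont: "continuous_on {-1/2..1/2} d"
    and coeff: "\<And>k::int. integral {-1/2..1/2} (\<lambda>x. d x * e2pi (of_int k * of_real x)) = 0"
  shows "d 0 = 0"
proof (rule ccontr)
  assume nz: "d 0 \<noteq> 0"
  \<comment> \<open>Multiplying by the conjugate makes the value at 0 positive; since the kernels
    are real, the real part still integrates to 0 against them.\<close>
  define h where "h x = Re (cnj (d 0) * d x)" for x
  have hc: "continuous_on {-1/2..1/2} h"
    unfolding h_def using cont by (intro continuous_intros)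
  have h0: "h 0 > 0" unfolding h_def using nz
    by (simp add: complex_neq_0 [symmetric] flip: power2_eq_square)
  have int0: "integral {-1/2..1/2} (\<lambda>x. h x * (cos (pi * x) ^ 2) ^ n) = 0" for n
  proof -
    have "integral {-1/2..1/2} (\<lambda>x. d x * of_real ((cos (pi * x) ^ 2) ^ n))
       = integral {-1/2..1/2} (\<lambda>x. \<Sum>j\<le>2*n. (of_nat ((2*n) choose j) / 4 ^ n) * (d x * e2pi (of_int (int j - int n) * of_real x)))"
      unfolding of_real_power[of "_ ^ 2"] cos_sq_power_trig_poly by (simp add: sum_distrib_left mult_ac)
    also have "\<dots> = (\<Sum>j\<le>2*n. integral {-1/2..1/2} (\<lambda>x. (of_nat ((2*n) choose j) / 4 ^ n) * (d x * e2pi (of_int (int j - int n) * of_real x))))"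
      using cont by (intro integral_sum) (auto intro!: integrable_continuous_interval continuous_intros simp: e2pi_def)
    also have "\<dots> = 0" by (simp only: integral_mult_right coeff) simp
    finally have z: "integral {-1/2..1/2} (\<lambda>x. d x * of_real ((cos (pi * x) ^ 2) ^ n)) = 0" .
    have hh: "(\<lambda>x. h x * (cos (pi * x) ^ 2) ^ n)
       = (\<lambda>x. Re (cnj (d 0) * (d x * of_real ((cos (pi * x) ^ 2) ^ n))))"
      unfolding h_def by (rule ext) (simp add: algebra_simps del: of_real_power)
    have "(\<lambda>x. cnj (d 0) * (d x * of_real ((cos (pi * x) ^ 2) ^ n))) integrable_on {-1/2..1/2}"
      using cont by (intro integrable_continuous_interval continuous_intros)
    from has_integral_Re[OF integrable_integral[OF this]]
    have "((\<lambda>x. Re (cnj (d 0) * (d x * of_real ((cos (pi * x) ^ 2) ^ n)))) has_integral 0) {-1/2..1/2}"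
      unfolding integral_mult_right z by simp
    then show ?thesis unfolding hh by (rule integral_unique)
  qed
  have mem0: "0 \<in> {-1/2..1/2::real}" by simp
  obtain \<delta>0 where \<delta>0: "\<delta>0 > 0" "\<And>x. x \<in> {-1/2..1/2} \<Longrightarrow> dist x 0 < \<delta>0 \<Longrightarrow> dist (h x) (h 0) < h 0 / 2"
    using hc[unfolded continuous_on_iff, rule_format, OF mem0, of "h 0 / 2"] h0 by auto
  \<comment> \<open>The bound 1/4 keeps pi \<delta> below pi / 2, where the cosine is positive and
    decreasing.\<close>
  define \<delta> where "\<delta> = min (\<delta>0 / 2) (1/4)"
  have \<delta>: "0 < \<delta>" "\<delta> < \<delta>0" "\<delta> \<le> 1/4" unfolding \<delta>_def using \<delta>0(1) by auto
  define c where "c = h 0 / 2"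
  have c: "c > 0" using h0 by (simp add: c_def)
  have hge: "c \<le> h x" if "\<bar>x\<bar> \<le> \<delta>" for x
  proof -
    have "dist (h x) (h 0) < h 0 / 2" using that \<delta> by (intro \<delta>0(2)) auto
    then show ?thesis unfolding c_def dist_real_def by linarith
  qed
  obtain M where M: "\<And>x. x \<in> {-1/2..1/2} \<Longrightarrow> \<bar>h x\<bar> \<le> M" "M > 0"
  proof -
    have "bounded (h ` {-1/2..1/2})"
      using hc compact_continuous_image compact_imp_bounded compact_Icc by blast
    then show ?thesis using that unfolding bounded_pos by (metis imageI real_norm_def)
  qed
  define \<rho> where "\<rho> = cos (pi * \<delta>) ^ 2"
  define \<rho>1 where "\<rho>1 = cos (pi * (\<delta>/2)) ^ 2"
  have cpos: "0 < cos (pi * \<delta>)" using \<delta>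
    by (intro cos_gt_zero) (auto simp: field_simps)
  have clt: "cos (pi * \<delta>) < cos (pi * (\<delta>/2))"
    using \<delta> by (intro cos_monotone_0_pi) auto
  have \<rho>: "0 < \<rho>" "\<rho> < \<rho>1" using cpos clt unfolding \<rho>_def \<rho>1_def
    by (auto intro!: power_strict_mono)
  \<comment> \<open>A lower bound for h times the kernel with an elementary integral: a gain of
    order \<rho>1^n near 0 and a loss M \<rho>^n everywhere. As \<rho> < \<rho>1, the gain wins for
    large n.\<close>
  define kk where "kk n x = (if \<bar>x\<bar> \<le> \<delta>/2 then c * \<rho>1 ^ n else 0) - M * \<rho> ^ n" for n and x :: real
  have low: "kk n x \<le> h x * (cos (pi * x) ^ 2) ^ n" if x: "x \<in> {-1/2..1/2}" for n x
  proof (cases "\<bar>x\<bar> \<le> \<delta>")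
    case True
    have Mn: "M * \<rho> ^ n > 0" using M \<rho> by simp
    show ?thesis
    proof (cases "\<bar>x\<bar> \<le> \<delta>/2")
      case T2: True
      have "cos (pi * (\<delta>/2)) \<le> cos (pi * \<bar>x\<bar>)"
        using T2 \<delta> by (intro cos_monotone_0_pi_le) auto
      also have "cos (pi * \<bar>x\<bar>) = cos (pi * x)" by (cases "x \<ge> 0") auto
      finally have "\<rho>1 \<le> cos (pi * x) ^ 2" unfolding \<rho>1_def using cpos clt by (intro power_mono) auto
      then have "\<rho>1 ^ n \<le> (cos (pi * x) ^ 2) ^ n" using \<rho> by (intro power_mono) auto
      then have "c * \<rho>1 ^ n \<le> h x * (cos (pi * x) ^ 2) ^ n"
        using hge[OF True] c \<rho> by (intro mult_mono) auto
      then show ?thesis using Mn T2 unfolding kk_def by simp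
    next
      case False
      have "0 \<le> h x * (cos (pi * x) ^ 2) ^ n" using hge[OF True] c by simp
      then show ?thesis using Mn False unfolding kk_def by simp
    qed
  next
    case False
    have "0 \<le> cos (pi * x)" "cos (pi * x) \<le> cos (pi * \<delta>)"
      using cos_le_cos_abs_of_dist[of \<delta> x] False x \<delta> by auto
    then have "cos (pi * x) ^ 2 \<le> \<rho>" unfolding \<rho>_def by (intro power_mono)
    then have "(cos (pi * x) ^ 2) ^ n \<le> \<rho> ^ n" by (intro power_mono) auto
    then have "\<bar>h x\<bar> * (cos (pi * x) ^ 2) ^ n \<le> M * \<rho> ^ n"
      using M x by (intro mult_mono) auto
    moreover have "- (\<bar>h x\<bar> * (cos (pi * x) ^ 2) ^ n) \<le> h x * (cos (pi * x) ^ 2) ^ n"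
      using mult_right_mono[of "- \<bar>h x\<bar>" "h x" "(cos (pi * x) ^ 2) ^ n"] by auto
    ultimately show ?thesis using False \<delta> unfolding kk_def by auto
  qed
  have kint: "(kk n has_integral (\<delta> * (c * \<rho>1 ^ n) - M * \<rho> ^ n)) {-1/2..1/2}" for n
  proof -
    have "((\<lambda>x. c * \<rho>1 ^ n) has_integral \<delta> * (c * \<rho>1 ^ n)) {-\<delta>/2..\<delta>/2}"
      using has_integral_const_real[of "c * \<rho>1 ^ n" "-\<delta>/2" "\<delta>/2"] \<delta> by simp
    then have "((\<lambda>x. if x \<in> {-\<delta>/2..\<delta>/2} then c * \<rho>1 ^ n else 0) has_integral \<delta> * (c * \<rho>1 ^ n)) {-1/2..1/2}"
      using \<delta> by (subst has_integral_restrict) auto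
    moreover have "(\<lambda>x. if x \<in> {-\<delta>/2..\<delta>/2} then c * \<rho>1 ^ n else 0) = (\<lambda>x::real. if \<bar>x\<bar> \<le> \<delta>/2 then c * \<rho>1 ^ n else 0)"
      by (auto simp: fun_eq_iff abs_le_iff)
    moreover have "((\<lambda>x::real. M * \<rho> ^ n) has_integral M * \<rho> ^ n) {-1/2..1/2}"
      using has_integral_const_real[of "M * \<rho> ^ n" "-1/2" "1/2"] by simp
    ultimately show ?thesis unfolding kk_def by (simp only: has_integral_diff)
  qed
  have le0: "\<delta> * (c * \<rho>1 ^ n) - M * \<rho> ^ n \<le> 0" for n
  proof -
    have "(\<lambda>x. h x * (cos (pi * x) ^ 2) ^ n) integrable_on {-1/2..1/2}"
      using hc by (intro integrable_continuous_interval continuous_intros)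
    from has_integral_le[OF kint integrable_integral[OF this, unfolded int0] low] show ?thesis .
  qed
  have "(\<lambda>n. (\<rho> / \<rho>1) ^ n) \<longlonglongrightarrow> 0" using \<rho> by (intro LIMSEQ_realpow_zero) auto
  then have "eventually (\<lambda>n. (\<rho> / \<rho>1) ^ n < \<delta> * c / M) sequentially"
    using \<delta> c M by (intro order_tendstoD) auto
  then obtain n where "(\<rho> / \<rho>1) ^ n < \<delta> * c / M"
    by (meson eventually_sequentially order_refl)
  then have "M * \<rho> ^ n < \<delta> * c * \<rho>1 ^ n"
    using M \<rho> by (simp add: power_divide field_simps)
  then show False using le0[of n] by (simp add: mult_ac)
qed

section \<open>Poisson summation in one variable\<close>

lemma e2pi_of_int [simp]: "e2pi (of_int n) = 1"
  unfolding e2pi_def exp_eq_1 by (auto simp: algebra_simps)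

lemma e2pi_add: "e2pi (x + y) = e2pi x * e2pi y"
  by (simp add: e2pi_def distrib_left exp_add)

lemma e2pi_0 [simp]: "e2pi 0 = 1"
  by (simp add: e2pi_def)

lemma norm_e2pi: "norm (e2pi z) = exp (- 2 * pi * Im z)"
  by (simp add: e2pi_def)

lemma continuous_on_e2pi [continuous_intros]:
  "continuous_on S f \<Longrightarrow> continuous_on S (\<lambda>x. e2pi (f x))"
  unfolding e2pi_def by (intro continuous_intros)

text \<open>The substitution x = c (y + v) with c^2 / 2 = pi / q turns this into the characteristic
  function of the standard normal distribution.\<close>

lemma gauss_fourier:
  fixes q v l :: real
  assumes q: "q > 0"
  shows "integrable lborel (\<lambda>y. complex_of_real (exp (- pi * (y + v)\<^sup>2 / q)) * e2pi (- of_real l * of_real y))"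
    and "(\<integral>y. complex_of_real (exp (- pi * (y + v)\<^sup>2 / q)) * e2pi (- of_real l * of_real y) \<partial>lborel)
      = of_real (sqrt q * exp (- pi * q * l\<^sup>2)) * e2pi (of_real (l * v))"
proof -
  define c where "c = sqrt (2 * pi / q)"
  have c: "c > 0" "c\<^sup>2 = 2 * pi / q" using q by (auto simp: c_def)
  define \<tau> where "\<tau> = - 2 * pi * l / c"
  define f where "f x = std_normal_density x *\<^sub>R iexp (\<tau> * x)" for x
  define g where "g y = complex_of_real (exp (- pi * (y + v)\<^sup>2 / q)) * e2pi (- of_real l * of_real y)" for y
  have int_f: "integrable lborel f"
  proof (rule Bochner_Integration.integrable_bound)
    show "integrable lborel std_normal_density"
      by (rule integrable_normal_density) simp
    show "f \<in> borel_measurable lborel" unfolding f_def by measurable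
    show "AE x in lborel. norm (f x) \<le> norm (std_normal_density x)"
      unfolding f_def by (simp add: norm_mult)
  qed
  have "char std_normal_distribution \<tau> = (\<integral>x. f x \<partial>lborel)"
    unfolding char_def f_def by (subst integral_density) auto
  then have val: "(\<integral>x. f x \<partial>lborel) = of_real (exp (- (\<tau>\<^sup>2) / 2))"
    by (simp add: char_std_normal_distribution)
  have fg: "f (c * v + c * y) = (of_real (1 / sqrt (2 * pi)) * e2pi (- of_real (l * v))) * g y" for y
  proof -
    have "c * v + c * y = c * (y + v)" by (simp add: algebra_simps)
    then have 1: "(c * v + c * y)\<^sup>2 / 2 = pi * (y + v)\<^sup>2 / q"
      by (simp add: power_mult_distrib c)
    have 2: "\<tau> * (c * v + c * y) = - (2 * pi * l * (v + y))"
      unfolding \<tau>_def using c by (simp add: field_simps)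
    have "iexp (\<tau> * (c * v + c * y)) = e2pi (- of_real (l * v)) * e2pi (- of_real l * of_real y)"
      unfolding 2 e2pi_def exp_add [symmetric] by (rule arg_cong[of _ _ exp]) (simp add: algebra_simps)
    then show ?thesis
      unfolding f_def g_def std_normal_density_def
      using 1 by (simp add: scaleR_conv_of_real mult_ac)
  qed
  have k0: "of_real (1 / sqrt (2 * pi)) * e2pi (- of_real (l * v)) \<noteq> 0" (is "?k \<noteq> 0")
    by (simp add: e2pi_def)
  have "integrable lborel (\<lambda>y. f (c * v + c * y))"
    using lborel_integrable_real_affine[OF int_f] c by simp
  then have int_kg: "integrable lborel (\<lambda>y. ?k * g y)" by (simp only: fg)
  then have ig: "integrable lborel g"
  proof -
    have inv: "inverse k * (k * b) = b" if "k \<noteq> 0" for k b :: complex using that by simp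
    show ?thesis
      using integrable_mult_right[of "inverse ?k", OF int_kg] unfolding inv[OF k0] by auto
  qed
  then show "integrable lborel (\<lambda>y. complex_of_real (exp (- pi * (y + v)\<^sup>2 / q)) * e2pi (- of_real l * of_real y))"
    unfolding g_def .
  have "(\<integral>x. f x \<partial>lborel) = \<bar>c\<bar> *\<^sub>R (\<integral>y. f (c * v + c * y) \<partial>lborel)"
    by (rule lborel_integral_real_affine) (use c in auto)
  also have "\<dots> = of_real c * (?k * (\<integral>y. g y \<partial>lborel))"
    unfolding fg using c by (simp add: scaleR_conv_of_real del: of_real_mult)
  finally have eq: "of_real (exp (- (\<tau>\<^sup>2) / 2)) = of_real c * (?k * (\<integral>y. g y \<partial>lborel))"
    unfolding val .
  have \<tau>2: "\<tau>\<^sup>2 / 2 = pi * q * l\<^sup>2"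
    unfolding \<tau>_def power_divide c using q by (simp add: field_simps power2_eq_square)
  have cc: "c / sqrt (2 * pi) = 1 / sqrt q"
    unfolding c_def by (simp add: real_sqrt_divide real_sqrt_mult)
  have kinv: "of_real c * ?k * (of_real (sqrt q) * e2pi (of_real (l * v))) = 1"
  proof -
    have "of_real c * ?k * (of_real (sqrt q) * e2pi (of_real (l * v)))
       = of_real (c / sqrt (2 * pi) * sqrt q) * (e2pi (- of_real (l * v)) * e2pi (of_real (l * v)))"
      by (simp add: mult_ac)
    also have "c / sqrt (2 * pi) * sqrt q = 1" unfolding cc using q by simp
    finally show ?thesis by (simp add: e2pi_add [symmetric])
  qed
  have "(\<integral>y. g y \<partial>lborel) = (of_real c * ?k * (of_real (sqrt q) * e2pi (of_real (l * v)))) * (\<integral>y. g y \<partial>lborel)"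
    unfolding kinv by simp
  also have "\<dots> = (of_real (sqrt q) * e2pi (of_real (l * v))) * (of_real c * (?k * (\<integral>y. g y \<partial>lborel)))"
    by (simp only: mult_ac)
  also have "\<dots> = of_real (sqrt q * exp (- pi * q * l\<^sup>2)) * e2pi (of_real (l * v))"
    unfolding eq [symmetric] using \<tau>2 by simp
  finally show "(\<integral>y. complex_of_real (exp (- pi * (y + v)\<^sup>2 / q)) * e2pi (- of_real l * of_real y) \<partial>lborel)
      = of_real (sqrt q * exp (- pi * q * l\<^sup>2)) * e2pi (of_real (l * v))"
    unfolding g_def .
qed

section \<open>Termwise integration and periodisation\<close>

lemma has_sum_integral_interval:
  fixes f :: "'k \<Rightarrow> real \<Rightarrow> complex"
  assumes cont: "\<And>k. continuous_on {a..b} (f k)"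
    and bd: "\<And>k x. x \<in> {a..b} \<Longrightarrow> norm (f k x) \<le> B k" and sm: "B summable_on UNIV"
  shows "((\<lambda>k. integral {a..b} (f k)) has_sum integral {a..b} (\<lambda>x. \<Sum>\<^sub>\<infinity>k. f k x)) UNIV"
proof -
  have ul: "uniform_limit {a..b} (\<lambda>X x. \<Sum>k\<in>X. f k x) (\<lambda>x. \<Sum>\<^sub>\<infinity>k\<in>UNIV. f k x) (finite_subsets_at_top UNIV)"
    by (rule Weierstrass_m_test_general[OF _ sm]) (rule bd)
  obtain I J where IJ: "\<And>X. ((\<lambda>x. \<Sum>k\<in>X. f k x) has_integral I X) {a..b}"
    "((\<lambda>x. \<Sum>\<^sub>\<infinity>k\<in>UNIV. f k x) has_integral J) {a..b}" "(I \<longlongrightarrow> J) (finite_subsets_at_top UNIV)"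
    by (rule uniform_limit_integral[OF ul]) (auto intro!: continuous_on_sum cont)
  have "I X = (\<Sum>k\<in>X. integral {a..b} (f k))" if "finite X" for X
    using integral_unique[OF IJ(1)[of X]] that
    by (subst (asm) integral_sum) (auto intro!: integrable_continuous_interval cont)
  then have "\<forall>\<^sub>F X in finite_subsets_at_top UNIV. I X = (\<Sum>k\<in>X. integral {a..b} (f k))"
    by (auto intro: eventually_finite_subsets_at_top_weakI)
  then have "((\<lambda>X. \<Sum>k\<in>X. integral {a..b} (f k)) \<longlongrightarrow> J) (finite_subsets_at_top UNIV)"
    using IJ(3) by (rule Lim_transform_eventually[rotated])
  then show ?thesis
    unfolding has_sum_def integral_unique[OF IJ(2)] .
qed

text \<open>Unconditional summation over the integers is traded for a limit over symmetric
  intervals, which can be compared with an integral over the line.\<close>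

lemma has_sum_int_imp_symmetric_limit:
  fixes f :: "int \<Rightarrow> 'a::{topological_comm_monoid_add,t2_space}"
  assumes "(f has_sum s) UNIV"
  shows "(\<lambda>N::nat. \<Sum>m\<in>{-int N..int N}. f m) \<longlonglongrightarrow> s"
proof -
  have "filterlim (\<lambda>N::nat. {-int N..int N}) (finite_subsets_at_top UNIV) sequentially"
    unfolding filterlim_finite_subsets_at_top
  proof (intro allI impI)
    fix X :: "int set" assume X: "finite X \<and> X \<subseteq> UNIV"
    define N0 where "N0 = (if X = {} then 0 else nat (Max (abs ` X)))"
    have "X \<subseteq> {-int N..int N}" if "N \<ge> N0" for N
    proof
      fix x assume x: "x \<in> X"
      then have "\<bar>x\<bar> \<le> Max (abs ` X)" using X by (intro Max_ge) auto
      moreover have "Max (abs ` X) \<le> int N" using that x unfolding N0_def by (auto split: if_splits)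
      ultimately show "x \<in> {-int N..int N}" by auto
    qed
    then show "\<forall>\<^sub>F N in sequentially. finite {-int N..int N} \<and> X \<subseteq> {-int N..int N} \<and> {-int N..int N} \<subseteq> UNIV"
      unfolding eventually_sequentially by (intro exI[of _ N0]) auto
  qed
  from filterlim_compose[OF assms[unfolded has_sum_def] this] show ?thesis .
qed

lemma sum_unit_interval_integrals:
  fixes F :: "real \<Rightarrow> complex"
  assumes "continuous_on UNIV F"
  shows "(\<Sum>m\<in>{-int N..int N}. integral {of_int m - 1/2..of_int m + 1/2} F) = integral {- real N - 1/2..real N + 1/2} F"
proof (induction N)
  case 0
  then show ?case by simp
next
  case (Suc N)
  have int: "F integrable_on {a..b}" for a b
    by (rule integrable_continuous_interval) (rule continuous_on_subset[OF assms], simp)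
  have "{-int (Suc N)..int (Suc N)} = insert (-int (Suc N)) (insert (int (Suc N)) {-int N..int N})"
    by auto
  then have "(\<Sum>m\<in>{-int (Suc N)..int (Suc N)}. integral {of_int m - 1/2..of_int m + 1/2} F)
     = integral {- real N - 3/2..- real N - 1/2} F + (integral {real N + 1/2..real N + 3/2} F
        + integral {- real N - 1/2..real N + 1/2} F)"
    by (simp add: Suc.IH algebra_simps minus_diff_commute[of "1/2" "real N"])
  also have "integral {real N + 1/2..real N + 3/2} F + integral {- real N - 1/2..real N + 1/2} F
    = integral {- real N - 1/2..real N + 3/2} F"
    by (subst add.commute, rule Henstock_Kurzweil_Integration.integral_combine) (auto intro: int)
  also have "integral {- real N - 3/2..- real N - 1/2} F + integral {- real N - 1/2..real N + 3/2} F
    = integral {- real N - 3/2..real N + 3/2} F"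
    by (rule Henstock_Kurzweil_Integration.integral_combine) (auto intro: int)
  finally show ?case by (simp add: algebra_simps)
qed

text \<open>Dominated convergence leads from gauge integrals over growing intervals to the Lebesgue
  integral over the line.\<close>

lemma symmetric_integral_limit:
  fixes F :: "real \<Rightarrow> complex"
  assumes "integrable lborel F"
  shows "(\<lambda>N::nat. integral {- real N - 1/2..real N + 1/2} F) \<longlonglongrightarrow> (\<integral>x. F x \<partial>lborel)"
proof -
  let ?S = "\<lambda>N::nat. {- real N - 1/2..real N + 1/2}"
  have eq: "integral (?S N) F = (\<integral>x. indicator (?S N) x *\<^sub>R F x \<partial>lborel)" for N
  proof -
    have "set_integrable lborel (?S N) F"
      unfolding set_integrable_def using assms by (intro integrable_mult_indicator) auto
    then show ?thesis
      using set_borel_integral_eq_integral(2) unfolding set_lebesgue_integral_def by metis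
  qed
  show ?thesis unfolding eq
  proof (rule integral_dominated_convergence[where w = "\<lambda>x. norm (F x)"])
    show "F \<in> borel_measurable lborel" using assms by auto
    then show "(\<lambda>x. indicator (?S N) x *\<^sub>R F x) \<in> borel_measurable lborel" for N by measurable
    show "integrable lborel (\<lambda>x. norm (F x))" using assms by auto
    show "AE x in lborel. (\<lambda>N. indicator (?S N) x *\<^sub>R F x) \<longlonglongrightarrow> F x"
    proof (intro AE_I2 tendsto_eventually)
      fix x :: real
      obtain N0 where N0: "\<bar>x\<bar> \<le> real N0" using real_arch_simple by blast
      show "\<forall>\<^sub>F N in sequentially. indicator (?S N) x *\<^sub>R F x = F x"
        unfolding eventually_sequentially
      proof (intro exI[of _ N0] allI impI)
        fix N assume "N0 \<le> N"
        then have "real N0 \<le> real N" by simp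
        then have "x \<in> ?S N" using N0 by (simp only: atLeastAtMost_iff) linarith
        then show "indicator (?S N) x *\<^sub>R F x = F x" by (simp only: indicator_simps scaleR_one)
      qed
    qed
    show "AE x in lborel. norm (indicator (?S N) x *\<^sub>R F x) \<le> norm (F x)" for N
      by (intro AE_I2) (simp add: indicator_def)
  qed
qed

lemma integral_e2pi_int:
  "integral {-1/2..1/2} (\<lambda>x. e2pi (of_int n * of_real x)) = (if n = 0 then 1 else 0)"
proof (cases "n = 0")
  case False
  have "((\<lambda>x. e2pi (of_int n * of_real x)) has_integral
      e2pi (of_int n * of_real (1/2)) / (2 * of_real pi * \<i> * of_int n)
       - e2pi (of_int n * of_real (-1/2)) / (2 * of_real pi * \<i> * of_int n)) {-1/2..1/2}"
  proof (rule fundamental_theorem_of_calculus)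
    fix x :: real assume "x \<in> {-1/2..1/2}"
    have "((\<lambda>z. e2pi (of_int n * z) / (2 * of_real pi * \<i> * of_int n)) has_field_derivative e2pi (of_int n * of_real x))
       (at (of_real x))"
      unfolding e2pi_def using False by (auto intro!: derivative_eq_intros simp: field_simps)
    from has_vector_derivative_real_field[OF this]
    show "((\<lambda>x. e2pi (of_int n * of_real x) / (2 * of_real pi * \<i> * of_int n)) has_vector_derivative
        e2pi (of_int n * of_real x)) (at x within {-1/2..1/2})"
      by (simp add: o_def has_vector_derivative_at_within)
  qed simp
  moreover have "e2pi (of_int n * of_real (1/2)) = e2pi (of_int n * of_real (-1/2))"
  proof -
    have "e2pi (of_int n * of_real (1/2)) = e2pi (of_int n * of_real (-1/2) + of_int n)"
      by (rule arg_cong[of _ _ e2pi]) (simp add: field_simps)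
    then show ?thesis by (simp only: e2pi_add e2pi_of_int mult_1_right)
  qed
  ultimately show ?thesis using False by (simp add: integral_unique)
qed (simp add: integral_const_real)

lemma gauss_int_translate_eq:
  fixes q :: real and y :: real
  assumes "q > 0"
  shows "complex_of_real (exp (- pi * (of_int m + y)\<^sup>2 / q))
    = exp (- of_real pi * of_real y ^ 2 / of_real q) * theta_term (1 / of_real q) (\<i> * of_real y / of_real q) m"
  unfolding theta_term_def exp_add [symmetric] exp_of_real [symmetric] using assms
  by (intro arg_cong[of _ _ exp]) (simp add: field_simps power2_eq_square)

text \<open>The periodised Gaussian f and the series g are continuous and have the same Fourier
  coefficients on a period, so they agree at 0. The free shift v makes this single point
  enough.\<close>

lemma poisson_gauss_real:
  fixes q v :: real
  assumes q: "q > 0"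
  shows "exp (- of_real pi * of_real v ^ 2 / of_real q) * theta_sum (1 / of_real q) (\<i> * of_real v / of_real q)
    = of_real (sqrt q) * theta_sum (of_real q) (of_real v)"
proof -
  define I where "I = {-1/2..1/2::real}"
  define \<phi> where "\<phi> y = complex_of_real (exp (- pi * (y + v)\<^sup>2 / q))" for y
  define f where "f x = (\<Sum>\<^sub>\<infinity>m::int. \<phi> (x + of_int m))" for x
  define g where "g x = (\<Sum>\<^sub>\<infinity>k::int. of_real (sqrt q) * theta_term (of_real q) (of_real v + of_real x) k)" for x
  have \<phi>_eq: "\<phi> (x + of_int m) = exp (- of_real pi * of_real (x + v) ^ 2 / of_real q)
        * theta_term (1 / of_real q) (\<i> * of_real (x + v) / of_real q) m" for x m
    unfolding \<phi>_def gauss_int_translate_eq[OF q, symmetric] by (simp add: add_ac)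
  have f_eq: "f x = exp (- of_real pi * of_real (x + v) ^ 2 / of_real q)
        * theta_sum (1 / of_real q) (\<i> * of_real (x + v) / of_real q)" for x
    unfolding f_def \<phi>_eq theta_sum_def by (rule infsum_cmult_right')
  have g_eq: "g x = of_real (sqrt q) * theta_sum (of_real q) (of_real v + of_real x)" for x
    unfolding g_def theta_sum_def by (rule infsum_cmult_right')
  have holf: "(\<lambda>t. theta_sum (1 / of_real q) (\<i> * (t + of_real v) / of_real q)) holomorphic_on UNIV"
    using q by (intro holomorphic_on_theta_sum holomorphic_intros) auto
  have holg: "(\<lambda>t. theta_sum (of_real q) (of_real v + t)) holomorphic_on UNIV"
    using q by (intro holomorphic_on_theta_sum holomorphic_intros) auto
  have cr: "continuous_on UNIV complex_of_real" by (intro continuous_intros)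
  have contf: "continuous_on UNIV f"
    unfolding f_eq using continuous_on_compose2[OF holomorphic_on_imp_continuous_on[OF holf] cr] q
    by (auto intro!: continuous_intros)
  have contg: "continuous_on UNIV g"
    unfolding g_eq using continuous_on_compose2[OF holomorphic_on_imp_continuous_on[OF holg] cr]
    by (auto intro!: continuous_intros)
  have cont\<phi>: "continuous_on UNIV \<phi>" unfolding \<phi>_def using q by (intro continuous_intros) auto
  have e1: "norm (e2pi (of_int k * of_real x)) = 1" for k x by (simp add: norm_e2pi)
  \<comment> \<open>The characters have period 1 and the translates of I tile the line, so the sum
    of integrals over I becomes the Fourier transform of the Gaussian.\<close>
  have coef_f: "integral I (\<lambda>x. f x * e2pi (of_int k * of_real x))
      = of_real (sqrt q * exp (- pi * q * (of_int k)\<^sup>2)) * e2pi (- of_int k * of_real v)" for k :: int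
  proof -
    define F where "F y = \<phi> y * e2pi (of_int k * of_real y)" for y
    have contF: "continuous_on UNIV F" unfolding F_def by (intro continuous_intros cont\<phi>)
    define M where "M = (1/2 + \<bar>v\<bar>) / q"
    define B where "B m = exp (- (pi * (1/q)) * real_of_int m ^ 2 + (2 * pi * M) * \<bar>real_of_int m\<bar>)" for m
    have bd: "norm (\<phi> (x + of_int m) * e2pi (of_int k * of_real x)) \<le> B m" if x: "x \<in> I" for m x
    proof -
      have "\<bar>x + v\<bar> \<le> 1/2 + \<bar>v\<bar>" using x unfolding I_def by auto
      then have Im: "\<bar>Im (\<i> * of_real (x + v) / of_real q)\<bar> \<le> M"
        unfolding M_def using q by (simp add: divide_right_mono)
      have n1: "norm (exp (- of_real pi * of_real (x + v) ^ 2 / complex_of_real q)) \<le> 1"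
      proof -
        have "exp (- of_real pi * of_real (x + v) ^ 2 / complex_of_real q) = of_real (exp (- pi * (x + v)\<^sup>2 / q))"
          by (simp add: exp_of_real [symmetric])
        then show ?thesis using q by simp
      qed
      have "norm (\<phi> (x + of_int m)) \<le> 1 * B m"
        unfolding \<phi>_eq norm_mult B_def using n1 Im q
        by (intro mult_mono norm_theta_term_le) auto
      then show ?thesis by (simp add: norm_mult e1)
    qed
    have smB: "B summable_on UNIV" unfolding B_def using q by (intro summable_on_gauss_int) simp
    have "((\<lambda>m. integral I (\<lambda>x. \<phi> (x + of_int m) * e2pi (of_int k * of_real x))) has_sum
       integral I (\<lambda>x. \<Sum>\<^sub>\<infinity>m. \<phi> (x + of_int m) * e2pi (of_int k * of_real x))) UNIV"
      unfolding I_def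
    proof (rule has_sum_integral_interval)
      show "continuous_on {-1/2..1/2} (\<lambda>x. \<phi> (x + of_int m) * e2pi (of_int k * of_real x))" for m
        by (intro continuous_intros continuous_on_compose2[OF cont\<phi>]) auto
    qed (use bd smB in \<open>auto simp: I_def\<close>)
    moreover have "integral I (\<lambda>x. \<phi> (x + of_int m) * e2pi (of_int k * of_real x))
        = integral {of_int m - 1/2..of_int m + 1/2} F" for m
    proof -
      have "(\<lambda>x. \<phi> (x + of_int m) * e2pi (of_int k * of_real x)) = F \<circ> ((+) (of_int m))"
      proof
        fix x :: real
        have "e2pi (of_int k * of_real (of_int m + x)) = e2pi (of_int k * of_real x + of_int (k * m))"
          by (rule arg_cong[of _ _ e2pi]) (simp add: algebra_simps)
        then show "\<phi> (x + of_int m) * e2pi (of_int k * of_real x) = (F \<circ> ((+) (of_int m))) x"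
          by (simp only: F_def o_def e2pi_add e2pi_of_int mult_1_right add.commute[of x])
      qed
      then show ?thesis
        using integral_shift_cbox_plus[of "-1/2" "1/2" F "of_int m"] unfolding I_def by (simp add: add_ac)
    qed
    moreover have "(\<lambda>x. \<Sum>\<^sub>\<infinity>m. \<phi> (x + of_int m) * e2pi (of_int k * of_real x)) = (\<lambda>x. f x * e2pi (of_int k * of_real x))"
      unfolding f_def by (rule ext, rule infsum_cmult_left')
    ultimately have "((\<lambda>m. integral {of_int m - 1/2..of_int m + 1/2} F) has_sum
        integral I (\<lambda>x. f x * e2pi (of_int k * of_real x))) UNIV" by simp
    from has_sum_int_imp_symmetric_limit[OF this]
    have l1: "(\<lambda>N::nat. integral {- real N - 1/2..real N + 1/2} F) \<longlonglongrightarrow> integral I (\<lambda>x. f x * e2pi (of_int k * of_real x))"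
      unfolding sum_unit_interval_integrals[OF contF] .
    \<comment> \<open>The character here has the opposite sign to the one in
      \<open>gauss_fourier\<close>, hence the frequency -k.\<close>
    have Fe: "F = (\<lambda>y. complex_of_real (exp (- pi * (y + v)\<^sup>2 / q)) * e2pi (- of_real (- of_int k) * of_real y))"
      unfolding F_def \<phi>_def by simp
    have l2: "(\<lambda>N::nat. integral {- real N - 1/2..real N + 1/2} F) \<longlonglongrightarrow>
        of_real (sqrt q * exp (- pi * q * (- of_int k)\<^sup>2)) * e2pi (of_real (- of_int k * v))"
      using symmetric_integral_limit[OF gauss_fourier(1)[OF q, of v "- of_int k"]]
      unfolding Fe gauss_fourier(2)[OF q] .
    from LIMSEQ_unique[OF l1 l2] show ?thesis by simp
  qed
  have coef_g: "integral I (\<lambda>x. g x * e2pi (of_int k * of_real x))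
      = of_real (sqrt q * exp (- pi * q * (of_int k)\<^sup>2)) * e2pi (- of_int k * of_real v)" for k :: int
  proof -
    define c where "c j = of_real (sqrt q * exp (- pi * q * (of_int j)\<^sup>2)) * e2pi (of_int j * of_real v)" for j :: int
    have tt: "of_real (sqrt q) * theta_term (of_real q) (of_real v + of_real x) j * e2pi (of_int k * of_real x)
       = c j * e2pi (of_int (j + k) * of_real x)" for j x
      unfolding c_def theta_term_def e2pi_def of_real_mult exp_of_real [symmetric] mult.assoc exp_add [symmetric]
      by (intro arg_cong2[of _ _ _ _ "(*)"] refl arg_cong[of _ _ exp]) (simp add: algebra_simps)
    have nc: "norm (c j) = sqrt q * exp (- (pi * q) * real_of_int j ^ 2 + 0 * \<bar>real_of_int j\<bar>)" for j
      unfolding c_def norm_mult e1 norm_of_real using q by simp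
    have "((\<lambda>j. integral I (\<lambda>x. c j * e2pi (of_int (j + k) * of_real x))) has_sum
       integral I (\<lambda>x. \<Sum>\<^sub>\<infinity>j. c j * e2pi (of_int (j + k) * of_real x))) UNIV"
      unfolding I_def
    proof (rule has_sum_integral_interval)
      show "continuous_on {-1/2..1/2} (\<lambda>x. c j * e2pi (of_int (j + k) * of_real x))" for j
        by (intro continuous_intros)
      show "norm (c j * e2pi (of_int (j + k) * of_real x)) \<le> norm (c j)" for j x
        by (simp only: norm_mult e1)
      show "(\<lambda>j. norm (c j)) summable_on UNIV"
        unfolding nc using q by (intro summable_on_cmult_right summable_on_gauss_int) simp
    qed
    moreover have "(\<lambda>j. integral I (\<lambda>x. c j * e2pi (of_int (j + k) * of_real x))) = (\<lambda>j. if j = -k then c (-k) else 0)"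
      unfolding I_def integral_mult_right integral_e2pi_int by auto
    moreover have "(\<lambda>x. \<Sum>\<^sub>\<infinity>j. c j * e2pi (of_int (j + k) * of_real x)) = (\<lambda>x. g x * e2pi (of_int k * of_real x))"
      unfolding tt [symmetric] g_def by (rule ext, rule infsum_cmult_left')
    ultimately have h: "((\<lambda>j. if j = -k then c (-k) else 0) has_sum integral I (\<lambda>x. g x * e2pi (of_int k * of_real x))) UNIV"
      by simp
    have "((\<lambda>j. if j = -k then c (-k) else 0) has_sum c (-k)) {-k}"
      using has_sum_finite[of "{-k}" "\<lambda>j. if j = -k then c (-k) else 0"] by simp
    then have "((\<lambda>j. if j = -k then c (-k) else 0) has_sum c (-k)) UNIV"
      by (rule has_sum_cong_neutral[THEN iffD1, rotated -1]) auto
    from has_sum_unique[OF h this] show ?thesis unfolding c_def by simp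
  qed
  have "f 0 - g 0 = 0"
  proof (rule fourier_uniqueness_at_0)
    show "continuous_on {-1/2..1/2} (\<lambda>x. f x - g x)"
      using contf contg by (intro continuous_on_diff) (auto elim: continuous_on_subset)
    fix k :: int
    have "integral I (\<lambda>x. f x * e2pi (of_int k * of_real x) - g x * e2pi (of_int k * of_real x)) = 0"
    proof (subst Henstock_Kurzweil_Integration.integral_diff)
      show "(\<lambda>x. f x * e2pi (of_int k * of_real x)) integrable_on I"
        unfolding I_def by (intro integrable_continuous_interval continuous_intros continuous_on_subset[OF contf]) auto
      show "(\<lambda>x. g x * e2pi (of_int k * of_real x)) integrable_on I"
        unfolding I_def by (intro integrable_continuous_interval continuous_intros continuous_on_subset[OF contg]) auto
    qed (simp only: coef_f coef_g diff_self)
    then show "integral {-1/2..1/2} (\<lambda>x. (f x - g x) * e2pi (of_int k * of_real x)) = 0"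
      unfolding I_def by (simp only: left_diff_distrib)
  qed
  then show ?thesis unfolding f_eq g_eq by simp
qed

lemma one_islimpt_positive_reals: "(1::complex) islimpt of_real ` {0<..}"
  unfolding islimpt_approachable
proof (intro allI impI)
  fix e :: real assume "e > 0"
  moreover have "dist (complex_of_real (1 + e / 2)) 1 = \<bar>e / 2\<bar>"
    unfolding dist_norm of_real_add add_diff_cancel_left' of_real_1 norm_of_real ..
  ultimately show "\<exists>x'\<in>complex_of_real ` {0<..}. x' \<noteq> 1 \<and> dist x' 1 < e"
    by (intro bexI[of _ "of_real (1 + e / 2)"] conjI imageI) (force, linarith, simp)
qed

lemma Re_inverse_pos: "Re s > 0 \<Longrightarrow> Re (1 / s) > 0"
proof -
  assume "Re s > 0"
  moreover from this have "(Re s)\<^sup>2 + (Im s)\<^sup>2 > 0" by (simp add: sum_power2_gt_zero_iff)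
  ultimately show ?thesis by (simp add: Re_divide)
qed

text \<open>The identity theorem is used twice: for real positive q the relation extends from real
  to complex z, and then for fixed z from real to complex q. Both times the positive reals with
  limit point 1 serve as the set of zeros.\<close>

lemma theta_sum_inversion:
  assumes "Re q > 0"
  shows "exp (- of_real pi * z ^ 2 / q) * theta_sum (1 / q) (\<i> * z / q) = csqrt q * theta_sum q z"
proof -
  define D where "D q z = exp (- of_real pi * z ^ 2 / q) * theta_sum (1 / q) (\<i> * z / q) - csqrt q * theta_sum q z" for q z
  have real: "D (of_real a) (of_real v) = 0" if "a > 0" for a v :: real
    unfolding D_def using poisson_gauss_real[OF that] that by (simp add: csqrt_of_real_nonneg)
  have real_q: "D (of_real a) z = 0" if a: "a > 0" for a :: real and z
  proof (rule analytic_continuation[of "D (of_real a)" UNIV "of_real ` {0<..}" 1])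
    show "D (of_real a) holomorphic_on UNIV"
      unfolding D_def using a by (intro holomorphic_intros holomorphic_on_theta_sum) auto
    show "\<And>w. w \<in> of_real ` {0<..} \<Longrightarrow> D (of_real a) w = 0"
      using real[OF a] by blast
    show "connected (UNIV::complex set)" by (rule convex_connected) simp
  qed (simp_all add: one_islimpt_positive_reals)
  have "D q z = 0"
  proof (rule analytic_continuation[of "\<lambda>q. D q z" "{t. Re t > 0}" "of_real ` {0<..}" 1])
    have nz: "t \<noteq> 0" if "Re t > 0" for t using that by auto
    have nn: "t \<notin> \<real>\<^sub>\<le>\<^sub>0" if "Re t > 0" for t using that complex_nonpos_Reals_iff by auto
    show "(\<lambda>q. D q z) holomorphic_on {t. Re t > 0}"
      unfolding D_def using Re_inverse_pos nz nn
      by (intro holomorphic_intros holomorphic_on_theta_sum) (simp_all add: open_halfspace_Re_gt)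
    show "connected {t. Re t > 0}" by (intro convex_connected convex_halfspace_Re_gt)
    show "of_real ` {0<..} \<subseteq> {t. Re t > 0}" by auto
    show "\<And>w. w \<in> of_real ` {0<..} \<Longrightarrow> D w z = 0" using real_q by blast
  qed (use assms in \<open>simp_all add: open_halfspace_Re_gt one_islimpt_positive_reals\<close>)
  then show ?thesis by (simp add: D_def)
qed

section \<open>Poisson summation for positive definite forms\<close>

text \<open>Brings the inversion formula into the form of a sum over shifted lattice points, as
  required when one variable is eliminated; m is reflected to turn + z into - z.\<close>

lemma theta_sum_poisson:
  assumes "Re q > 0"
  shows "csqrt q * theta_sum q z = (\<Sum>\<^sub>\<infinity>m::int. exp (- of_real pi * (of_int m - z) ^ 2 / q))"
proof -
  have q: "q \<noteq> 0" using assms by auto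
  have "exp (- of_real pi * z ^ 2 / q) * theta_sum (1 / q) (\<i> * z / q)
      = (\<Sum>\<^sub>\<infinity>m::int. exp (- of_real pi * (of_int m + z) ^ 2 / q))"
    unfolding theta_sum_def infsum_cmult_right' [symmetric] theta_term_def exp_add [symmetric]
    by (intro infsum_cong arg_cong[of _ _ exp]) (use q in \<open>simp add: field_simps power2_eq_square\<close>)
  also have "\<dots> = (\<Sum>\<^sub>\<infinity>m::int. exp (- of_real pi * (of_int (- m) + z) ^ 2 / q))"
    by (rule infsum_reindex_bij_betw[symmetric, where g = uminus and A = UNIV])
      (auto intro!: bij_betwI[of uminus _ _ uminus])
  also have "\<dots> = (\<Sum>\<^sub>\<infinity>m::int. exp (- of_real pi * (of_int m - z) ^ 2 / q))"
    by (intro infsum_cong arg_cong[of _ _ exp]) (simp add: power2_eq_square algebra_simps)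
  finally show ?thesis using theta_sum_inversion[OF assms] by simp
qed

section \<open>Summation over integer vectors, one coordinate at a time\<close>

lemma summable_on_mult_Times:
  fixes f :: "'a \<Rightarrow> real" and g :: "'b \<Rightarrow> real"
  assumes "f summable_on A" "g summable_on B" "\<And>x. f x \<ge> 0" "\<And>y. g y \<ge> 0"
  shows "(\<lambda>(x, y). f x * g y) summable_on A \<times> B"
proof (rule summable_on_SigmaI)
  show "((\<lambda>y. case (x, y) of (x, y) \<Rightarrow> f x * g y) has_sum f x * infsum g B) B" for x
    using assms(2) by (auto intro!: has_sum_cmult_right)
  show "(\<lambda>x. f x * infsum g B) summable_on A"
    by (rule summable_on_cmult_left[OF assms(1)])
qed (use assms in auto)

text \<open>Vectors with fewer variables stay functions on the full index type, so the induction
  over the variables never changes the type of the matrix.\<close>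

definition supported :: "'n set \<Rightarrow> ('n \<Rightarrow> int) set" where
  "supported F = {y. \<forall>i. i \<notin> F \<longrightarrow> y i = 0}"

lemma supported_UNIV [simp]: "supported UNIV = UNIV"
  by (auto simp: supported_def)

lemma supported_insert:
  assumes "i \<notin> F"
  shows "bij_betw (\<lambda>(k, y). y(i := k)) (UNIV \<times> supported F) (supported (insert i F))"
proof (rule bij_betwI[where g = "\<lambda>y. (y i, y(i := 0))"])
  show "(\<lambda>(k, y). y(i := k)) \<in> UNIV \<times> supported F \<rightarrow> supported (insert i F)"
    by (auto simp: supported_def)
  show "(\<lambda>y. (y i, y(i := 0))) \<in> supported (insert i F) \<rightarrow> UNIV \<times> supported F"
    by (auto simp: supported_def)
qed (use assms in \<open>auto simp: supported_def fun_eq_iff\<close>)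

lemma summable_on_prod_supported:
  fixes g :: "int \<Rightarrow> real"
  assumes "g summable_on UNIV" "\<And>k. g k \<ge> 0" "finite F"
  shows "(\<lambda>y. \<Prod>i\<in>F. g (y i)) summable_on supported F"
  using assms(3)
proof (induction F)
  case empty
  have "supported {} = {\<lambda>i::'a. 0}" by (auto simp: supported_def)
  then show ?case by simp
next
  case (insert i F)
  have "(\<lambda>y. \<Prod>j\<in>insert i F. g (y j)) summable_on supported (insert i F) \<longleftrightarrow>
     (\<lambda>(k, y). g k * (\<Prod>j\<in>F. g (y j))) summable_on UNIV \<times> supported F"
    unfolding summable_on_reindex_bij_betw[OF supported_insert[OF insert(2)], symmetric]
    by (rule summable_on_cong) (use insert in \<open>auto intro!: arg_cong2[of _ _ _ _ "(*)"] prod.cong\<close>)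
  also have "\<dots>"
    using insert assms by (intro summable_on_mult_Times prod_nonneg) auto
  finally show ?case .
qed

text \<open>Polymorphic in the scalars: real vectors serve the estimates, complex ones the
  parameters of Poisson summation.\<close>

definition qform :: "real^'n^'n \<Rightarrow> ('n \<Rightarrow> 'a::real_normed_field) \<Rightarrow> 'a" where
  "qform Q u = (\<Sum>i\<in>UNIV. \<Sum>j\<in>UNIV. of_real (Q $ i $ j) * u i * u j)"

definition mvec :: "real^'n^'n \<Rightarrow> ('n \<Rightarrow> 'a::real_normed_field) \<Rightarrow> 'n \<Rightarrow> 'a" where
  "mvec Q u i = (\<Sum>j\<in>UNIV. of_real (Q $ i $ j) * u j)"

lemma qform_mvec: "qform Q u = (\<Sum>i\<in>UNIV. u i * mvec Q u i)"
  unfolding qform_def mvec_def by (simp add: sum_distrib_left mult_ac)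

lemma sum_mvec_symmetric:
  assumes "transpose Q = Q"
  shows "(\<Sum>i\<in>UNIV. v i * mvec Q u i) = (\<Sum>i\<in>UNIV. mvec Q v i * u i)"
proof -
  have "Q $ j $ i = Q $ i $ j" for i j
    using assms by (metis transpose_def vec_lambda_beta)
  then show ?thesis
    unfolding mvec_def sum_distrib_left sum_distrib_right
    by (subst sum.swap) (simp add: mult_ac)
qed

lemma qform_of_real: "qform Q (\<lambda>i. of_real (x i)) = of_real (qform Q x)"
  unfolding qform_def by simp

lemma qform_inner: "qform Q (($) x) = x \<bullet> (Q *v x)"
  unfolding qform_def by (simp add: inner_vec_def matrix_vector_mult_def sum_distrib_left mult_ac)

lemma pos_def_mat_qform:
  "pos_def_mat Q \<longleftrightarrow> transpose Q = Q \<and> (\<forall>x::'n \<Rightarrow> real. x \<noteq> (\<lambda>i. 0) \<longrightarrow> qform Q x > 0)" for Q :: "real^'n^'n"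
proof -
  have "(\<forall>x. x \<noteq> 0 \<longrightarrow> x \<bullet> (Q *v x) > 0) \<longleftrightarrow> (\<forall>x::'n \<Rightarrow> real. x \<noteq> (\<lambda>i. 0) \<longrightarrow> qform Q x > 0)" (is "?L \<longleftrightarrow> ?R")
  proof
    assume L: ?L
    show ?R
    proof (intro allI impI)
      fix x :: "'n \<Rightarrow> real" assume "x \<noteq> (\<lambda>i. 0)"
      then have "vec_lambda x \<noteq> 0" by (auto simp: vec_eq_iff fun_eq_iff)
      then have "qform Q (($) (vec_lambda x)) > 0" using L unfolding qform_inner by blast
      then show "qform Q x > 0" by (simp add: vec_lambda_inverse)
    qed
  next
    assume R: ?R
    show ?L
    proof (intro allI impI)
      fix x :: "real^'n" assume "x \<noteq> 0"
      then have "($) x \<noteq> (\<lambda>i. 0)" by (auto simp: vec_eq_iff fun_eq_iff)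
      then show "x \<bullet> (Q *v x) > 0" using R unfolding qform_inner [symmetric] by blast
    qed
  qed
  then show ?thesis unfolding pos_def_mat_def by blast
qed

text \<open>The constant is the minimum of the form on the compact unit sphere; homogeneity extends
  the bound.\<close>

lemma pos_def_lower_bound:
  fixes Q :: "real^'n^'n"
  assumes "pos_def_mat Q"
  shows "\<exists>c>0. \<forall>x::'n \<Rightarrow> real. c * (\<Sum>i\<in>UNIV. (x i)\<^sup>2) \<le> qform Q x"
proof -
  have "continuous_on (sphere 0 1) (\<lambda>x::real^'n. x \<bullet> (Q *v x))"
    by (intro continuous_intros linear_continuous_on matrix_vector_mul_bounded_linear)
  moreover have "sphere (0::real^'n) 1 \<noteq> {}" by simp
  ultimately have "\<exists>x\<in>sphere 0 1. \<forall>y\<in>sphere 0 1. x \<bullet> (Q *v x) \<le> y \<bullet> (Q *v y)"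
    by (intro continuous_attains_inf compact_sphere)
  then obtain x0 :: "real^'n" where x0: "x0 \<in> sphere 0 1"
      "\<And>x. x \<in> sphere 0 1 \<Longrightarrow> x0 \<bullet> (Q *v x0) \<le> x \<bullet> (Q *v x)"
    by blast
  define c where "c = x0 \<bullet> (Q *v x0)"
  have "x0 \<noteq> 0" using x0 by auto
  then have c: "c > 0" using assms unfolding pos_def_mat_def c_def by blast
  have "c * (\<Sum>i\<in>UNIV. (x i)\<^sup>2) \<le> qform Q x" for x :: "'n \<Rightarrow> real"
  proof -
    define v where "v = (vec_lambda x :: real^'n)"
    have qv: "qform Q x = v \<bullet> (Q *v v)" unfolding qform_inner [symmetric] v_def by (simp add: vec_lambda_inverse)
    have nv: "(\<Sum>i\<in>UNIV. (x i)\<^sup>2) = (norm v)\<^sup>2"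
      unfolding v_def power2_norm_eq_inner by (simp add: inner_vec_def power2_eq_square)
    show ?thesis
    proof (cases "v = 0")
      case True
      then show ?thesis unfolding qv nv by simp
    next
      case False
      then have "c \<le> (v /\<^sub>R norm v) \<bullet> (Q *v (v /\<^sub>R norm v))"
        unfolding c_def by (intro x0(2)) simp
      also have "\<dots> = (v \<bullet> (Q *v v)) / (norm v)\<^sup>2"
        by (simp add: matrix_vector_mult_scaleR power2_eq_square field_simps)
      finally show ?thesis unfolding qv nv using False by (simp add: field_simps)
    qed
  qed
  with c show ?thesis by blast
qed

text \<open>The lower bound for the form dominates each term by a product of one-variable Gaussians,
  M being a common bound for all |b i|.\<close>

lemma summable_on_gauss_qform:
  fixes Q :: "real^'n^'n" and b :: "'n \<Rightarrow> real"
  assumes "pos_def_mat Q"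
  shows "(\<lambda>y::'n \<Rightarrow> int. exp (- qform Q (\<lambda>i. real_of_int (y i)) + (\<Sum>i\<in>UNIV. b i * real_of_int (y i)))) summable_on X"
proof -
  obtain c where c: "c > 0" "\<And>x::'n \<Rightarrow> real. c * (\<Sum>i\<in>UNIV. (x i)\<^sup>2) \<le> qform Q x"
    using pos_def_lower_bound[OF assms] by blast
  define M where "M = (\<Sum>i\<in>UNIV. \<bar>b i\<bar>)"
  have bM: "\<bar>b i\<bar> \<le> M" for i unfolding M_def by (intro member_le_sum) auto
  define g where "g k = exp (- c * real_of_int k ^ 2 + M * \<bar>real_of_int k\<bar>)" for k
  have "(\<lambda>y. \<Prod>i\<in>UNIV. g (y i)) summable_on (supported UNIV :: ('n \<Rightarrow> int) set)"
    unfolding g_def using c by (intro summable_on_prod_supported summable_on_gauss_int) auto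
  then have "(\<lambda>y::'n \<Rightarrow> int. \<Prod>i\<in>UNIV. g (y i)) summable_on UNIV" by simp
  moreover have "exp (- qform Q (\<lambda>i. real_of_int (y i)) + (\<Sum>i\<in>UNIV. b i * real_of_int (y i))) \<le> (\<Prod>i\<in>UNIV. g (y i))" for y
  proof -
    have "b i * real_of_int (y i) \<le> M * \<bar>real_of_int (y i)\<bar>" for i
    proof -
      have "b i * real_of_int (y i) \<le> \<bar>b i\<bar> * \<bar>real_of_int (y i)\<bar>" by (metis abs_ge_self abs_mult)
      also have "\<dots> \<le> M * \<bar>real_of_int (y i)\<bar>" by (intro mult_right_mono bM) auto
      finally show ?thesis .
    qed
    then have "(\<Sum>i\<in>UNIV. b i * real_of_int (y i)) \<le> (\<Sum>i\<in>UNIV. M * \<bar>real_of_int (y i)\<bar>)"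
      by (rule sum_mono)
    then have "- qform Q (\<lambda>i. real_of_int (y i)) + (\<Sum>i\<in>UNIV. b i * real_of_int (y i))
       \<le> (\<Sum>i\<in>UNIV. - c * real_of_int (y i) ^ 2 + M * \<bar>real_of_int (y i)\<bar>)"
      using c(2)[of "\<lambda>i. real_of_int (y i)"] by (simp add: sum.distrib sum_distrib_left sum_negf sum_subtractf)
    then show ?thesis unfolding g_def by (subst exp_sum [symmetric]) simp_all
  qed
  ultimately have "(\<lambda>y::'n \<Rightarrow> int. exp (- qform Q (\<lambda>i. real_of_int (y i)) + (\<Sum>i\<in>UNIV. b i * real_of_int (y i)))) summable_on UNIV"
    by (rule summable_on_comparison_test) auto
  then show ?thesis by (rule summable_on_subset_banach) simp
qed

lemma pos_def_mat_scaleR: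
  fixes Q :: "real^'n^'n"
  assumes "pos_def_mat Q" "c > 0"
  shows "pos_def_mat (c *\<^sub>R Q)"
proof -
  have "qform (c *\<^sub>R Q) x = c * qform Q x" for x :: "'n \<Rightarrow> real"
    unfolding qform_def by (simp add: sum_distrib_left mult_ac)
  then show ?thesis using assms unfolding pos_def_mat_qform by (auto simp: transpose_scalar)
qed

lemma qform_scaleR: "qform (c *\<^sub>R Q) u = of_real c * qform Q u"
  unfolding qform_def by (simp add: sum_distrib_left mult_ac)

definition gauss_term :: "complex \<Rightarrow> real^'n^'n \<Rightarrow> ('n \<Rightarrow> complex) \<Rightarrow> ('n \<Rightarrow> int) \<Rightarrow> complex" where
  "gauss_term s Q u y = exp (- of_real pi * s * qform Q (\<lambda>i. of_int (y i)) + 2 * of_real pi * \<i> * (\<Sum>i\<in>UNIV. u i * of_int (y i)))"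

lemma gauss_term_abs_summable:
  fixes Q :: "real^'n^'n"
  assumes "pos_def_mat Q" "Re s > 0"
  shows "(\<lambda>y. norm (gauss_term s Q u y)) summable_on X"
proof -
  have "norm (gauss_term s Q u y)
     = exp (- qform ((pi * Re s) *\<^sub>R Q) (\<lambda>i. real_of_int (y i)) + (\<Sum>i\<in>UNIV. (- 2 * pi * Im (u i)) * real_of_int (y i)))" for y
  proof -
    have "qform Q (\<lambda>i. of_int (y i)) = complex_of_real (qform Q (\<lambda>i. real_of_int (y i)))"
      unfolding qform_of_real [symmetric] by simp
    then show ?thesis
      unfolding gauss_term_def qform_scaleR
      by (simp add: Im_sum sum_distrib_left sum_negf algebra_simps)
  qed
  moreover have "pos_def_mat ((pi * Re s) *\<^sub>R Q)" using assms by (intro pos_def_mat_scaleR) auto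
  ultimately show ?thesis using summable_on_gauss_qform by (simp only:)
qed

lemma transpose_eq_entry: "transpose Q = Q \<Longrightarrow> Q $ j $ i = Q $ i $ j"
  by (drule arg_cong[of _ _ "\<lambda>M. M $ i $ j"]) (simp add: transpose_def)

lemma matrix_inv_inverse:
  fixes Q :: "real^'n^'n"
  assumes "invertible Q"
  shows "Q ** matrix_inv Q = mat 1" "matrix_inv Q ** Q = mat 1"
proof -
  have "Q ** matrix_inv Q = mat 1 \<and> matrix_inv Q ** Q = mat 1"
    unfolding matrix_inv_def using assms[unfolded invertible_def] by (rule someI_ex)
  then show "Q ** matrix_inv Q = mat 1" "matrix_inv Q ** Q = mat 1" by auto
qed

lemma pos_def_invertible:
  fixes Q :: "real^'n^'n"
  assumes "pos_def_mat Q"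
  shows "invertible Q"
  unfolding invertible_left_inverse matrix_left_invertible_ker
proof (intro allI impI)
  fix x assume "Q *v x = 0"
  then have 0: "x \<bullet> (Q *v x) = 0" by simp
  show "x = 0"
  proof (rule ccontr)
    assume "x \<noteq> 0"
    then have "x \<bullet> (Q *v x) > 0" using assms unfolding pos_def_mat_def by blast
    with 0 show False by simp
  qed
qed

lemma mvec_mult: "mvec A (mvec B u) = mvec (A ** B) u"
  unfolding mvec_def matrix_matrix_mult_def
  by (rule ext) (simp add: sum_distrib_left sum_distrib_right mult_ac, rule sum.swap)

lemma mvec_mat_1 [simp]: "mvec (mat 1) u = u"
  unfolding mvec_def mat_def by (rule ext) (simp add: if_distrib if_distribR sum.delta cong: if_cong)

lemma mvec_matrix_inv:
  fixes Q :: "real^'n^'n"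
  assumes "pos_def_mat Q"
  shows "mvec Q (mvec (matrix_inv Q) u) = u" "mvec (matrix_inv Q) (mvec Q u) = u"
  using matrix_inv_inverse[OF pos_def_invertible[OF assms]] by (simp_all add: mvec_mult)

lemma qform_matrix_inv:
  fixes Q :: "real^'n^'n"
  assumes "pos_def_mat Q"
  shows "qform (matrix_inv Q) (mvec Q u) = qform Q u"
  unfolding qform_mvec mvec_matrix_inv[OF assms] by (simp add: mult.commute)

lemma transpose_matrix_inv:
  fixes Q :: "real^'n^'n"
  assumes "pos_def_mat Q"
  shows "transpose (matrix_inv Q) = matrix_inv Q"
proof -
  have Q: "transpose Q = Q" using assms by (simp add: pos_def_mat_def)
  note inv = matrix_inv_inverse[OF pos_def_invertible[OF assms]]
  have "transpose (matrix_inv Q) ** Q = mat 1"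
    using arg_cong[OF inv(1), of transpose] by (simp add: matrix_transpose_mul Q)
  then have "(transpose (matrix_inv Q) ** Q) ** matrix_inv Q = matrix_inv Q" by simp
  then show ?thesis unfolding matrix_mul_assoc [symmetric] inv(1) by simp
qed

lemma pos_def_matrix_inv:
  fixes Q :: "real^'n^'n"
  assumes "pos_def_mat Q"
  shows "pos_def_mat (matrix_inv Q)"
  unfolding pos_def_mat_qform
proof (intro conjI allI impI)
  show "transpose (matrix_inv Q) = matrix_inv Q" by (rule transpose_matrix_inv[OF assms])
  fix x :: "'n \<Rightarrow> real" assume x: "x \<noteq> (\<lambda>i. 0)"
  define u where "u = mvec (matrix_inv Q) x"
  have xu: "x = mvec Q u" unfolding u_def mvec_matrix_inv[OF assms] ..
  have "u \<noteq> (\<lambda>i. 0)" using x unfolding xu by (auto simp: mvec_def)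
  then have "qform Q u > 0" using assms unfolding pos_def_mat_qform by blast
  then show "qform (matrix_inv Q) x > 0" unfolding xu qform_matrix_inv[OF assms] .
qed

section \<open>Elimination of one variable by a Schur complement\<close>

definition pivot :: "'n \<Rightarrow> real^'n^'n \<Rightarrow> 'n \<Rightarrow> real" where
  "pivot i Q j = Q $ i $ j / Q $ i $ i"

text \<open>Row and column i are replaced by those of the identity instead of being deleted, so the
  complement keeps the size of Q and its determinant, inverse and positivity make sense in the same
  type.\<close>

definition schur :: "'n \<Rightarrow> real^'n^'n \<Rightarrow> real^'n^'n" where
  "schur i Q = (\<chi> j k. if j = i \<or> k = i then (if j = k then 1 else 0) else Q $ j $ k - Q $ i $ i * pivot i Q j * pivot i Q k)"

lemma mvec_pivot:
  assumes "Q $ i $ i \<noteq> 0"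
  shows "mvec Q u i = of_real (Q $ i $ i) * (\<Sum>j\<in>UNIV. of_real (pivot i Q j) * u j)"
  unfolding mvec_def pivot_def sum_distrib_left using assms by (intro sum.cong) auto

text \<open>Completion of the square in the variable i.\<close>

lemma qform_schur:
  assumes Q: "transpose Q = Q" "Q $ i $ i \<noteq> 0"
  shows "qform Q u = of_real (Q $ i $ i) * (\<Sum>j\<in>UNIV. of_real (pivot i Q j) * u j)\<^sup>2 + qform (schur i Q) (u(i := 0))"
proof -
  have p: "of_real (schur i Q $ j $ k) * (u(i := 0)) j * (u(i := 0)) k
     = of_real (Q $ j $ k) * u j * u k - of_real (Q $ i $ i) * ((of_real (pivot i Q j) * u j) * (of_real (pivot i Q k) * u k))" for j k
    using Q(2) transpose_eq_entry[OF Q(1), of i j] by (auto simp: schur_def pivot_def algebra_simps)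
  show ?thesis
    unfolding qform_def p sum_subtractf power2_eq_square sum_product by (simp add: sum_distrib_left)
qed

text \<open>For w = Q u this identifies the vector that the inverse of the complement sends back to
  \<open>u(i := 0)\<close>, so that inverse never has to be computed.\<close>

lemma mvec_schur:
  assumes Q: "transpose Q = Q" "Q $ i $ i \<noteq> 0"
  shows "mvec (schur i Q) (u(i := 0)) = (\<lambda>j. if j = i then 0 else mvec Q u j - of_real (pivot i Q j) * mvec Q u i)"
proof
  fix j
  show "mvec (schur i Q) (u(i := 0)) j = (if j = i then 0 else mvec Q u j - of_real (pivot i Q j) * mvec Q u i)"
  proof (cases "j = i")
    case True
    then show ?thesis unfolding mvec_def schur_def by (auto intro!: sum.neutral)
  next
    case False
    then have "of_real (schur i Q $ j $ k) * (u(i := 0)) k = of_real (Q $ j $ k) * u k - of_real (pivot i Q j) * (of_real (Q $ i $ k) * u k)" for k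
      using Q(2) transpose_eq_entry[OF Q(1), of i j] by (auto simp: schur_def pivot_def algebra_simps)
    then show ?thesis
      using False unfolding mvec_def sum_distrib_left by (simp add: sum_subtractf)
  qed
qed

lemma pos_def_diag:
  fixes Q :: "real^'n^'n"
  assumes "pos_def_mat Q"
  shows "Q $ i $ i > 0"
proof -
  define x :: "'n \<Rightarrow> real" where "x j = (if j = i then 1 else 0)" for j
  have "x \<noteq> (\<lambda>j. 0)" by (auto simp: x_def fun_eq_iff)
  then have "qform Q x > 0" using assms unfolding pos_def_mat_qform by blast
  moreover have "qform Q x = Q $ i $ i"
  proof -
    have "of_real (Q $ j $ k) * x j * x k = (if k = i then (if j = i then Q $ i $ i else 0) else 0)" for j k
      by (auto simp: x_def)
    then show ?thesis unfolding qform_def by (simp add: sum.delta)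
  qed
  ultimately show ?thesis by simp
qed

lemma pos_def_schur:
  fixes Q :: "real^'n^'n"
  assumes pd: "pos_def_mat Q"
  shows "pos_def_mat (schur i Q)"
  unfolding pos_def_mat_qform
proof (intro conjI allI impI)
  have Q: "transpose Q = Q" "Q $ i $ i \<noteq> 0" using pd pos_def_diag[OF pd, of i] by (auto simp: pos_def_mat_def)
  show "transpose (schur i Q) = schur i Q"
    unfolding transpose_def schur_def using transpose_eq_entry[OF Q(1)] by (auto simp: vec_eq_iff)
  fix x :: "'n \<Rightarrow> real" assume x: "x \<noteq> (\<lambda>j. 0)"
  have split: "qform (schur i Q) x = (x i)\<^sup>2 + qform (schur i Q) (x(i := 0))"
  proof -
    have "of_real (schur i Q $ j $ k) * x j * x k = (if k = i then (if j = i then (x i)\<^sup>2 else 0) else 0)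
       + of_real (schur i Q $ j $ k) * (x(i := 0)) j * (x(i := 0)) k" for j k
      by (auto simp: schur_def power2_eq_square)
    then show ?thesis unfolding qform_def by (simp add: sum.distrib sum.delta)
  qed
  \<comment> \<open>The entry at i is chosen so that the square split off by
    \<open>qform_schur\<close> vanishes.\<close>
  define w where "w = x(i := - (\<Sum>j\<in>UNIV - {i}. pivot i Q j * x j))"
  have "(\<Sum>j\<in>UNIV. pivot i Q j * w j) = pivot i Q i * w i + (\<Sum>j\<in>UNIV - {i}. pivot i Q j * w j)"
    by (rule sum.remove) auto
  also have "(\<Sum>j\<in>UNIV - {i}. pivot i Q j * w j) = (\<Sum>j\<in>UNIV - {i}. pivot i Q j * x j)"
    by (intro sum.cong) (auto simp: w_def)
  also have "pivot i Q i = 1" using Q by (simp add: pivot_def)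
  finally have w0: "(\<Sum>j\<in>UNIV. pivot i Q j * w j) = 0" by (simp add: w_def)
  have qw: "qform Q w = qform (schur i Q) (x(i := 0))"
    unfolding qform_schur[OF Q, of w] using w0 by (simp add: w_def)
  show "qform (schur i Q) x > 0"
  proof (cases "w = (\<lambda>j. 0)")
    case True
    have xj: "x j = 0" if "j \<noteq> i" for j using fun_cong[OF True, of j] that by (simp add: w_def)
    have "x i \<noteq> 0"
    proof
      assume "x i = 0"
      then have "x j = 0" for j using xj[of j] by (cases "j = i") auto
      then show False using x by auto
    qed
    then show ?thesis unfolding split qw [symmetric] using True by (simp add: qform_def)
  next
    case False
    then have "qform Q w > 0" using pd unfolding pos_def_mat_qform by blast
    then show ?thesis unfolding split qw by (simp add: add_nonneg_pos)
  qed
qed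

text \<open>The completed square is a congruence Q = G^T P G: P is the complement with the pivot put
  back at (i, i), and G is the identity with the pivots in row i, of determinant 1.\<close>

lemma det_schur:
  fixes Q :: "real^'n^'n"
  assumes Q: "transpose Q = Q" "Q $ i $ i \<noteq> 0"
  shows "det Q = Q $ i $ i * det (schur i Q)"
proof -
  define r where "r j = (if j = i then 0 else pivot i Q j)" for j
  define G :: "real^'n^'n" where "G = (\<chi> k. if k = i then row i (mat 1) + (\<chi> j. r j) else row k (mat 1))"
  define P :: "real^'n^'n" where "P = (\<chi> k. if k = i then Q $ i $ i *s schur i Q $ i else schur i Q $ k)"
  have Gjk: "G $ j $ k = (if j = k then 1 else 0) + (if j = i then r k else 0)" for j k
    unfolding G_def by (simp add: row_def mat_def)
  have Pjk: "P $ j $ k = (if j = i then (if k = i then Q $ i $ i else 0) else schur i Q $ j $ k)" for j k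
    unfolding P_def by (simp add: schur_def)
  have PG: "(P ** G) $ l $ k = P $ l $ k + (if l = i then Q $ i $ i * r k else 0)" for l k
  proof -
    have "(P ** G) $ l $ k = (\<Sum>m\<in>UNIV. (if m = k then P $ l $ k else 0) + (if m = i then P $ l $ i * r k else 0))"
      unfolding matrix_matrix_mult_def by (auto intro!: sum.cong simp: Gjk algebra_simps)
    also have "\<dots> = P $ l $ k + P $ l $ i * r k" by (simp add: sum.distrib sum.delta)
    finally show ?thesis by (auto simp: Pjk schur_def)
  qed
  have "(transpose G ** (P ** G)) $ j $ k = Q $ j $ k" for j k
  proof -
    have "(transpose G ** (P ** G)) $ j $ k
        = (\<Sum>l\<in>UNIV. (if l = j then (P ** G) $ j $ k else 0) + (if l = i then r j * (P ** G) $ i $ k else 0))"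
      by (subst matrix_matrix_mult_def) (auto intro!: sum.cong simp: Gjk transpose_def algebra_simps)
    also have "\<dots> = (P ** G) $ j $ k + r j * (P ** G) $ i $ k" by (simp add: sum.distrib sum.delta)
    finally show ?thesis
      unfolding PG Pjk schur_def r_def pivot_def using Q(2) transpose_eq_entry[OF Q(1), of i j]
      by (auto simp: field_simps)
  qed
  then have "Q = transpose G ** (P ** G)" by (simp add: vec_eq_iff)
  then have "det Q = det (transpose G ** (P ** G))" by (rule arg_cong)
  then have "det Q = det G * (det P * det G)" by (simp only: det_mul det_transpose)
  moreover have "det G = 1"
  proof -
    have "(\<chi> j. r j) = (\<Sum>j\<in>UNIV - {i}. r j *s row j (mat 1))"
    proof -
      have "(\<Sum>j\<in>UNIV - {i}. r j * (if j = k then 1 else 0)) = r k" for k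
        by (cases "k = i") (auto simp: r_def if_distrib sum.delta' cong: if_cong)
      then show ?thesis by (simp add: vec_eq_iff row_def mat_def)
    qed
    also have "\<dots> \<in> vec.span {row j (mat 1) |j. j \<noteq> i}"
      by (intro vec.span_sum vec.span_scale vec.span_base) auto
    finally show ?thesis unfolding G_def by (subst det_row_span) simp_all
  qed
  moreover have "det P = Q $ i $ i * det (schur i Q)"
  proof -
    have "(\<chi> k. if k = i then schur i Q $ i else schur i Q $ k) = schur i Q" by (simp add: vec_eq_iff)
    then show ?thesis unfolding P_def det_row_mul by simp
  qed
  ultimately show ?thesis by simp
qed

text \<open>A positive factor does not change the argument, so the principal branch is kept; the
  induction below then accumulates a plain power of \<open>csqrt s\<close>.\<close>

lemma csqrt_mult_of_real: "q > 0 \<Longrightarrow> csqrt (s * of_real q) = csqrt s * of_real (sqrt q)"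
  using csqrt_principal[of s]
  by (intro csqrt_unique) (auto simp: power_mult_distrib simp flip: of_real_power)

definition dual_term :: "complex \<Rightarrow> real^'n^'n \<Rightarrow> ('n \<Rightarrow> complex) \<Rightarrow> ('n \<Rightarrow> int) \<Rightarrow> complex" where
  "dual_term s Q u m = exp (- of_real pi / s * qform (matrix_inv Q) (\<lambda>i. of_int (m i) - u i))"

lemma qform_diff:
  assumes "transpose R = R"
  shows "qform R (\<lambda>i. a i - b i) = qform R a - 2 * (\<Sum>i\<in>UNIV. mvec R b i * a i) + qform R b"
proof -
  have m: "mvec R (\<lambda>i. a i - b i) j = mvec R a j - mvec R b j" for j
    unfolding mvec_def by (simp add: algebra_simps sum_subtractf)
  have "qform R (\<lambda>i. a i - b i) = (\<Sum>i\<in>UNIV. a i * mvec R a i) - (\<Sum>i\<in>UNIV. a i * mvec R b i)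
     - (\<Sum>i\<in>UNIV. b i * mvec R a i) + (\<Sum>i\<in>UNIV. b i * mvec R b i)"
    unfolding qform_mvec m by (simp add: algebra_simps sum_subtractf sum.distrib)
  also have "(\<Sum>i\<in>UNIV. b i * mvec R a i) = (\<Sum>i\<in>UNIV. mvec R b i * a i)"
    by (rule sum_mvec_symmetric[OF assms])
  finally show ?thesis unfolding qform_mvec by (simp add: mult.commute)
qed

text \<open>The dual term is itself a Gaussian term for the inverse matrix at 1 / s, which yields
  its summability.\<close>

lemma dual_term_eq_gauss_term:
  fixes Q :: "real^'n^'n"
  assumes "pos_def_mat Q" "s \<noteq> 0"
  shows "dual_term s Q u m = exp (- of_real pi / s * qform (matrix_inv Q) u)
    * gauss_term (1 / s) (matrix_inv Q) (\<lambda>i. - \<i> / s * mvec (matrix_inv Q) u i) m"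
proof -
  define A where "A = qform (matrix_inv Q) (\<lambda>i. complex_of_int (m i))"
  define B where "B = (\<Sum>i\<in>UNIV. mvec (matrix_inv Q) u i * complex_of_int (m i))"
  define C where "C = qform (matrix_inv Q) u"
  have l: "(\<Sum>i\<in>UNIV. - \<i> / s * mvec (matrix_inv Q) u i * of_int (m i)) = - \<i> / s * B"
    unfolding B_def sum_distrib_left by (simp add: mult.assoc)
  have "- of_real pi / s * (A - 2 * B + C)
    = - of_real pi / s * C + (- of_real pi * (1 / s) * A + 2 * of_real pi * \<i> * (- \<i> / s * B))"
    using assms(2) by (simp add: field_simps)
  then show ?thesis
    unfolding dual_term_def gauss_term_def qform_diff[OF transpose_matrix_inv[OF assms(1)]] l
      exp_add [symmetric] A_def [symmetric] B_def [symmetric] C_def [symmetric] by simp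
qed

lemma dual_term_abs_summable:
  fixes Q :: "real^'n^'n"
  assumes "pos_def_mat Q" "Re s > 0"
  shows "(\<lambda>m. norm (dual_term s Q u m)) summable_on X"
proof -
  have s0: "s \<noteq> 0" using assms by auto
  show ?thesis
    unfolding dual_term_eq_gauss_term[OF assms(1) s0] norm_mult
    by (intro summable_on_cmult_right gauss_term_abs_summable pos_def_matrix_inv assms Re_inverse_pos)
qed

text \<open>Under w = Q u the inverse form becomes the form itself, where the square has been
  completed already.\<close>

lemma qform_matrix_inv_schur:
  fixes Q :: "real^'n^'n"
  assumes pd: "pos_def_mat Q"
  shows "qform (matrix_inv Q) w = (w i)\<^sup>2 / of_real (Q $ i $ i)
    + qform (matrix_inv (schur i Q)) (\<lambda>j. if j = i then 0 else w j - of_real (pivot i Q j) * w i)"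
proof -
  have Q: "transpose Q = Q" "Q $ i $ i \<noteq> 0" using pd pos_def_diag[OF pd, of i] by (auto simp: pos_def_mat_def)
  define u where "u = mvec (matrix_inv Q) w"
  have w: "w = mvec Q u" unfolding u_def mvec_matrix_inv[OF pd] ..
  have "qform (matrix_inv (schur i Q)) (\<lambda>j. if j = i then 0 else w j - of_real (pivot i Q j) * w i) = qform (schur i Q) (u(i := 0))"
    unfolding w mvec_schur[OF Q, symmetric] by (rule qform_matrix_inv[OF pos_def_schur[OF pd]])
  moreover have "(w i)\<^sup>2 / of_real (Q $ i $ i) = of_real (Q $ i $ i) * (\<Sum>j\<in>UNIV. of_real (pivot i Q j) * u j)\<^sup>2"
    unfolding w mvec_pivot[OF Q(2)] using Q(2) by (simp add: power2_eq_square field_simps)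
  ultimately show ?thesis
    unfolding w qform_matrix_inv[OF pd] qform_schur[OF Q, of u] by simp
qed

text \<open>The cross term 2 k \<rho> of the completed square is absorbed into the elliptic argument
  of the theta function as the shift i s q \<rho>.\<close>

lemma gauss_term_split:
  fixes Q :: "real^'n^'n"
  assumes pd: "pos_def_mat Q" and y: "y i = 0"
  defines "q \<equiv> complex_of_real (Q $ i $ i)"
  defines "\<rho> \<equiv> (\<Sum>j\<in>UNIV. of_real (pivot i Q j) * complex_of_int (y j))"
  shows "gauss_term s Q u (y(i := k)) = (exp (- of_real pi * s * q * \<rho>\<^sup>2) * gauss_term s (schur i Q) u y)
     * theta_term (s * q) (u i + \<i> * s * q * \<rho>) k"
proof -
  have Q: "transpose Q = Q" "Q $ i $ i \<noteq> 0" using pd pos_def_diag[OF pd, of i] by (auto simp: pos_def_mat_def)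
  have z: "(\<lambda>j. complex_of_int ((y(i := k)) j))(i := 0) = (\<lambda>j. of_int (y j))" using y by (auto simp: fun_eq_iff)
  have s1: "(\<Sum>j\<in>UNIV. c j * complex_of_int ((y(i := k)) j)) = c i * of_int k + (\<Sum>j\<in>UNIV. c j * of_int (y j))" for c
  proof -
    have "c j * complex_of_int ((y(i := k)) j) = (if j = i then c i * of_int k else 0) + c j * of_int (y j)" for j
      using y by auto
    then show ?thesis by (simp add: sum.distrib sum.delta)
  qed
  have p: "complex_of_real (pivot i Q i) = 1" using Q(2) by (simp add: pivot_def)
  define S where "S = qform (schur i Q) (\<lambda>j. complex_of_int (y j))"
  define U where "U = (\<Sum>j\<in>UNIV. u j * complex_of_int (y j))"
  have "qform Q (\<lambda>j. complex_of_int ((y(i := k)) j)) = q * (of_int k + \<rho>)\<^sup>2 + S"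
    unfolding qform_schur[OF Q, of "\<lambda>j. of_int ((y(i := k)) j)"] z s1 p \<rho>_def S_def q_def by simp
  then show ?thesis
    unfolding gauss_term_def theta_term_def s1 exp_add [symmetric] S_def [symmetric] U_def [symmetric]
    by (simp add: power2_eq_square algebra_simps)
qed

text \<open>Induction over the support, eliminating one variable by its Schur complement. After the
  one-dimensional summation the modulus of the summand is a product of a function of the new dual variable and a function
  of the remaining variables, which justifies the exchange of the sums.\<close>

lemma poisson_gauss_supported:
  fixes Q :: "real^'n^'n"
  assumes "finite F" "pos_def_mat Q" "\<And>j k. j \<notin> F \<or> k \<notin> F \<Longrightarrow> Q $ j $ k = (if j = k then 1 else 0)"
    and s: "Re s > 0" and "\<And>j. j \<notin> F \<Longrightarrow> u j = 0"
  shows "csqrt s ^ card F * of_real (sqrt (det Q)) * (\<Sum>\<^sub>\<infinity>y\<in>supported F. gauss_term s Q u y)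
    = (\<Sum>\<^sub>\<infinity>m\<in>supported F. dual_term s Q u m)"
  using assms(1,2,3,5)
proof (induction F arbitrary: Q u rule: finite_induct)
  case empty
  \<comment> \<open>Outside F the matrix is the identity and u vanishes, so for empty F both sums
    reduce to the zero vector.\<close>
  have 1: "Q = mat 1" using empty(2) by (simp add: vec_eq_iff mat_def)
  have 2: "supported {} = {\<lambda>i::'n. 0}" by (auto simp: supported_def)
  have 3: "u = (\<lambda>i. 0)" using empty(3) by auto
  have q0: "qform R (\<lambda>i. 0) = 0" for R :: "real^'n^'n" by (simp add: qform_def)
  show ?case unfolding 2 3 using 1 by (simp add: gauss_term_def dual_term_def q0)
next
  case (insert i F)
  note pd = insert.prems(1) and supp = insert.prems(2) and u0 = insert.prems(3)
  have s0: "s \<noteq> 0" using s by auto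
  have q: "Q $ i $ i > 0" by (rule pos_def_diag[OF pd])
  have Q: "transpose Q = Q" "Q $ i $ i \<noteq> 0" using pd q by (auto simp: pos_def_mat_def)
  define qc where "qc = complex_of_real (Q $ i $ i)"
  have qc: "qc \<noteq> 0" using q by (simp add: qc_def)
  have sq: "Re (s * qc) > 0" using s q by (simp add: qc_def)
  have sq0: "s * qc \<noteq> 0" using s0 qc by simp
  let ?S = "schur i Q"
  have pdS: "pos_def_mat ?S" by (rule pos_def_schur[OF pd])
  define \<rho> where "\<rho> y = (\<Sum>j\<in>UNIV. of_real (pivot i Q j) * complex_of_int (y j))" for y
  \<comment> \<open>One-dimensional summation leaves a term linear in y; it is moved into the linear
    parameter of the remaining form, weighted by the pivots.\<close>
  define u' where "u' m j = (if j = i then 0 else u j + (of_int m - u i) * of_real (pivot i Q j))" for m :: int and j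
  define E where "E m = exp (- of_real pi * (of_int m - u i)\<^sup>2 / (s * qc))" for m :: int
  have bij: "bij_betw (\<lambda>(k, y). y(i := k)) (UNIV \<times> supported F) (supported (insert i F))"
    by (rule supported_insert[OF insert.hyps(2)])
  have y0: "y i = 0" if "y \<in> supported F" for y using that insert.hyps(2) by (auto simp: supported_def)
  have step: "csqrt (s * qc) * (\<Sum>\<^sub>\<infinity>k. gauss_term s Q u (y(i := k))) = (\<Sum>\<^sub>\<infinity>m. E m * gauss_term s ?S (u' m) y)"
    if y: "y \<in> supported F" for y
  proof -
    have "csqrt (s * qc) * (\<Sum>\<^sub>\<infinity>k. gauss_term s Q u (y(i := k)))
       = (exp (- of_real pi * s * qc * (\<rho> y)\<^sup>2) * gauss_term s ?S u y) * (csqrt (s * qc) * theta_sum (s * qc) (u i + \<i> * s * qc * \<rho> y))"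
      unfolding gauss_term_split[where i = i and y = y, OF pd y0[OF y]] qc_def [symmetric] \<rho>_def [symmetric]
        infsum_cmult_right' theta_sum_def by (simp only: mult_ac)
    also have "\<dots> = (\<Sum>\<^sub>\<infinity>m. (exp (- of_real pi * s * qc * (\<rho> y)\<^sup>2) * gauss_term s ?S u y)
        * exp (- of_real pi * (of_int m - (u i + \<i> * s * qc * \<rho> y))\<^sup>2 / (s * qc)))"
      unfolding theta_sum_poisson[OF sq] infsum_cmult_right' ..
    also have "\<dots> = (\<Sum>\<^sub>\<infinity>m. E m * gauss_term s ?S (u' m) y)"
    proof (rule infsum_cong)
      fix m :: int
      define a where "a = complex_of_int m - u i"
      have "(\<Sum>j\<in>UNIV. u' m j * of_int (y j)) = (\<Sum>j\<in>UNIV. u j * of_int (y j) + a * (of_real (pivot i Q j) * of_int (y j)))"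
        using y0[OF y] by (intro sum.cong) (auto simp: u'_def a_def algebra_simps)
      also have "\<dots> = (\<Sum>j\<in>UNIV. u j * of_int (y j)) + a * \<rho> y"
        unfolding \<rho>_def sum.distrib sum_distrib_left ..
      finally have l: "(\<Sum>j\<in>UNIV. u' m j * of_int (y j)) = (\<Sum>j\<in>UNIV. u j * of_int (y j)) + a * \<rho> y" .
      \<comment> \<open>The shift i s q \<rho> in the theta argument is exactly what cancels the
        \<rho>^2 term.\<close>
      have e: "- of_real pi * s * qc * (\<rho> y)\<^sup>2 + (- of_real pi * (of_int m - (u i + \<i> * s * qc * \<rho> y))\<^sup>2 / (s * qc))
         = - of_real pi * a\<^sup>2 / (s * qc) + 2 * of_real pi * \<i> * (a * \<rho> y)"
        using s0 qc by (simp add: a_def field_simps power2_eq_square)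
      have "(exp (- of_real pi * s * qc * (\<rho> y)\<^sup>2) * gauss_term s ?S u y)
          * exp (- of_real pi * (of_int m - (u i + \<i> * s * qc * \<rho> y))\<^sup>2 / (s * qc))
          = exp (- of_real pi * s * qc * (\<rho> y)\<^sup>2 + (- of_real pi * (of_int m - (u i + \<i> * s * qc * \<rho> y))\<^sup>2 / (s * qc)))
             * gauss_term s ?S u y"
        by (simp only: exp_add mult_ac)
      also have "\<dots> = E m * gauss_term s ?S (u' m) y"
        unfolding e gauss_term_def l E_def a_def [symmetric] exp_add [symmetric]
        by (rule arg_cong[of _ _ exp]) (simp add: algebra_simps)
      finally show "(exp (- of_real pi * s * qc * (\<rho> y)\<^sup>2) * gauss_term s ?S u y)
          * exp (- of_real pi * (of_int m - (u i + \<i> * s * qc * \<rho> y))\<^sup>2 / (s * qc))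
          = E m * gauss_term s ?S (u' m) y" .
    qed
    finally show ?thesis .
  qed
  have combine: "E m * dual_term s ?S (u' m) m' = dual_term s Q u (m'(i := m))" if m': "m' \<in> supported F" for m m'
  proof -
    have f: "(\<lambda>j. if j = i then 0 else (of_int ((m'(i := m)) j) - u j) - of_real (pivot i Q j) * (of_int ((m'(i := m)) i) - u i))
       = (\<lambda>j. of_int (m' j) - u' m j)"
      using y0[OF m'] by (auto simp: fun_eq_iff u'_def algebra_simps)
    show ?thesis
      unfolding dual_term_def E_def qform_matrix_inv_schur[OF pd, where i = i and w = "\<lambda>j. of_int ((m'(i := m)) j) - u j"] f
        exp_add [symmetric] qc_def [symmetric]
      using s0 qc by (intro arg_cong[of _ _ exp]) (simp add: field_simps)
  qed
  have IH: "csqrt s ^ card F * of_real (sqrt (det ?S)) * (\<Sum>\<^sub>\<infinity>y\<in>supported F. gauss_term s ?S (u' m) y)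
    = (\<Sum>\<^sub>\<infinity>m'\<in>supported F. dual_term s ?S (u' m) m')" for m
  proof (rule insert.IH[OF pdS])
    have p0: "pivot i Q j = 0" if "j \<notin> F" "j \<noteq> i" for j
      using supp[of i j] that by (simp add: pivot_def)
    show "?S $ j $ k = (if j = k then 1 else 0)" if "j \<notin> F \<or> k \<notin> F" for j k
      using that supp[of j k] p0[of j] p0[of k] by (auto simp: schur_def)
    show "u' m j = 0" if "j \<notin> F" for j
      using that u0[of j] p0[of j] by (auto simp: u'_def)
  qed
  have sum1: "(\<lambda>(k, y). gauss_term s Q u (y(i := k))) summable_on UNIV \<times> supported F"
  proof -
    have "gauss_term s Q u summable_on supported (insert i F)"
      by (rule abs_summable_summable[OF gauss_term_abs_summable[OF pd s]])
    then show ?thesis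
      unfolding summable_on_reindex_bij_betw[OF bij, symmetric] by (simp add: case_prod_unfold)
  qed
  have sum2: "(\<lambda>(y, m). E m * gauss_term s ?S (u' m) y) summable_on supported F \<times> UNIV"
  proof -
    have nE: "(\<lambda>m. norm (E m)) summable_on UNIV"
    proof -
      have "E m = exp (- of_real pi * (u i)\<^sup>2 / (s * qc)) * theta_term (1 / (s * qc)) (- \<i> * u i / (s * qc)) m" for m
        unfolding E_def theta_term_def exp_add [symmetric]
        using sq0 by (intro arg_cong[of _ _ exp]) (simp add: field_simps power2_eq_square)
      then show ?thesis
        using abs_summable_theta_term[OF Re_inverse_pos[OF sq]]
        by (simp add: norm_mult summable_on_cmult_right)
    qed
    \<comment> \<open>\<open>u' m\<close> differs from \<open>u' 0\<close> by real numbers only,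
      hence m affects just the phase.\<close>
    have ng: "norm (gauss_term s ?S (u' m) y) = norm (gauss_term s ?S (u' 0) y)" for m y
    proof -
      have "Im (\<Sum>j\<in>UNIV. u' m j * of_int (y j)) = Im (\<Sum>j\<in>UNIV. u' 0 j * of_int (y j))"
        unfolding Im_sum by (intro sum.cong) (auto simp: u'_def)
      then show ?thesis unfolding gauss_term_def norm_exp_eq_Re by simp
    qed
    have A: "(\<lambda>(y, m). norm (gauss_term s ?S (u' 0) y) * norm (E m)) summable_on supported F \<times> UNIV"
      by (intro summable_on_mult_Times nE gauss_term_abs_summable pdS s) auto
    have eq: "(\<lambda>(y, m). norm (gauss_term s ?S (u' 0) y) * norm (E m)) = (\<lambda>x. norm ((\<lambda>(y, m). E m * gauss_term s ?S (u' m) y) x))"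
    proof (rule ext, clarify)
      fix y m
      show "norm (gauss_term s ?S (u' 0) y) * norm (E m) = norm (E m * gauss_term s ?S (u' m) y)"
        unfolding norm_mult ng[of m y] by (rule mult.commute)
    qed
    show ?thesis using A unfolding eq by (rule abs_summable_summable)
  qed
  have sum3: "(\<lambda>(m, m'). dual_term s Q u (m'(i := m))) summable_on UNIV \<times> supported F"
  proof -
    have "dual_term s Q u summable_on supported (insert i F)"
      by (rule abs_summable_summable[OF dual_term_abs_summable[OF pd s]])
    then show ?thesis
      unfolding summable_on_reindex_bij_betw[OF bij, symmetric] by (simp add: case_prod_unfold)
  qed
  have c1: "csqrt s ^ card (insert i F) * of_real (sqrt (det Q))
      = (csqrt s ^ card F * of_real (sqrt (det ?S))) * csqrt (s * qc)"
    unfolding det_schur[OF Q] qc_def csqrt_mult_of_real[OF q] real_sqrt_mult using insert.hyps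
    by (simp add: mult_ac)
  have "(\<Sum>\<^sub>\<infinity>y\<in>supported (insert i F). gauss_term s Q u y) = (\<Sum>\<^sub>\<infinity>(k, y)\<in>UNIV \<times> supported F. gauss_term s Q u (y(i := k)))"
    unfolding infsum_reindex_bij_betw[OF bij, symmetric] by (simp add: case_prod_unfold)
  also have "\<dots> = (\<Sum>\<^sub>\<infinity>k. \<Sum>\<^sub>\<infinity>y\<in>supported F. gauss_term s Q u (y(i := k)))"
    using infsum_Sigma_banach[OF sum1] by simp
  also have "\<dots> = (\<Sum>\<^sub>\<infinity>y\<in>supported F. \<Sum>\<^sub>\<infinity>k. gauss_term s Q u (y(i := k)))"
    by (rule infsum_swap_banach[OF sum1])
  finally have "csqrt (s * qc) * (\<Sum>\<^sub>\<infinity>y\<in>supported (insert i F). gauss_term s Q u y)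
    = (\<Sum>\<^sub>\<infinity>y\<in>supported F. csqrt (s * qc) * (\<Sum>\<^sub>\<infinity>k. gauss_term s Q u (y(i := k))))"
    by (simp only: infsum_cmult_right')
  also have "\<dots> = (\<Sum>\<^sub>\<infinity>y\<in>supported F. \<Sum>\<^sub>\<infinity>m. E m * gauss_term s ?S (u' m) y)"
    by (rule infsum_cong) (rule step)
  also have "\<dots> = (\<Sum>\<^sub>\<infinity>m. \<Sum>\<^sub>\<infinity>y\<in>supported F. E m * gauss_term s ?S (u' m) y)"
    by (rule infsum_swap_banach[OF sum2])
  also have "\<dots> = (\<Sum>\<^sub>\<infinity>m. E m * (\<Sum>\<^sub>\<infinity>y\<in>supported F. gauss_term s ?S (u' m) y))"
    by (simp only: infsum_cmult_right')
  finally have "csqrt s ^ card (insert i F) * of_real (sqrt (det Q)) * (\<Sum>\<^sub>\<infinity>y\<in>supported (insert i F). gauss_term s Q u y)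
    = (\<Sum>\<^sub>\<infinity>m. E m * (csqrt s ^ card F * of_real (sqrt (det ?S)) * (\<Sum>\<^sub>\<infinity>y\<in>supported F. gauss_term s ?S (u' m) y)))"
    unfolding c1 by (simp only: mult.assoc mult.left_commute[of "E _"] infsum_cmult_right')
  also have "\<dots> = (\<Sum>\<^sub>\<infinity>m. \<Sum>\<^sub>\<infinity>m'\<in>supported F. E m * dual_term s ?S (u' m) m')"
    unfolding IH by (simp only: infsum_cmult_right')
  also have "\<dots> = (\<Sum>\<^sub>\<infinity>m. \<Sum>\<^sub>\<infinity>m'\<in>supported F. dual_term s Q u (m'(i := m)))"
    by (intro infsum_cong combine)
  also have "\<dots> = (\<Sum>\<^sub>\<infinity>(m, m')\<in>UNIV \<times> supported F. dual_term s Q u (m'(i := m)))"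
    using infsum_Sigma_banach[OF sum3] by simp
  also have "\<dots> = (\<Sum>\<^sub>\<infinity>m\<in>supported (insert i F). dual_term s Q u m)"
    unfolding infsum_reindex_bij_betw[OF bij, symmetric] by (simp add: case_prod_unfold)
  finally show ?case .
qed

theorem poisson_gauss:
  fixes Q :: "real^'n^'n"
  assumes "pos_def_mat Q" "Re s > 0"
  shows "csqrt s ^ CARD('n) * of_real (sqrt (det Q)) * (\<Sum>\<^sub>\<infinity>y. gauss_term s Q u y) = (\<Sum>\<^sub>\<infinity>m. dual_term s Q u m)"
  using poisson_gauss_supported[of UNIV Q s u] assms by simp

section \<open>Even quaternary forms of level p\<close>

definition dot :: "('n::finite \<Rightarrow> int) \<Rightarrow> ('n \<Rightarrow> int) \<Rightarrow> int" where
  "dot x y = (\<Sum>i\<in>UNIV. x i * y i)"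

text \<open>The entries of an even matrix are reals with integral values, so \<open>floor\<close>
  merely changes their type; divisibility can then be stated over \<open>int\<close>.\<close>

definition int_act :: "real^'n^'n \<Rightarrow> ('n \<Rightarrow> int) \<Rightarrow> 'n \<Rightarrow> int" where
  "int_act A x i = (\<Sum>j\<in>UNIV. \<lfloor>A $ i $ j\<rfloor> * x j)"

text \<open>The division is exact for even matrices, see \<open>half_form_double\<close>.\<close>

definition half_form :: "real^'n^'n \<Rightarrow> ('n \<Rightarrow> int) \<Rightarrow> int" where
  "half_form A x = dot x (int_act A x) div 2"

lemma dot_commute: "dot x y = dot y x"
  by (simp add: dot_def mult.commute)

lemma dot_add_left: "dot (\<lambda>i. x i + y i) z = dot x z + dot y z"
  by (simp add: dot_def algebra_simps sum.distrib)

lemma dot_add_right: "dot z (\<lambda>i. x i + y i) = dot z x + dot z y"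
  by (simp add: dot_def algebra_simps sum.distrib)

lemma dot_scale_left: "dot (\<lambda>i. k * x i) z = k * dot x z"
  by (simp add: dot_def sum_distrib_left mult_ac)

lemma dot_scale_right: "dot z (\<lambda>i. k * x i) = k * dot z x"
  by (simp add: dot_def sum_distrib_left mult_ac)

lemma int_act_add: "int_act A (\<lambda>i. x i + y i) = (\<lambda>i. int_act A x i + int_act A y i)"
  by (rule ext) (simp add: int_act_def algebra_simps sum.distrib)

lemma int_act_scale: "int_act A (\<lambda>i. k * x i) = (\<lambda>i. k * int_act A x i)"
  by (rule ext) (simp add: int_act_def sum_distrib_left mult_ac)

lemma even_mat_floor: "even_mat A \<Longrightarrow> real_of_int \<lfloor>A $ i $ j\<rfloor> = A $ i $ j"
  unfolding even_mat_def by (metis Ints_cases floor_of_int)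

lemma of_int_int_act:
  assumes "even_mat A"
  shows "(of_int (int_act A x i) :: 'b::real_normed_field) = mvec A (\<lambda>j. of_int (x j)) i"
proof -
  have "of_int \<lfloor>A $ i $ j\<rfloor> = (of_real (A $ i $ j) :: 'b)" for j
    using even_mat_floor[OF assms, of i j] by (metis of_real_of_int_eq)
  then show ?thesis unfolding int_act_def mvec_def by simp
qed

lemma dot_int_act_commute:
  assumes "even_mat A"
  shows "dot x (int_act A y) = dot (int_act A x) y"
proof -
  have "transpose A = A" using assms by (simp add: even_mat_def)
  from sum_mvec_symmetric[OF this, of "\<lambda>i. real_of_int (x i)" "\<lambda>i. real_of_int (y i)"]
  have "real_of_int (dot x (int_act A y)) = real_of_int (dot (int_act A x) y)"
    unfolding dot_def by (simp add: of_int_int_act[OF assms])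
  then show ?thesis by linarith
qed

text \<open>Off-diagonal terms cancel in pairs modulo 2, so only the diagonal matters.\<close>

lemma even_sum_sum_symmetric:
  fixes f :: "'n::finite \<Rightarrow> 'n \<Rightarrow> int"
  assumes "\<And>i j. f i j = f j i" "\<And>i. even (f i i)"
  shows "even (\<Sum>i\<in>X. \<Sum>j\<in>X. f i j)"
proof -
  have "finite X" by simp
  then show ?thesis
  proof (induction X)
    case (insert x F)
    have "(\<Sum>i\<in>insert x F. \<Sum>j\<in>insert x F. f i j) = f x x + (\<Sum>j\<in>F. f x j) + ((\<Sum>i\<in>F. f i x) + (\<Sum>i\<in>F. \<Sum>j\<in>F. f i j))"
      using insert(1,2) by (simp add: sum.distrib)
    also have "(\<Sum>i\<in>F. f i x) = (\<Sum>j\<in>F. f x j)" using assms(1) by simp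
    finally show ?case using insert(3) assms(2)[of x] by (simp add: algebra_simps)
  qed simp
qed

lemma half_form_double:
  assumes "even_mat A"
  shows "2 * half_form A x = dot x (int_act A x)"
proof -
  have tr: "transpose A = A" and ev: "\<And>i. \<exists>m::int. A $ i $ i = of_int (2 * m)"
    using assms by (auto simp: even_mat_def)
  have e: "even (\<Sum>i\<in>UNIV. \<Sum>j\<in>UNIV. x i * (\<lfloor>A $ i $ j\<rfloor> * x j))"
  proof (rule even_sum_sum_symmetric)
    show "x i * (\<lfloor>A $ i $ j\<rfloor> * x j) = x j * (\<lfloor>A $ j $ i\<rfloor> * x i)" for i j
      using transpose_eq_entry[OF tr, of i j] by (simp add: mult_ac)
    show "even (x i * (\<lfloor>A $ i $ i\<rfloor> * x i))" for i
    proof -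
      obtain m :: int where "A $ i $ i = of_int (2 * m)" using ev by blast
      then have "\<lfloor>A $ i $ i\<rfloor> = 2 * m" by (metis floor_of_int)
      then show ?thesis by simp
    qed
  qed
  have "dot x (int_act A x) = (\<Sum>i\<in>UNIV. \<Sum>j\<in>UNIV. x i * (\<lfloor>A $ i $ j\<rfloor> * x j))"
    unfolding dot_def int_act_def sum_distrib_left ..
  with e show ?thesis unfolding half_form_def by simp
qed

lemma qform_of_int:
  assumes "even_mat A"
  shows "qform A (\<lambda>i. of_int (x i)) = of_int (2 * half_form A x)"
  unfolding half_form_double[OF assms] qform_mvec dot_def by (simp add: of_int_int_act[OF assms])

lemma half_form_add:
  assumes "even_mat A"
  shows "half_form A (\<lambda>i. x i + y i) = half_form A x + dot x (int_act A y) + half_form A y"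
proof -
  have "2 * half_form A (\<lambda>i. x i + y i) = 2 * (half_form A x + dot x (int_act A y) + half_form A y)"
    unfolding distrib_left half_form_double[OF assms] int_act_add dot_add_left dot_add_right
    using dot_int_act_commute[OF assms, of x y] dot_commute[of "int_act A x" y] by simp
  then show ?thesis by simp
qed

lemma half_form_scale:
  assumes "even_mat A"
  shows "half_form A (\<lambda>i. k * x i) = k\<^sup>2 * half_form A x"
proof -
  have "2 * half_form A (\<lambda>i. k * x i) = 2 * (k\<^sup>2 * half_form A x)"
    using half_form_double[OF assms, of "\<lambda>i. k * x i"] half_form_double[OF assms, of x]
    by (simp add: int_act_scale dot_scale_left dot_scale_right power2_eq_square)
  then show ?thesis by simp
qed

lemma half_form_theta_summable:
  fixes A :: "real^'n^'n"
  assumes "even_mat A" "pos_def_mat A" "Im \<omega> > 0"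
  shows "(\<lambda>x. norm (e2pi (\<omega> * of_int (half_form A x) + (\<Sum>i\<in>UNIV. u i * of_int (x i))))) summable_on X"
proof -
  have "e2pi (\<omega> * of_int (half_form A x) + (\<Sum>i\<in>UNIV. u i * of_int (x i))) = gauss_term (- \<i> * \<omega>) A u x" for x
    unfolding e2pi_def gauss_term_def qform_of_int[OF assms(1)]
    by (rule arg_cong[of _ _ exp]) (simp add: algebra_simps)
  then show ?thesis
    using gauss_term_abs_summable[OF assms(2), of "- \<i> * \<omega>" u X] assms(3) by simp
qed

lemma infsum_finite_sum:
  fixes f :: "'j \<Rightarrow> 'a \<Rightarrow> complex"
  assumes "finite J" "\<And>j. j \<in> J \<Longrightarrow> f j summable_on X"
  shows "(\<Sum>\<^sub>\<infinity>n\<in>X. \<Sum>j\<in>J. f j n) = (\<Sum>j\<in>J. \<Sum>\<^sub>\<infinity>n\<in>X. f j n)"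
proof -
  have "((\<lambda>n. \<Sum>j\<in>J. f j n) has_sum (\<Sum>j\<in>J. \<Sum>\<^sub>\<infinity>n\<in>X. f j n)) X"
    using assms by (induction J rule: finite_induct) (auto intro!: has_sum_add)
  then show ?thesis by (rule infsumI)
qed

text \<open>Orthogonality of additive characters, used for the level p and again for arbitrary
  moduli in the uniqueness of Fourier coefficients.\<close>

lemma sum_e2pi_residues:
  fixes p :: nat
  assumes p_pos: "p > 0"
  shows "(\<Sum>j<p. e2pi (of_int (int j * d) / of_nat p)) = (if int p dvd d then of_nat p else 0)"
proof (cases "int p dvd d")
  case True
  then obtain k where k: "d = int p * k" by blast
  have "e2pi (of_int (int j * d) / of_nat p) = 1" for j
  proof -
    have "complex_of_int (int j * d) / of_nat p = of_int (int j * k)" unfolding k using p_pos by simp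
    then show ?thesis by (simp only: e2pi_of_int)
  qed
  then show ?thesis using True by simp
next
  case False
  define r where "r = e2pi (of_int d / of_nat p)"
  have pw: "e2pi (of_int (int j * d) / of_nat p) = r ^ j" for j
    unfolding r_def e2pi_def exp_of_nat_mult [symmetric] by (simp add: algebra_simps)
  have "r ^ p = e2pi (of_int d)" unfolding pw [symmetric] using p_pos by simp
  then have rp: "r ^ p = 1" by simp
  have "r \<noteq> 1"
  proof
    assume "r = 1"
    then obtain n :: int where "2 * of_real pi * (of_int d / real p) = of_int (2 * n) * pi"
      unfolding r_def e2pi_def exp_eq_1 by (auto simp: Im_divide_of_nat)
    then have "(2 * pi) * (of_int d / real p) = (2 * pi) * real_of_int n" by (simp add: mult_ac)
    then have "of_int d / real p = real_of_int n" by (subst (asm) mult_left_cancel) auto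
    then have "real_of_int d = real_of_int (n * int p)" using p_pos by (simp add: field_simps)
    then have "d = n * int p" by (simp only: of_int_eq_iff)
    then show False using False by simp
  qed
  then have "(\<Sum>j<p. r ^ j) = 0" using rp by (simp add: geometric_sum)
  then show ?thesis using False pw by simp
qed

text \<open>With \<open>L = \<int>\<^sup>4\<close> for the form \<open>A\<close>, the vector \<open>m \<in> \<int>\<^sup>4\<close> stands for the element \<open>A\<^sup>-\<^sup>1m\<close> of the dual
  lattice, on which the form is given by \<open>A'/p\<close>, where \<open>A' = pA\<^sup>-\<^sup>1\<close>; the lattice itself is the range of \<open>A\<close>.\<close>

locale level_pair =
  fixes p :: nat and A A' :: "real^4^4"
  assumes prime_p: "prime p" and even_A: "even_mat A" and even_A': "even_mat A'"
    and pos_A: "pos_def_mat A" and det_A: "det A = real p ^ 2"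
    and AA': "A ** A' = real p *\<^sub>R mat 1"
begin

lemma p_pos: "p > 0" "real p > 0" "complex_of_nat p \<noteq> 0"
  using prime_gt_0_nat[OF prime_p] by auto

lemma matrix_inv_A: "matrix_inv A = (1 / real p) *\<^sub>R A'"
proof -
  note inv = matrix_inv_inverse[OF pos_def_invertible[OF pos_A]]
  have "A ** ((1 / real p) *\<^sub>R A') = (1 / real p) *\<^sub>R (A ** A')"
    by (simp add: vec_eq_iff matrix_matrix_mult_def sum_distrib_left mult_ac)
  then have "A ** ((1 / real p) *\<^sub>R A') = mat 1" using p_pos by (simp add: AA')
  then have "matrix_inv A ** (A ** ((1 / real p) *\<^sub>R A')) = matrix_inv A" by simp
  then show ?thesis unfolding matrix_mul_assoc inv(2) by simp
qed

lemma A'A: "A' ** A = real p *\<^sub>R mat 1"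
proof -
  have "A' = real p *\<^sub>R matrix_inv A" unfolding matrix_inv_A using p_pos by simp
  then show ?thesis
    using matrix_inv_inverse(2)[OF pos_def_invertible[OF pos_A]] by (metis scalar_matrix_assoc)
qed

text \<open>The situation is symmetric: the rescaled dual has determinant p^4 / p^2. Every fact
  about \<open>A\<close> thus becomes available for \<open>A'\<close> by interpretation.\<close>

lemma dual_level_pair: "level_pair p A' A"
proof
  have A': "A' = real p *\<^sub>R matrix_inv A" unfolding matrix_inv_A using p_pos by simp
  show "pos_def_mat A'" unfolding A' by (intro pos_def_mat_scaleR pos_def_matrix_inv pos_A p_pos)
  have "det A * det A' = real p ^ 4"
  proof -
    have "(real p *\<^sub>R mat 1 :: real^4^4) = (\<chi> i j. if i = j then real p else 0)"
      by (simp add: vec_eq_iff mat_def)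
    then have "det (real p *\<^sub>R mat 1 :: real^4^4) = real p ^ 4"
      by (subst det_diagonal) auto
    then show ?thesis using det_mul[of A A'] unfolding AA' by simp
  qed
  then show "det A' = real p ^ 2"
    unfolding det_A using p_pos by (simp add: power4_eq_xxxx power2_eq_square)
qed (use prime_p even_A even_A' A'A in auto)

lemma int_act_dual: "int_act A (int_act A' m) = (\<lambda>i. int p * m i)"
proof
  fix i
  have "real_of_int (int_act A (int_act A' m) i) = mvec A (\<lambda>j. mvec A' (\<lambda>k. real_of_int (m k)) j) i"
    by (simp add: of_int_int_act[OF even_A] of_int_int_act[OF even_A'])
  also have "\<dots> = mvec (real p *\<^sub>R mat 1) (\<lambda>k. real_of_int (m k)) i"
    unfolding AA' [symmetric] mvec_mult [symmetric] ..
  also have "\<dots> = real p * mvec (mat 1) (\<lambda>k. real_of_int (m k)) i"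
    unfolding mvec_def by (simp add: sum_distrib_left mult_ac)
  also have "\<dots> = real_of_int (int p * m i)" by simp
  finally show "int_act A (int_act A' m) i = int p * m i" by linarith
qed

end

context level_pair
begin

interpretation dual: level_pair p A' A by (rule dual_level_pair)

lemma int_act_dual': "int_act A' (int_act A x) = (\<lambda>i. int p * x i)"
  by (rule dual.int_act_dual)

lemma inj_int_act: "inj (int_act A)"
proof (rule injI)
  fix x y assume "int_act A x = int_act A y"
  then have "(\<lambda>i. int p * x i) = (\<lambda>i. int p * y i)" by (metis int_act_dual')
  then show "x = y" using p_pos by (auto simp: fun_eq_iff)
qed

text \<open>A lattice vector seen in dual coordinates keeps its value, since the dual form is that
  of \<open>A'\<close> divided by p.\<close>

lemma half_form_int_act: "half_form A' (int_act A x) = int p * half_form A x"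
proof -
  have "2 * half_form A' (int_act A x) = 2 * (int p * half_form A x)"
    using half_form_double[OF even_A', of "int_act A x"] half_form_double[OF even_A, of x]
    by (simp add: int_act_dual' dot_scale_right dot_commute)
  then show ?thesis by simp
qed

text \<open>Poisson summation at s = i / w. In rank four the power of \<open>csqrt\<close> is (i /
  w)^2 = -1 / w^2, the source of the sign, and the root of \<open>det A\<close> is p. The linear
  term along m serves cosets of the lattice as well as the second vector of a pair.\<close>

lemma poisson_half_form:
  assumes w: "Im w > 0"
  shows "(\<Sum>\<^sub>\<infinity>y. e2pi (- of_int (half_form A y) / w - c * of_int (dot m y)))
    = - (w\<^sup>2 / of_nat p) * (\<Sum>\<^sub>\<infinity>n. e2pi (w / of_nat p * (of_int (half_form A' n)
        + c * of_int (dot n (int_act A' m)) + c\<^sup>2 * of_int (half_form A' m))))"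
proof -
  have w0: "w \<noteq> 0" using w by auto
  have "Re (\<i> / w) = Im w / ((Re w)\<^sup>2 + (Im w)\<^sup>2)" by (simp add: Re_divide)
  moreover have "(Re w)\<^sup>2 + (Im w)\<^sup>2 > 0" using w by (simp add: sum_power2_gt_zero_iff)
  ultimately have s: "Re (\<i> / w) > 0" using w by simp
  define u where "u i = - c * complex_of_int (m i)" for i
  have g: "gauss_term (\<i> / w) A u y = e2pi (- of_int (half_form A y) / w - c * of_int (dot m y))" for y
  proof -
    have "(\<Sum>i\<in>UNIV. u i * of_int (y i)) = - c * of_int (dot m y)"
      unfolding u_def dot_def by (simp add: sum_distrib_left mult_ac sum_negf)
    then show ?thesis unfolding gauss_term_def e2pi_def qform_of_int[OF even_A]
      by (intro arg_cong[of _ _ exp]) (simp add: algebra_simps)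
  qed
  have d: "dual_term (\<i> / w) A u n = e2pi (w / of_nat p * (of_int (half_form A' n)
        + c * of_int (dot n (int_act A' m)) + c\<^sup>2 * of_int (half_form A' m)))" for n
  proof -
    have tr: "transpose A' = A'" using even_A' by (simp add: even_mat_def)
    have mu: "mvec A' u i = - c * of_int (int_act A' m i)" for i
      unfolding of_int_int_act[OF even_A'] u_def mvec_def by (simp add: sum_distrib_left mult_ac sum_negf)
    have "qform A' u = (\<Sum>i\<in>UNIV. c\<^sup>2 * (of_int (m i) * of_int (int_act A' m i)))"
      unfolding qform_mvec mu u_def by (simp add: power2_eq_square mult_ac)
    also have "\<dots> = c\<^sup>2 * of_int (2 * half_form A' m)"
      unfolding half_form_double[OF even_A'] dot_def by (simp add: sum_distrib_left)
    finally have qu: "qform A' u = c\<^sup>2 * of_int (2 * half_form A' m)" .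
    have lin: "(\<Sum>i\<in>UNIV. mvec A' u i * of_int (n i)) = - c * of_int (dot n (int_act A' m))"
      unfolding mu dot_def by (simp add: sum_distrib_left mult_ac sum_negf)
    show ?thesis
      unfolding dual_term_def matrix_inv_A qform_scaleR qform_diff[OF tr] qu lin qform_of_int[OF even_A'] e2pi_def
      using w0 p_pos by (intro arg_cong[of _ _ exp]) (simp add: field_simps)
  qed
  have "csqrt (\<i> / w) ^ 4 = ((csqrt (\<i> / w))\<^sup>2)\<^sup>2"
    by (simp only: power4_eq_xxxx power2_eq_square mult.assoc)
  also have "\<dots> = - 1 / w\<^sup>2" unfolding power2_csqrt by (simp add: power_divide)
  finally have "- 1 / w\<^sup>2 * of_nat p * (\<Sum>\<^sub>\<infinity>y. gauss_term (\<i> / w) A u y) = (\<Sum>\<^sub>\<infinity>n. dual_term (\<i> / w) A u n)"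
    using poisson_gauss[OF pos_A s, of u] by (simp add: det_A)
  moreover have "X = - (w\<^sup>2 / of_nat p) * Y" if "- 1 / w\<^sup>2 * of_nat p * X = Y" for X Y
    unfolding that [symmetric] using w0 p_pos by (simp add: field_simps)
  ultimately show ?thesis unfolding g [symmetric] d [symmetric] by blast
qed

definition dual_theta :: "(4 \<Rightarrow> int) set \<Rightarrow> complex \<Rightarrow> complex" where
  "dual_theta X \<omega> = (\<Sum>\<^sub>\<infinity>n\<in>X. e2pi (\<omega> * of_int (half_form A' n) / of_nat p))"

lemma dual_theta_summable:
  assumes "Im \<omega> > 0"
  shows "(\<lambda>n. norm (e2pi (\<omega> * of_int (half_form A' n) / of_nat p))) summable_on X"
proof -
  have "Im (\<omega> / of_nat p) > 0" using assms p_pos by (simp add: Im_divide_of_nat)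
  from half_form_theta_summable[OF even_A' dual.pos_A this, of "\<lambda>i. 0" X]
  show ?thesis by simp
qed

lemma half_form_coset:
  "half_form A' (\<lambda>i. k * m i + int_act A x i) = k\<^sup>2 * half_form A' m + int p * (k * dot m x + half_form A x)"
  unfolding half_form_add[OF even_A'] half_form_scale[OF even_A'] half_form_int_act int_act_dual'
    dot_scale_left dot_scale_right by (simp add: algebra_simps)

text \<open>If \<open>p\<close> divides the dual form at some \<open>m\<close> outside the lattice, then adjoining \<open>m\<close> yields an even
  lattice whose theta series \<open>\<Theta>\<close> satisfies \<open>\<Theta>(-1/\<omega>) = -\<omega>\<^sup>2 \<Theta>(\<omega>)\<close> (it would be unimodular of rank four). The relation
  \<open>(ST)\<^sup>3 = 1\<close>, applied at \<open>\<omega> = \<i>\<close>, then gives \<open>\<Theta>(\<i>) = -\<Theta>(\<i>)\<close>.\<close>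

theorem dual_anisotropic:
  assumes iso: "int p dvd half_form A' m"
  shows "m \<in> range (int_act A)"
proof (rule ccontr)
  assume nm: "m \<notin> range (int_act A)"
  \<comment> \<open>Enumerates the overlattice generated by m, coset by coset; M below is the dual
    of that overlattice.\<close>
  define f where "f = (\<lambda>(j::nat, x). (\<lambda>i. int j * m i + int_act A x i))"
  define L where "L = f ` ({..<p} \<times> UNIV)"
  define M where "M = {n. int p dvd dot n (int_act A' m)}"
  have inj: "inj_on f ({..<p} \<times> UNIV)"
  proof (rule inj_onI, clarify)
    fix j x j' x' assume j: "j < p" "j' < p" and eq: "f (j, x) = f (j', x')"
    define d where "d = int j - int j'"
    have "d * m i = int_act A (\<lambda>i. x' i + (-1) * x i) i" for i
      using fun_cong[OF eq, of i] unfolding f_def int_act_add int_act_scale d_def by (simp add: algebra_simps)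
    then have dm: "(\<lambda>i. d * m i) = int_act A (\<lambda>i. x' i + (-1) * x i)" by auto
    have "j = j'"
    proof (rule ccontr)
      assume "j \<noteq> j'"
      then have "\<not> int p dvd d" using j unfolding d_def
        using dvd_imp_le_int[of "int j - int j'" "int p"] by auto
      then have "coprime (int p) d" using prime_p prime_imp_coprime by (simp add: prime_imp_coprime)
      then have "gcd d (int p) = 1" by (simp add: coprime_iff_gcd_eq_1 gcd.commute)
      \<comment> \<open>The multiple p m lies in the lattice because A A' m = p m; with d m there as
        well, the Bezout relation puts m itself into it.\<close>
      then obtain a b where ab: "a * d + b * int p = 1" using bezout_int[of d "int p"] by auto
      have "m i = int_act A (\<lambda>i. a * (x' i + (-1) * x i) + b * int_act A' m i) i" for i
      proof -
        have "int_act A (\<lambda>i. a * (x' i + (-1) * x i) + b * int_act A' m i) i = a * (d * m i) + b * (int p * m i)"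
          unfolding int_act_add[of A "\<lambda>i. a * _ i"] int_act_scale dm [symmetric] int_act_dual ..
        also have "\<dots> = (a * d + b * int p) * m i" by (simp add: algebra_simps)
        finally show ?thesis unfolding ab by simp
      qed
      then show False using nm by blast
    qed
    moreover have "x = x'"
      using eq calculation injD[OF inj_int_act, of x x'] unfolding f_def by (auto simp: fun_eq_iff)
    ultimately show "j = j' \<and> x = x'" by simp
  qed
  have inv: "dual_theta L (-1/\<omega>) = - \<omega>\<^sup>2 * dual_theta M \<omega>" if \<omega>: "Im \<omega> > 0" for \<omega>
  proof -
    have w0: "\<omega> \<noteq> 0" using \<omega> by auto
    have im: "Im (-1/\<omega>) > 0"
    proof -
      have "(Re \<omega>)\<^sup>2 + (Im \<omega>)\<^sup>2 > 0" using \<omega> by (simp add: sum_power2_gt_zero_iff)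
      then show ?thesis using \<omega> by (simp add: Im_divide)
    qed
    define g where "g n = e2pi (\<omega> * of_int (half_form A' n) / of_nat p)" for n
    \<comment> \<open>Poisson summation over the coset of j m produces a character in n with
      exponent proportional to j; summing over all j leaves exactly the n in M.\<close>
    have coset: "(\<Sum>\<^sub>\<infinity>x. e2pi (-1/\<omega> * of_int (half_form A' (f (j, x))) / of_nat p))
       = - (\<omega>\<^sup>2 / of_nat p) * (\<Sum>\<^sub>\<infinity>n. g n * e2pi (of_int (int j * dot n (int_act A' m)) / of_nat p))" for j
    proof -
      define E where "E = e2pi (- (of_nat j * of_nat j * of_int (half_form A' m)) / (of_nat p * \<omega>))"
      have 1: "e2pi (-1/\<omega> * of_int (half_form A' (f (j, x))) / of_nat p)
         = E * e2pi (- of_int (half_form A x) / \<omega> - (of_nat j / \<omega>) * of_int (dot m x))" for x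
        unfolding f_def prod.case half_form_coset E_def e2pi_add [symmetric]
        using w0 p_pos by (intro arg_cong[of _ _ e2pi]) (simp add: field_simps power2_eq_square)
      have 2: "E * e2pi (\<omega> / of_nat p * (of_int (half_form A' n) + of_nat j / \<omega> * of_int (dot n (int_act A' m))
            + (of_nat j / \<omega>)\<^sup>2 * of_int (half_form A' m)))
         = g n * e2pi (of_int (int j * dot n (int_act A' m)) / of_nat p)" for n
        unfolding E_def g_def e2pi_add [symmetric]
        using w0 p_pos by (intro arg_cong[of _ _ e2pi]) (simp add: field_simps power2_eq_square)
      show ?thesis
        unfolding 1 infsum_cmult_right' poisson_half_form[OF \<omega>] 2 [symmetric] by (simp only: mult_ac)
    qed
    have sm: "(\<lambda>n. g n * e2pi (of_int (int j * dot n (int_act A' m)) / of_nat p)) summable_on UNIV" for j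
    proof (rule abs_summable_summable)
      have "norm (e2pi (of_int (int j * dot n (int_act A' m)) / of_nat p)) = 1" for n
        unfolding norm_e2pi by (simp add: Im_divide_of_nat)
      then show "(\<lambda>n. g n * e2pi (of_int (int j * dot n (int_act A' m)) / of_nat p)) abs_summable_on UNIV"
        using dual_theta_summable[OF \<omega>, of UNIV] by (simp add: norm_mult g_def)
    qed
    have sm2: "(\<lambda>n. e2pi (-1/\<omega> * of_int (half_form A' n) / of_nat p)) summable_on L"
      by (rule abs_summable_summable[OF dual_theta_summable[OF im]])
    have smf: "(\<lambda>z. e2pi (-1/\<omega> * of_int (half_form A' (f z)) / of_nat p)) summable_on {..<p} \<times> UNIV"
      using sm2 unfolding L_def summable_on_reindex[OF inj] o_def .
    have "dual_theta L (-1/\<omega>) = (\<Sum>\<^sub>\<infinity>z\<in>{..<p} \<times> UNIV. e2pi (-1/\<omega> * of_int (half_form A' (f z)) / of_nat p))"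
      unfolding dual_theta_def L_def infsum_reindex[OF inj] o_def ..
    also have "\<dots> = (\<Sum>\<^sub>\<infinity>j\<in>{..<p}. \<Sum>\<^sub>\<infinity>x. e2pi (-1/\<omega> * of_int (half_form A' (f (j, x))) / of_nat p))"
      by (rule infsum_Sigma_banach[OF smf, symmetric])
    also have "\<dots> = (\<Sum>j<p. - (\<omega>\<^sup>2 / of_nat p) * (\<Sum>\<^sub>\<infinity>n. g n * e2pi (of_int (int j * dot n (int_act A' m)) / of_nat p)))"
      unfolding coset by simp
    also have "\<dots> = - (\<omega>\<^sup>2 / of_nat p) * (\<Sum>\<^sub>\<infinity>n. \<Sum>j<p. g n * e2pi (of_int (int j * dot n (int_act A' m)) / of_nat p))"
      by (subst infsum_finite_sum) (use sm in \<open>auto simp: sum_distrib_left\<close>)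
    also have "(\<Sum>\<^sub>\<infinity>n. \<Sum>j<p. g n * e2pi (of_int (int j * dot n (int_act A' m)) / of_nat p)) = (\<Sum>\<^sub>\<infinity>n\<in>M. of_nat p * g n)"
      unfolding sum_distrib_left [symmetric] sum_e2pi_residues[OF p_pos(1)] by (rule infsum_cong_neutral) (auto simp: M_def)
    also have "\<dots> = of_nat p * dual_theta M \<omega>" unfolding infsum_cmult_right' dual_theta_def g_def ..
    finally show ?thesis using p_pos by simp
  qed
  have LM: "L \<subseteq> M"
  proof
    fix n assume "n \<in> L"
    then obtain j :: nat and x where n: "n = (\<lambda>i. int j * m i + int_act A x i)" unfolding L_def f_def by auto
    have "dot n (int_act A' m) = int j * (2 * half_form A' m) + int p * dot x m"
      unfolding n dot_add_left dot_scale_left half_form_double[OF even_A']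
      unfolding dot_int_act_commute[OF even_A, symmetric] int_act_dual dot_scale_right ..
    then show "n \<in> M" unfolding M_def using iso by simp
  qed
  define g where "g n = exp (- 2 * pi * of_int (half_form A' n) / real p)" for n
  have gi: "e2pi (\<i> * of_int (half_form A' n) / of_nat p) = of_real (g n)" for n
    unfolding g_def e2pi_def exp_of_real [symmetric] by (intro arg_cong[of _ _ exp]) (simp add: field_simps)
  have sg: "g summable_on X" for X
    using dual_theta_summable[of \<i> X] unfolding gi by (simp add: g_def [abs_def])
  have th: "dual_theta X \<i> = of_real (infsum g X)" for X
    unfolding dual_theta_def gi using has_sum_of_real[OF has_sum_infsum[OF sg]] by (rule infsumI)
  \<comment> \<open>Instead of comparing indices, evaluate at the fixed point i of the inversion:
    the two theta values agree there, all terms are positive and L is contained in M.\<close>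
  have "L = M"
  proof (rule ccontr)
    assume "L \<noteq> M"
    then obtain v where v: "v \<in> M - L" using LM by blast
    have "dual_theta L \<i> = dual_theta M \<i>" using inv[of \<i>] by (simp add: divide_complex_def)
    then have "infsum g L = infsum g M" unfolding th by simp
    then have "infsum g (M - L) = 0" using infsum_Diff[OF sg sg LM] by simp
    then have "g v = 0" by (intro nonneg_infsum_le_0D[OF _ sg _ v]) (auto simp: g_def)
    then show False by (simp add: g_def)
  qed
  have S: "dual_theta L (-1/\<omega>) = - \<omega>\<^sup>2 * dual_theta L \<omega>" if "Im \<omega> > 0" for \<omega>
    using inv[OF that] \<open>L = M\<close> by simp
  \<comment> \<open>By the choice of m, p divides \<open>half_form A'\<close> on all of L, so the
    exponents on L are integral multiples of \<omega>.\<close>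
  have T: "dual_theta L (\<omega> + 1) = dual_theta L \<omega>" for \<omega>
    unfolding dual_theta_def
  proof (rule infsum_cong)
    fix n assume "n \<in> L"
    then obtain j :: nat and x where n: "n = (\<lambda>i. int j * m i + int_act A x i)" unfolding L_def f_def by auto
    have "int p dvd half_form A' n" unfolding n half_form_coset using iso by simp
    then obtain k where k: "half_form A' n = int p * k" by blast
    have "(\<omega> + 1) * of_int (half_form A' n) / of_nat p = \<omega> * of_int (half_form A' n) / of_nat p + of_int k"
      unfolding k using p_pos by (simp add: field_simps)
    then show "e2pi ((\<omega> + 1) * of_int (half_form A' n) / of_nat p) = e2pi (\<omega> * of_int (half_form A' n) / of_nat p)"
      by (simp only: e2pi_add e2pi_of_int mult_1_right)
  qed
  \<comment> \<open>The points i, i + 1, (i - 1) / 2, (i + 1) / 2, i - 1 arise by alternating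
    translation and inversion. The two inversions contribute (i + 1)^4 / 4 = -1 in total, while i -
    1 is also a translate of i.\<close>
  define t where "t = dual_theta L \<i>"
  have 1: "dual_theta L (\<i> + 1) = t" unfolding t_def by (rule T)
  have e1: "-1 / (\<i> + 1) = (\<i> - 1) / 2" by (simp add: complex_eq_iff Re_divide Im_divide)
  have 2: "dual_theta L ((\<i> - 1) / 2) = - (\<i> + 1)\<^sup>2 * t"
    using S[of "\<i> + 1"] unfolding e1 1 by (auto simp del: minus_mult_left)
  have e2: "(\<i> - 1) / 2 + 1 = (\<i> + 1) / 2" by (simp add: field_simps)
  have 3: "dual_theta L ((\<i> + 1) / 2) = - (\<i> + 1)\<^sup>2 * t" using T[of "(\<i> - 1) / 2"] unfolding e2 2 .
  have e3: "-1 / ((\<i> + 1) / 2) = \<i> - 1" by (simp add: complex_eq_iff Re_divide Im_divide)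
  have "Im ((\<i> + 1) / 2) > 0" by simp
  from S[OF this] have 4: "dual_theta L (\<i> - 1) = - ((\<i> + 1) / 2)\<^sup>2 * (- (\<i> + 1)\<^sup>2 * t)" unfolding e3 3 .
  have "(\<i> + 1)\<^sup>2 = 2 * \<i>" by (simp add: power2_eq_square algebra_simps)
  then have "dual_theta L (\<i> - 1) = - t" using 4 by (simp add: power_divide power2_eq_square)
  moreover have "dual_theta L (\<i> - 1) = t" using T[of "\<i> - 1"] unfolding t_def by simp
  ultimately have "t = 0" by simp
  \<comment> \<open>All terms of this sum are positive and L contains 0, so it cannot
    vanish.\<close>
  then have "infsum g L = 0" unfolding t_def th by simp
  moreover have "(\<lambda>i. 0) \<in> L"
  proof -
    have "f (0, \<lambda>i. 0) = (\<lambda>i. 0)" unfolding f_def by (simp add: int_act_def)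
    then show ?thesis unfolding L_def using p_pos by (metis SigmaI UNIV_I imageI lessThan_iff)
  qed
  ultimately have "g (\<lambda>i. 0) = 0" by (intro nonneg_infsum_le_0D[OF _ sg]) (auto simp: g_def)
  then show False by (simp add: g_def)
qed

end

section \<open>Theta series of pairs of vectors\<close>

text \<open>The Siegel upper half space in the entries of a symmetric matrix: positivity of the
  imaginary part by its diagonal and its determinant.\<close>

definition siegel3 :: "complex \<Rightarrow> complex \<Rightarrow> complex \<Rightarrow> bool" where
  "siegel3 t z w \<longleftrightarrow> Im t > 0 \<and> Im w > 0 \<and> Im t * Im w > (Im z)\<^sup>2"

lemma siegel3_swap: "siegel3 t z w \<longleftrightarrow> siegel3 w z t"
  unfolding siegel3_def by (auto simp: mult.commute)

text \<open>This is the action of \<open>E1_mat\<close>. The determinant of the imaginary part gets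
  divided by N = |w|^2, so it stays positive.\<close>

lemma siegel3_partial_inversion:
  assumes "siegel3 t z w"
  shows "siegel3 (t - z\<^sup>2 / w) (- z / w) (- 1 / w)"
proof -
  have w: "Im w > 0" and det: "Im t * Im w > (Im z)\<^sup>2" using assms by (auto simp: siegel3_def)
  have w0: "w \<noteq> 0" using w by auto
  define q where "q = z / w"
  define N where "N = (Re w)\<^sup>2 + (Im w)\<^sup>2"
  have N: "N > 0" unfolding N_def using w by (simp add: sum_power2_gt_zero_iff)
  have z: "z = q * w" unfolding q_def using w0 by simp
  have zz: "z\<^sup>2 / w = q\<^sup>2 * w" unfolding z using w0 by (simp add: power2_eq_square)
  have im: "Im (- 1 / w) = Im w / N" unfolding N_def by (simp add: Im_divide)
  have imw: "Im (- 1 / w) > 0" unfolding im using w N by simp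
  have "(Im (t - z\<^sup>2 / w) * Im w - N * (Im (- z / w))\<^sup>2) = Im t * Im w - (Im z)\<^sup>2"
    unfolding zz N_def minus_divide_left [symmetric] q_def [symmetric] z
    by (simp add: power2_eq_square algebra_simps)
  then have "N * (Im (- z / w))\<^sup>2 < Im (t - z\<^sup>2 / w) * Im w" using det by linarith
  then have d: "(Im (- z / w))\<^sup>2 < Im (t - z\<^sup>2 / w) * Im (- 1 / w)"
    unfolding im using N by (simp add: field_simps)
  then have "0 < Im (t - z\<^sup>2 / w) * Im (- 1 / w)" by (meson le_less_trans zero_le_power2)
  then have "0 < Im (t - z\<^sup>2 / w)" by (rule zero_less_mult_pos2[OF _ imw])
  with imw d show ?thesis unfolding siegel3_def by blast
qed

lemma dot_uminus_left: "dot (\<lambda>i. - x i) y = - dot x y"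
  using dot_scale_left[of "-1" x y] by simp

lemma int_act_uminus: "int_act A (\<lambda>i. - x i) = (\<lambda>i. - int_act A x i)"
  using int_act_scale[of A "-1" x] by simp

lemma half_form_uminus: "even_mat A \<Longrightarrow> half_form A (\<lambda>i. - x i) = half_form A x"
  using half_form_scale[of A "-1" x] by simp

context level_pair
begin

interpretation dual: level_pair p A' A by (rule dual_level_pair)

text \<open>If y is the dual vector with coordinates m, this is e(tr(T \<Omega>)) where 2 T is the
  Gram matrix of x and y; in mixed coordinates the pairing of x and y is the plain
  \<open>dot x m\<close>.\<close>

definition pair_term :: "complex \<Rightarrow> complex \<Rightarrow> complex \<Rightarrow> (4 \<Rightarrow> int) \<times> (4 \<Rightarrow> int) \<Rightarrow> complex" where
  "pair_term t z w = (\<lambda>(x, m). e2pi (of_int (half_form A x) * t + of_int (dot x m) * z + of_int (half_form A' m) * w / of_nat p))"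

lemma qform_mvec_inv_A: "qform A (mvec (matrix_inv A) v) = qform (matrix_inv A) v"
  unfolding qform_mvec mvec_matrix_inv[OF pos_A] by (simp add: mult.commute)

text \<open>Cauchy-Schwarz with a free weight l, from the positivity of the form at l x - y and l x
  + y, where y is the dual vector given by m.\<close>

lemma dot_bound:
  assumes l: "l > 0"
  shows "\<bar>real_of_int (dot x m)\<bar> \<le> l * of_int (half_form A x) + of_int (half_form A' m) / (l * real p)"
proof -
  have tr: "transpose A = A" using even_A by (simp add: even_mat_def)
  have nn: "qform A v \<ge> 0" for v :: "4 \<Rightarrow> real"
    using pos_A unfolding pos_def_mat_qform by (cases "v = (\<lambda>i. 0)") (auto simp: qform_def intro: less_imp_le)
  have "2 * l * (s * real_of_int (dot x m)) \<le> 2 * (l * (l * of_int (half_form A x))) + 2 * (of_int (half_form A' m) / real p)"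
    if s: "s\<^sup>2 = 1" for s :: real
  proof -
    define v where "v = mvec (matrix_inv A) (\<lambda>i. s * real_of_int (m i))"
    have mv: "mvec A v = (\<lambda>i. s * real_of_int (m i))" unfolding v_def by (rule mvec_matrix_inv[OF pos_A])
    have q1: "qform A (\<lambda>i. l * real_of_int (x i)) = l * (l * of_int (2 * half_form A x))"
      unfolding qform_of_int[OF even_A, symmetric] qform_def by (simp add: sum_distrib_left mult_ac)
    have "qform A v = qform (matrix_inv A) (\<lambda>i. s * real_of_int (m i))"
      unfolding v_def by (rule qform_mvec_inv_A)
    also have "\<dots> = s\<^sup>2 * qform (matrix_inv A) (\<lambda>i. real_of_int (m i))"
      unfolding qform_def by (simp add: sum_distrib_left mult_ac power2_eq_square)
    also have "\<dots> = of_int (2 * half_form A' m) / real p"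
      unfolding s matrix_inv_A qform_scaleR qform_of_int[OF even_A'] by simp
    finally have q2: "qform A v = of_int (2 * half_form A' m) / real p" .
    have lin: "(\<Sum>i\<in>UNIV. mvec A v i * (l * real_of_int (x i))) = l * (s * of_int (dot x m))"
      unfolding mv dot_def by (simp add: sum_distrib_left mult_ac)
    have "0 \<le> qform A (\<lambda>i. l * real_of_int (x i) - v i)" by (rule nn)
    also have "\<dots> = l * (l * of_int (2 * half_form A x)) - 2 * (l * (s * of_int (dot x m))) + of_int (2 * half_form A' m) / real p"
      unfolding qform_diff[OF tr] q1 q2 lin ..
    finally show ?thesis by simp
  qed
  from this[of 1] this[of "-1"]
  have "2 * l * \<bar>real_of_int (dot x m)\<bar> \<le> 2 * (l * (l * of_int (half_form A x))) + 2 * (of_int (half_form A' m) / real p)"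
    by (cases "real_of_int (dot x m) \<ge> 0") auto
  also have "\<dots> = 2 * l * (l * of_int (half_form A x) + of_int (half_form A' m) / (l * real p))"
    using l p_pos by (simp add: field_simps)
  finally show ?thesis using l by (subst (asm) mult_le_cancel_left_pos) auto
qed

lemma pair_term_summable:
  assumes "siegel3 t z w"
  shows "(\<lambda>v. norm (pair_term t z w v)) summable_on X"
proof -
  define \<tau> \<zeta> \<nu> where "\<tau> = Im t" "\<zeta> = \<bar>Im z\<bar>" "\<nu> = Im w"
  have pos: "\<tau> > 0" "\<nu> > 0" "\<zeta> \<ge> 0" and det: "\<zeta>\<^sup>2 < \<tau> * \<nu>"
    using assms by (auto simp: siegel3_def \<tau>_\<zeta>_\<nu>_def)
  \<comment> \<open>This weight balances the two losses: \<tau> - \<zeta> l and \<nu> - \<zeta> / l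
    are both positive because of the determinant condition.\<close>
  define l where "l = sqrt (\<tau> / \<nu>)"
  have l: "l > 0" unfolding l_def using pos by simp
  have \<zeta>: "\<zeta> < sqrt (\<tau> * \<nu>)" using det pos by (simp add: real_less_rsqrt)
  have "\<zeta> * l < sqrt (\<tau> * \<nu>) * l" using \<zeta> l by simp
  also have "\<dots> = \<tau>" unfolding l_def real_sqrt_mult [symmetric] using pos by simp
  finally have c1: "\<tau> - \<zeta> * l > 0" by simp
  have "\<zeta> / l < sqrt (\<tau> * \<nu>) / l" using \<zeta> l by (simp add: divide_strict_right_mono)
  also have "\<dots> = \<nu>" unfolding l_def real_sqrt_divide [symmetric] using pos by simp
  finally have c2: "\<nu> - \<zeta> / l > 0" by simp
  define f where "f x = norm (e2pi (\<i> * of_real (\<tau> - \<zeta> * l) * of_int (half_form A x)))" for x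
  define g where "g m = norm (e2pi (\<i> * of_real (\<nu> - \<zeta> / l) * of_int (half_form A' m) / of_nat p))" for m
  have sf: "f summable_on UNIV"
    unfolding f_def using half_form_theta_summable[OF even_A pos_A, of "\<i> * of_real (\<tau> - \<zeta> * l)" "\<lambda>i. 0" UNIV] c1 by simp
  have sg: "g summable_on UNIV"
    unfolding g_def using c2 by (intro dual_theta_summable) simp
  have "(\<lambda>(x, m). f x * g m) summable_on UNIV \<times> UNIV"
    by (rule summable_on_mult_Times[OF sf sg]) (simp_all add: f_def g_def)
  then have sm: "(\<lambda>(x, m). f x * g m) summable_on UNIV" by simp
  have bd: "norm (pair_term t z w (x, m)) \<le> f x * g m" for x m
  proof -
    define a b d where "a = real_of_int (half_form A x)" "b = real_of_int (half_form A' m)" "d = real_of_int (dot x m)"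
    have "\<zeta> * \<bar>d\<bar> \<le> \<zeta> * (l * a + b / (l * real p))"
      unfolding a_b_d_def using dot_bound[OF l] pos by (intro mult_left_mono) auto
    moreover have "- (d * Im z) \<le> \<zeta> * \<bar>d\<bar>"
    proof -
      have "- (d * Im z) \<le> \<bar>d * Im z\<bar>" by linarith
      then show ?thesis unfolding \<tau>_\<zeta>_\<nu>_def abs_mult by (simp add: mult.commute)
    qed
    ultimately have "- (a * \<tau> + d * Im z + b * \<nu> / real p) \<le> - (a * \<tau> + b * \<nu> / real p) + \<zeta> * (l * a + b / (l * real p))"
      by linarith
    also have "\<dots> = - ((\<tau> - \<zeta> * l) * a) - ((\<nu> - \<zeta> / l) * b / real p)"
      using l p_pos by (simp add: field_simps)
    finally have "2 * pi * - (a * \<tau> + d * Im z + b * \<nu> / real p) \<le> 2 * pi * (- ((\<tau> - \<zeta> * l) * a) - ((\<nu> - \<zeta> / l) * b / real p))"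
      by (intro mult_left_mono) auto
    moreover have "Im (of_int (half_form A x) * t + of_int (dot x m) * z + of_int (half_form A' m) * w / of_nat p)
       = a * \<tau> + d * Im z + b * \<nu> / real p"
      unfolding a_b_d_def \<tau>_\<zeta>_\<nu>_def by (simp add: Im_divide_of_nat)
    moreover have "f x * g m = exp (2 * pi * (- ((\<tau> - \<zeta> * l) * a) - ((\<nu> - \<zeta> / l) * b / real p)))"
      unfolding f_def g_def norm_e2pi exp_add [symmetric] a_b_d_def
      by (intro arg_cong[of _ _ exp]) (simp add: Im_divide_of_nat algebra_simps diff_divide_distrib)
    ultimately show ?thesis unfolding pair_term_def prod.case norm_e2pi by (simp only: exp_le_cancel_iff mult_minus_right mult_minus_left)
  qed
  have "(\<lambda>v. norm (pair_term t z w v)) summable_on UNIV"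
    by (rule summable_on_comparison_test[OF sm]) (use bd in auto)
  then show ?thesis by (rule summable_on_subset_banach) simp
qed

definition pair_theta :: "((4 \<Rightarrow> int) \<times> (4 \<Rightarrow> int)) set \<Rightarrow> complex \<Rightarrow> complex \<Rightarrow> complex \<Rightarrow> complex" where
  "pair_theta X t z w = (\<Sum>\<^sub>\<infinity>v\<in>X. pair_term t z w v)"

lemma pair_term_int_act:
  "pair_term t z w (x, int_act A y) = e2pi (of_int (half_form A x) * t + of_int (dot x (int_act A y)) * z + of_int (half_form A y) * w)"
  unfolding pair_term_def prod.case half_form_int_act using p_pos by (simp add: mult_ac)

lemma inj_map_int_act: "inj (\<lambda>(x, y). (x, int_act A y))"
  by (auto intro!: injI dest: injD[OF inj_int_act])

lemma pair_theta_lattice: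
  "pair_theta (UNIV \<times> range (int_act A)) t z w = (\<Sum>\<^sub>\<infinity>(x, y)\<in>UNIV. pair_term t z w (x, int_act A y))"
proof -
  have eq: "UNIV \<times> range (int_act A) = (\<lambda>(x, y). (x, int_act A y)) ` UNIV" by (auto simp: image_iff)
  show ?thesis unfolding pair_theta_def eq infsum_reindex[OF inj_map_int_act] o_def
    by (simp add: case_prod_unfold)
qed

text \<open>For fixed x, Poisson summation runs over the second vector only and replaces the lattice
  by its dual. The linear term has coefficient z / w and direction
  \<open>int_act A x\<close>.\<close>

theorem pair_theta_partial_inversion:
  assumes s: "siegel3 t z w"
  shows "pair_theta (UNIV \<times> range (int_act A)) (t - z\<^sup>2 / w) (- z / w) (- 1 / w) = - (w\<^sup>2 / of_nat p) * pair_theta UNIV t z w"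
proof -
  have w: "Im w > 0" using s by (simp add: siegel3_def)
  have w0: "w \<noteq> 0" using w by auto
  note s' = siegel3_partial_inversion[OF s]
  let ?T = "\<lambda>x y. pair_term (t - z\<^sup>2 / w) (- z / w) (- 1 / w) (x, int_act A y)"
  have sm1: "(\<lambda>(x, y). ?T x y) summable_on UNIV \<times> UNIV"
  proof -
    have "pair_term (t - z\<^sup>2 / w) (- z / w) (- 1 / w) summable_on range (\<lambda>(x, y). (x, int_act A y))"
      by (rule abs_summable_summable[OF pair_term_summable[OF s']])
    then show ?thesis unfolding summable_on_reindex[OF inj_map_int_act] by (simp add: o_def case_prod_unfold)
  qed
  have sm2: "pair_term t z w summable_on UNIV \<times> UNIV"
    by (rule abs_summable_summable[OF pair_term_summable[OF s]])
  have inner: "(\<Sum>\<^sub>\<infinity>y. ?T x y) = - (w\<^sup>2 / of_nat p) * (\<Sum>\<^sub>\<infinity>m. pair_term t z w (x, m))" for x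
  proof -
    define E where "E = e2pi (of_int (half_form A x) * (t - z\<^sup>2 / w))"
    have "?T x y = E * e2pi (- of_int (half_form A y) / w - (z / w) * of_int (dot (int_act A x) y))" for y
      unfolding pair_term_int_act E_def e2pi_add [symmetric] dot_int_act_commute[OF even_A, symmetric]
      by (intro arg_cong[of _ _ e2pi]) (simp add: algebra_simps)
    then have "(\<Sum>\<^sub>\<infinity>y. ?T x y) = E * (- (w\<^sup>2 / of_nat p) * (\<Sum>\<^sub>\<infinity>n. e2pi (w / of_nat p * (of_int (half_form A' n)
        + z / w * of_int (dot n (int_act A' (int_act A x))) + (z / w)\<^sup>2 * of_int (half_form A' (int_act A x))))))"
      by (simp only: infsum_cmult_right' poisson_half_form[OF w])
    also have "\<dots> = - (w\<^sup>2 / of_nat p) * (\<Sum>\<^sub>\<infinity>n. E * e2pi (w / of_nat p * (of_int (half_form A' n)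
        + z / w * of_int (dot n (int_act A' (int_act A x))) + (z / w)\<^sup>2 * of_int (half_form A' (int_act A x)))))"
      by (simp only: infsum_cmult_right' mult.left_commute[of E])
    also have "\<dots> = - (w\<^sup>2 / of_nat p) * (\<Sum>\<^sub>\<infinity>m. pair_term t z w (x, m))"
    proof (intro arg_cong2[of _ _ _ _ "(*)"] refl infsum_cong)
      fix n
      show "E * e2pi (w / of_nat p * (of_int (half_form A' n)
        + z / w * of_int (dot n (int_act A' (int_act A x))) + (z / w)\<^sup>2 * of_int (half_form A' (int_act A x)))) = pair_term t z w (x, n)"
        unfolding E_def pair_term_def prod.case int_act_dual' dot_scale_right half_form_int_act e2pi_add [symmetric]
          dot_commute[of x n]
        using w0 p_pos by (intro arg_cong[of _ _ e2pi]) (simp add: field_simps power2_eq_square)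
    qed
    finally show ?thesis .
  qed
  have "pair_theta (UNIV \<times> range (int_act A)) (t - z\<^sup>2 / w) (- z / w) (- 1 / w) = (\<Sum>\<^sub>\<infinity>x. \<Sum>\<^sub>\<infinity>y. ?T x y)"
    unfolding pair_theta_lattice using infsum_Sigma_banach[OF sm1] by simp
  also have "\<dots> = - (w\<^sup>2 / of_nat p) * (\<Sum>\<^sub>\<infinity>x. \<Sum>\<^sub>\<infinity>m. pair_term t z w (x, m))"
    unfolding inner infsum_cmult_right' ..
  also have "(\<Sum>\<^sub>\<infinity>x. \<Sum>\<^sub>\<infinity>m. pair_term t z w (x, m)) = pair_theta UNIV t z w"
    unfolding pair_theta_def using infsum_Sigma_banach[OF sm2] by simp
  finally show ?thesis .
qed

text \<open>Now the first vector is transformed with m fixed; afterwards both vectors run over the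
  dual lattice.\<close>

lemma pair_theta_second_inversion:
  assumes s: "siegel3 t z w"
  shows "pair_theta UNIV (- 1 / t) (- z / t) (w - z\<^sup>2 / t) = - (t\<^sup>2 / of_nat p) *
    (\<Sum>\<^sub>\<infinity>m. \<Sum>\<^sub>\<infinity>n. e2pi ((of_int (half_form A' n) * t + of_int (dot n (int_act A' m)) * z + of_int (half_form A' m) * w) / of_nat p))"
proof -
  have t: "Im t > 0" using s by (simp add: siegel3_def)
  have t0: "t \<noteq> 0" using t by auto
  have s': "siegel3 (- 1 / t) (- z / t) (w - z\<^sup>2 / t)"
    using siegel3_partial_inversion[of w z t] s by (simp add: siegel3_swap)
  let ?T = "pair_term (- 1 / t) (- z / t) (w - z\<^sup>2 / t)"
  have sm: "(\<lambda>(x, m). ?T (x, m)) summable_on UNIV \<times> UNIV"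
    using abs_summable_summable[OF pair_term_summable[OF s', of "UNIV \<times> UNIV"]] by (simp add: case_prod_unfold)
  have inner: "(\<Sum>\<^sub>\<infinity>x. ?T (x, m)) = - (t\<^sup>2 / of_nat p) * (\<Sum>\<^sub>\<infinity>n. e2pi ((of_int (half_form A' n) * t
      + of_int (dot n (int_act A' m)) * z + of_int (half_form A' m) * w) / of_nat p))" for m
  proof -
    define E where "E = e2pi (of_int (half_form A' m) * (w - z\<^sup>2 / t) / of_nat p)"
    have "?T (x, m) = E * e2pi (- of_int (half_form A x) / t - (z / t) * of_int (dot m x))" for x
      unfolding pair_term_def prod.case E_def e2pi_add [symmetric] dot_commute[of m x]
      by (intro arg_cong[of _ _ e2pi]) (simp add: algebra_simps)
    then have "(\<Sum>\<^sub>\<infinity>x. ?T (x, m)) = E * (- (t\<^sup>2 / of_nat p) * (\<Sum>\<^sub>\<infinity>n. e2pi (t / of_nat p * (of_int (half_form A' n)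
        + z / t * of_int (dot n (int_act A' m)) + (z / t)\<^sup>2 * of_int (half_form A' m)))))"
      by (simp only: infsum_cmult_right' poisson_half_form[OF t])
    also have "\<dots> = - (t\<^sup>2 / of_nat p) * (\<Sum>\<^sub>\<infinity>n. E * e2pi (t / of_nat p * (of_int (half_form A' n)
        + z / t * of_int (dot n (int_act A' m)) + (z / t)\<^sup>2 * of_int (half_form A' m))))"
      by (simp only: infsum_cmult_right' mult.left_commute[of E])
    also have "\<dots> = - (t\<^sup>2 / of_nat p) * (\<Sum>\<^sub>\<infinity>n. e2pi ((of_int (half_form A' n) * t
      + of_int (dot n (int_act A' m)) * z + of_int (half_form A' m) * w) / of_nat p))"
      unfolding E_def e2pi_add [symmetric]
      using t0 p_pos by (intro arg_cong2[of _ _ _ _ "(*)"] refl infsum_cong arg_cong[of _ _ e2pi])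
        (simp add: field_simps power2_eq_square)
    finally show ?thesis .
  qed
  have "pair_theta UNIV (- 1 / t) (- z / t) (w - z\<^sup>2 / t) = (\<Sum>\<^sub>\<infinity>x. \<Sum>\<^sub>\<infinity>m. ?T (x, m))"
    unfolding pair_theta_def using infsum_Sigma_banach[OF sm] by (simp add: case_prod_unfold)
  also have "\<dots> = (\<Sum>\<^sub>\<infinity>m. \<Sum>\<^sub>\<infinity>x. ?T (x, m))" by (rule infsum_swap_banach[OF sm])
  finally show ?thesis unfolding inner infsum_cmult_right' .
qed

text \<open>Negative matrix inversion is the composition of the two partial inversions. Their
  factors -(d / t)^2 / p and -t^2 / p multiply to d^2 / p^2, so the signs cancel.\<close>

theorem pair_theta_full_inversion:
  assumes s: "siegel3 t z w"
  defines "d \<equiv> t * w - z\<^sup>2"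
  shows "pair_theta (UNIV \<times> range (int_act A)) (- w / d) (z / d) (- t / d) = d\<^sup>2 / of_nat p ^ 2 *
    (\<Sum>\<^sub>\<infinity>m. \<Sum>\<^sub>\<infinity>n. e2pi ((of_int (half_form A' n) * t + of_int (dot n (int_act A' m)) * z + of_int (half_form A' m) * w) / of_nat p))"
proof -
  have t0: "t \<noteq> 0" using s by (auto simp: siegel3_def)
  have s': "siegel3 (- 1 / t) (- z / t) (w - z\<^sup>2 / t)"
    using siegel3_partial_inversion[of w z t] s by (simp add: siegel3_swap)
  then have W0: "w - z\<^sup>2 / t \<noteq> 0" by (auto simp: siegel3_def)
  have d: "d = t * (w - z\<^sup>2 / t)" unfolding d_def using t0 by (simp add: field_simps)
  have d0: "d \<noteq> 0" unfolding d using t0 W0 by simp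
  have W: "w - z\<^sup>2 / t = d / t" unfolding d using t0 by simp
  have 1: "- w / d = - 1 / t - (- z / t)\<^sup>2 / (w - z\<^sup>2 / t)"
  proof -
    have "- 1 / t - (- z / t)\<^sup>2 / (w - z\<^sup>2 / t) = - (d + z\<^sup>2) / (t * d)"
      unfolding W using t0 d0 by (simp add: field_simps power2_eq_square)
    also have "d + z\<^sup>2 = t * w" by (simp add: d_def)
    also have "- (t * w) / (t * d) = - w / d" using t0 by simp
    finally show ?thesis by (rule sym)
  qed
  have 2: "z / d = - (- z / t) / (w - z\<^sup>2 / t)" unfolding W using t0 d0 by (simp add: field_simps)
  have 3: "- t / d = - 1 / (w - z\<^sup>2 / t)" unfolding W using t0 d0 by (simp add: field_simps)
  have e: "- ((d / t)\<^sup>2 / of_nat p) * (- (t\<^sup>2 / of_nat p) * S) = d\<^sup>2 / of_nat p ^ 2 * S" for S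
    using t0 by (simp add: power2_eq_square)
  have "pair_theta (UNIV \<times> range (int_act A)) (- w / d) (z / d) (- t / d)
     = - ((w - z\<^sup>2 / t)\<^sup>2 / of_nat p) * pair_theta UNIV (- 1 / t) (- z / t) (w - z\<^sup>2 / t)"
    using pair_theta_partial_inversion[OF s'] unfolding 1 [symmetric] 2 [symmetric] 3 [symmetric] .
  then show ?thesis unfolding pair_theta_second_inversion[OF s] unfolding W e .
qed

text \<open>The argument (w, -p z, p^2 t) exchanges the two vectors and rescales one of them: the
  dual vector of m, multiplied by -p, becomes the first vector, with lattice coordinates -A' m. The
  minus sign matches that of -p z.\<close>

lemma pair_theta_dual_scaled:
  assumes s: "siegel3 t z w"
  shows "(\<Sum>\<^sub>\<infinity>m. \<Sum>\<^sub>\<infinity>n. e2pi ((of_int (half_form A' n) * w + of_int (dot n (int_act A' m)) * (- of_nat p * z)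
      + of_int (half_form A' m) * (of_nat p ^ 2 * t)) / of_nat p)) = pair_theta (range (int_act A') \<times> UNIV) t z w"
proof -
  define h where "h = (\<lambda>(m, n). (int_act A' (\<lambda>i. - m i), n :: 4 \<Rightarrow> int))"
  have inj: "inj h"
    unfolding h_def by (auto intro!: injI dest!: injD[OF dual.inj_int_act] simp: fun_eq_iff)
  have rng: "range (int_act A') \<times> UNIV = range h"
  proof -
    have "(int_act A' m, n) = h (\<lambda>i. - m i, n)" for m n unfolding h_def by simp
    then have "range (int_act A') \<times> UNIV \<subseteq> range h" by blast
    moreover have "range h \<subseteq> range (int_act A') \<times> UNIV" unfolding h_def by auto
    ultimately show ?thesis by blast
  qed
  have tm: "pair_term t z w (h (m, n)) = e2pi ((of_int (half_form A' n) * w + of_int (dot n (int_act A' m)) * (- of_nat p * z)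
      + of_int (half_form A' m) * (of_nat p ^ 2 * t)) / of_nat p)" for m n
    unfolding h_def prod.case pair_term_def dual.half_form_int_act int_act_uminus dot_uminus_left
      dot_commute[of "int_act A' m" n] half_form_uminus[OF even_A] dual.half_form_int_act
    using p_pos by (intro arg_cong[of _ _ e2pi]) (simp add: field_simps power2_eq_square)
  have "pair_term t z w summable_on range h"
    by (rule abs_summable_summable[OF pair_term_summable[OF s]])
  then have sm: "(\<lambda>(m, n). pair_term t z w (h (m, n))) summable_on UNIV \<times> UNIV"
    unfolding summable_on_reindex[OF inj] by (simp add: o_def case_prod_unfold)
  have "pair_theta (range (int_act A') \<times> UNIV) t z w = (\<Sum>\<^sub>\<infinity>v. pair_term t z w (h v))"
    unfolding pair_theta_def rng infsum_reindex[OF inj] o_def ..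
  also have "\<dots> = (\<Sum>\<^sub>\<infinity>m. \<Sum>\<^sub>\<infinity>n. pair_term t z w (h (m, n)))"
    using infsum_Sigma_banach[OF sm] by (simp add: case_prod_unfold)
  finally show ?thesis unfolding tm ..
qed

text \<open>The same exchange when only one of the vectors was dual: the other one stays in the
  lattice and reappears in dual coordinates as \<open>int_act A x\<close>.\<close>

lemma pair_theta_swap_scaled:
  shows "pair_theta UNIV w (- of_nat p * z) (of_nat p ^ 2 * t) = pair_theta (range (int_act A') \<times> range (int_act A)) t z w"
proof -
  define h where "h = (\<lambda>(x, m). (int_act A' (\<lambda>i. - m i), int_act A x))"
  have inj: "inj h"
    unfolding h_def by (auto intro!: injI dest!: injD[OF dual.inj_int_act] injD[OF inj_int_act] simp: fun_eq_iff)
  have rng: "range (int_act A') \<times> range (int_act A) = range h"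
  proof -
    have "(int_act A' m, int_act A x) = h (x, \<lambda>i. - m i)" for m x unfolding h_def by simp
    then have "range (int_act A') \<times> range (int_act A) \<subseteq> range h" by blast
    moreover have "range h \<subseteq> range (int_act A') \<times> range (int_act A)" unfolding h_def by auto
    ultimately show ?thesis by blast
  qed
  have tm: "pair_term t z w (h (x, m)) = pair_term w (- of_nat p * z) (of_nat p ^ 2 * t) (x, m)" for x m
  proof -
    have "dot (int_act A' (\<lambda>i. - m i)) (int_act A x) = - (int p * dot x m)"
      unfolding int_act_uminus dot_uminus_left dot_int_act_commute[OF even_A', symmetric] int_act_dual' dot_scale_right
      by (simp add: dot_commute)
    then show ?thesis
      unfolding h_def prod.case pair_term_int_act unfolding pair_term_def prod.case dual.half_form_int_act
        half_form_uminus[OF even_A']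
      using p_pos by (intro arg_cong[of _ _ e2pi]) (simp add: field_simps power2_eq_square)
  qed
  show ?thesis
    unfolding pair_theta_def rng infsum_reindex[OF inj] o_def
    by (rule infsum_cong) (metis tm surj_pair)
qed

end

section \<open>Slash operators of degree two\<close>

lemma sum_UNIV_Plus:
  fixes f :: "'a::finite + 'b::finite \<Rightarrow> 'c::comm_monoid_add"
  shows "(\<Sum>x\<in>UNIV. f x) = (\<Sum>a\<in>UNIV. f (Inl a)) + (\<Sum>b\<in>UNIV. f (Inr b))"
  unfolding UNIV_Plus_UNIV [symmetric] by (subst sum.Plus) (simp_all add: o_def)

lemma mat2_nth [simp]:
  "mat2 a b c d $ 1 $ 1 = a" "mat2 a b c d $ 1 $ 2 = b" "mat2 a b c d $ 2 $ 1 = c" "mat2 a b c d $ 2 $ 2 = d"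
  by (simp_all add: mat2_def)

lemma mat2_eqI:
  fixes M N :: "'a^2^2"
  assumes "M $ 1 $ 1 = N $ 1 $ 1" "M $ 1 $ 2 = N $ 1 $ 2" "M $ 2 $ 1 = N $ 2 $ 1" "M $ 2 $ 2 = N $ 2 $ 2"
  shows "M = N"
  using assms by (simp add: vec_eq_iff forall_2)

lemma mat2_mult: "mat2 a b c d ** mat2 e f g h = mat2 (a * e + b * g) (a * f + b * h) (c * e + d * g) (c * f + d * h)"
  by (rule mat2_eqI) (simp_all add: matrix_matrix_mult_def sum_2)

lemma mat2_add: "mat2 a b c d + mat2 e f g h = mat2 (a + e) (b + f) (c + g) (d + h :: 'a::monoid_add)"
  by (rule mat2_eqI) simp_all

lemma mat2_diff: "mat2 a b c d - mat2 e f g h = mat2 (a - e) (b - f) (c - g) (d - h :: 'a::group_add)"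
  by (rule mat2_eqI) simp_all

lemma mat2_uminus: "- mat2 a b c d = mat2 (- a) (- b) (- c) (- d :: 'a::group_add)"
  by (rule mat2_eqI) simp_all

lemma mat2_scaleR: "r *\<^sub>R mat2 a b c d = mat2 (r *\<^sub>R a) (r *\<^sub>R b) (r *\<^sub>R c) (r *\<^sub>R d)"
  by (rule mat2_eqI) simp_all

lemma mat2_transpose: "transpose (mat2 a b c d) = mat2 a c b d"
  by (rule mat2_eqI) (simp_all add: transpose_def)

lemma mat_1_mat2: "(mat 1 :: 'a::zero_neq_one^2^2) = mat2 1 0 0 1"
  by (rule mat2_eqI) (simp_all add: mat_def)

lemma zero_mat2: "(0 :: 'a::zero^2^2) = mat2 0 0 0 0"
  by (rule mat2_eqI) simp_all

lemma cmat_mat2: "cmat (mat2 a b c d) = mat2 (of_real a) (of_real b) (of_real c) (of_real d)"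
  by (rule mat2_eqI) (simp_all add: map_matrix_def)

lemma det_mat2: "det (mat2 a b c d) = a * d - b * (c :: 'a::comm_ring_1)"
  by (simp add: det_2)

lemmas mat2_simps = mat2_mult mat2_add mat2_diff mat2_uminus mat2_scaleR mat2_transpose cmat_mat2

lemma matrix_inv_eqI:
  fixes M X :: "complex^'n^'n"
  assumes "M ** X = mat 1" "X ** M = mat 1"
  shows "matrix_inv M = X"
proof -
  have "M ** matrix_inv M = mat 1 \<and> matrix_inv M ** M = mat 1"
    unfolding matrix_inv_def by (rule someI[where x = X]) (simp add: assms)
  then have "X ** (M ** matrix_inv M) = X" by simp
  then show ?thesis unfolding matrix_mul_assoc assms by simp
qed

lemma matrix_inv_mat2:
  fixes a b c d :: complex
  assumes "a * d - b * c \<noteq> 0"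
  shows "matrix_inv (mat2 a b c d)
    = mat2 (d / (a * d - b * c)) (- b / (a * d - b * c)) (- c / (a * d - b * c)) (a / (a * d - b * c))"
proof (rule matrix_inv_eqI)
  define D where "D = a * d - b * c"
  have D: "D \<noteq> 0" using assms by (simp add: D_def)
  have f: "(a * d - b * c) / D = 1" using D by (simp add: D_def)
  have "a * (d / D) + b * (- c / D) = (a * d - b * c) / D" "c * (- b / D) + d * (a / D) = (a * d - b * c) / D"
    "d / D * a + - b / D * c = (a * d - b * c) / D" "- c / D * b + a / D * d = (a * d - b * c) / D"
    by (simp_all add: diff_divide_distrib mult.commute)
  note e1 = this[unfolded f]
  have e2: "a * (- b / D) + b * (a / D) = 0" "c * (d / D) + d * (- c / D) = 0"
    "d / D * b + - b / D * d = 0" "- c / D * a + a / D * c = 0"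
    by simp_all
  note e = e1 e2
  show "mat2 a b c d ** mat2 (d / (a * d - b * c)) (- b / (a * d - b * c)) (- c / (a * d - b * c)) (a / (a * d - b * c)) = mat 1"
    unfolding D_def [symmetric] mat2_mult e mat_1_mat2 ..
  show "mat2 (d / (a * d - b * c)) (- b / (a * d - b * c)) (- c / (a * d - b * c)) (a / (a * d - b * c)) ** mat2 a b c d = mat 1"
    unfolding D_def [symmetric] mat2_mult e mat_1_mat2 ..
qed

lemma block_mat_mult:
  fixes A A' :: "real^2^2"
  shows "block_mat A B C D ** block_mat A' B' C' D'
    = block_mat (A ** A' + B ** C') (A ** B' + B ** D') (C ** A' + D ** C') (C ** B' + D ** (D' :: real^2^2))"
  unfolding block_mat_def matrix_matrix_mult_def vec_eq_iff sum_UNIV_Plus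
  by (auto simp: sum_2 split: sum.split)

lemma block_mat_transpose:
  "transpose (block_mat A B C D) = block_mat (transpose A) (transpose C) (transpose B) (transpose (D :: 'a^'n^'n))"
  unfolding block_mat_def transpose_def vec_eq_iff by (auto split: sum.split)

lemma block_mat_scaleR: "r *\<^sub>R block_mat A B C D = block_mat (r *\<^sub>R A) (r *\<^sub>R B) (r *\<^sub>R C) (r *\<^sub>R (D :: real^'n^'n))"
  unfolding block_mat_def vec_eq_iff by (auto split: sum.split)

lemma blk_block_mat [simp]:
  "blkA (block_mat A B C D) = A" "blkB (block_mat A B C D) = B"
  "blkC (block_mat A B C D) = C" "blkD (block_mat A B C D) = D"
  by (simp_all add: blkA_def blkB_def blkC_def blkD_def block_mat_def)

text \<open>One nonzero entry of \<open>symp_J\<close> already determines the multiplier. Every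
  matrix slashed with in the trace is normalised to be symplectic, so this factor is always
  1.\<close>

lemma similitude_eq_1:
  assumes "transpose \<gamma> ** symp_J ** \<gamma> = symp_J"
  shows "similitude \<gamma> = 1"
  unfolding similitude_def
proof (rule the_equality)
  show "transpose \<gamma> ** symp_J ** \<gamma> = 1 *\<^sub>R symp_J" using assms by simp
  fix m assume "transpose \<gamma> ** symp_J ** \<gamma> = m *\<^sub>R symp_J"
  then have "symp_J $ Inl 1 $ Inr 1 = (m *\<^sub>R symp_J) $ Inl 1 $ Inr 1" unfolding assms by simp
  then show "m = 1" by (simp add: symp_J_def block_mat_def mat_def)
qed

lemmas symp_simps = symp_J_def mat_1_mat2 zero_mat2 block_mat_mult block_mat_transpose block_mat_scaleR mat2_simps

text \<open>A computation rule: numerator, denominator and its determinant D are supplied entrywise,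
  and the inverse of the denominator is written as the adjugate over D.\<close>

lemma slash_mat2:
  assumes "transpose \<gamma> ** symp_J ** \<gamma> = symp_J"
    and "cmat (blkA \<gamma>) ** \<Omega> + cmat (blkB \<gamma>) = N" and "cmat (blkC \<gamma>) ** \<Omega> + cmat (blkD \<gamma>) = mat2 a b c d"
    and "a * d - b * c = D" "D \<noteq> 0"
    and "N ** mat2 (d / D) (- b / D) (- c / D) (a / D) = R"
  shows "slash 4 f \<gamma> \<Omega> = inverse (D ^ 4) * f R"
proof -
  have "matrix_inv (mat2 a b c d) = mat2 (d / D) (- b / D) (- c / D) (a / D)"
    using matrix_inv_mat2[of a d b c] assms(4,5) by simp
  then show ?thesis
    unfolding slash_def Let_def similitude_eq_1[OF assms(1)] assms(2,3) det_mat2 assms(4)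
    using assms(6) by (simp add: power_int_minus)
qed

section \<open>The slash operators occurring in the trace\<close>

lemma slash_transl:
  "slash 4 f (transl (mat2 a 0 0 c)) (mat2 t z z w) = f (mat2 (t + of_real a) z z (w + of_real c))"
proof -
  have "slash 4 f (transl (mat2 a 0 0 c)) (mat2 t z z w) = inverse (1 ^ 4) * f (mat2 (t + of_real a) z z (w + of_real c))"
  proof (rule slash_mat2)
    show "transpose (transl (mat2 a 0 0 c)) ** symp_J ** transl (mat2 a 0 0 c) = symp_J"
      unfolding transl_def by (simp add: symp_simps)
    show "cmat (blkA (transl (mat2 a 0 0 c))) ** mat2 t z z w + cmat (blkB (transl (mat2 a 0 0 c)))
       = mat2 (t + of_real a) z z (w + of_real c)"
      unfolding transl_def by (simp add: mat_1_mat2 zero_mat2 mat2_simps)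
    show "cmat (blkC (transl (mat2 a 0 0 c))) ** mat2 t z z w + cmat (blkD (transl (mat2 a 0 0 c))) = mat2 1 0 0 1"
      unfolding transl_def by (simp add: mat_1_mat2 zero_mat2 mat2_simps)
  qed (simp_all add: mat2_mult)
  then show ?thesis by simp
qed

lemma slash_E1:
  assumes "w \<noteq> 0"
  shows "slash 4 f E1_mat (mat2 t z z w) = inverse (w ^ 4) * f (mat2 (t - z\<^sup>2 / w) (- z / w) (- z / w) (- 1 / w))"
proof -
  have "slash 4 f E1_mat (mat2 t z z w) = inverse ((- w) ^ 4) * f (mat2 (t - z\<^sup>2 / w) (- z / w) (- z / w) (- 1 / w))"
  proof (rule slash_mat2)
    show "transpose E1_mat ** symp_J ** E1_mat = symp_J"
      unfolding E1_mat_def by (simp add: symp_simps)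
    show "cmat (blkA E1_mat) ** mat2 t z z w + cmat (blkB E1_mat) = mat2 t z 0 1"
      unfolding E1_mat_def by (simp add: mat2_simps)
    show "cmat (blkC E1_mat) ** mat2 t z z w + cmat (blkD E1_mat) = mat2 1 0 (- z) (- w)"
      unfolding E1_mat_def by (simp add: mat2_simps)
    show "mat2 t z 0 1 ** mat2 (- w / - w) (- 0 / - w) (- (- z) / - w) (1 / - w) = mat2 (t - z\<^sup>2 / w) (- z / w) (- z / w) (- 1 / w)"
      unfolding mat2_mult using assms by (simp add: power2_eq_square)
  qed (use assms in simp_all)
  then show ?thesis by simp
qed

text \<open>F_p inverts p times the argument; the normalising root of p enters only through its
  square \<open>R * R\<close>.\<close>

lemma slash_F:
  assumes p: "p > 0" and d: "d = t * w - z\<^sup>2" "d \<noteq> 0"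
  shows "slash 4 f (F_mat p) (mat2 t z z w) = inverse ((of_nat p * d) ^ 4)
     * f (mat2 (- w / (of_nat p * d)) (z / (of_nat p * d)) (z / (of_nat p * d)) (- t / (of_nat p * d)))"
proof -
  define r where "r = sqrt (real p)"
  have r: "r > 0" "r * r = real p" using p by (auto simp: r_def)
  have pr: "real p / r = r" "1 / r * r = 1" using r by (simp_all add: field_simps)
  define R where "R = complex_of_real r"
  have R: "R \<noteq> 0" "R * R = of_nat p" unfolding R_def using r by (simp_all flip: of_real_mult)
  have F: "F_mat p = block_mat 0 (mat2 (1 / r) 0 0 (1 / r)) (mat2 (- r) 0 0 (- r)) 0"
    unfolding F_mat_def r_def [symmetric] by (simp add: block_mat_scaleR mat_1_mat2 mat2_simps pr)
  have dd: "- R * t * (- R * w) - - R * z * (- R * z) = of_nat p * d"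
    unfolding d R(2) [symmetric] by (simp add: power2_eq_square algebra_simps)
  show ?thesis
  proof (rule slash_mat2)
    show "transpose (F_mat p) ** symp_J ** F_mat p = symp_J"
      unfolding F using r by (simp add: symp_simps)
    show "cmat (blkA (F_mat p)) ** mat2 t z z w + cmat (blkB (F_mat p)) = mat2 (1 / R) 0 0 (1 / R)"
      unfolding F R_def by (simp add: zero_mat2 mat2_simps)
    show "cmat (blkC (F_mat p)) ** mat2 t z z w + cmat (blkD (F_mat p)) = mat2 (- R * t) (- R * z) (- R * z) (- R * w)"
      unfolding F R_def by (simp add: zero_mat2 mat2_simps)
    show "- R * t * (- R * w) - - R * z * (- R * z) = of_nat p * d" by (rule dd)
    show "of_nat p * d \<noteq> 0" using p d by simp
    show "mat2 (1 / R) 0 0 (1 / R) ** mat2 (- R * w / (of_nat p * d)) (- (- R * z) / (of_nat p * d)) (- (- R * z) / (of_nat p * d))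
         (- R * t / (of_nat p * d))
       = mat2 (- w / (of_nat p * d)) (z / (of_nat p * d)) (z / (of_nat p * d)) (- t / (of_nat p * d))"
      unfolding mat2_mult using R(1) by simp
  qed
qed

lemma slash_mu_tilde:
  assumes p: "p > 0"
  shows "slash 4 f (mu_tilde_mat p) (mat2 t z z w)
    = of_nat p ^ 4 * f (mat2 w (- of_nat p * z) (- of_nat p * z) (of_nat p ^ 2 * t))"
proof -
  have "slash 4 f (mu_tilde_mat p) (mat2 t z z w)
    = inverse ((1 / of_nat p) ^ 4) * f (mat2 w (- of_nat p * z) (- of_nat p * z) (of_nat p ^ 2 * t))"
  proof (rule slash_mat2)
    show "transpose (mu_tilde_mat p) ** symp_J ** mu_tilde_mat p = symp_J"
      unfolding mu_tilde_mat_def using p by (simp add: symp_simps)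
    show "cmat (blkA (mu_tilde_mat p)) ** mat2 t z z w + cmat (blkB (mu_tilde_mat p)) = mat2 z w (- of_nat p * t) (- of_nat p * z)"
      unfolding mu_tilde_mat_def by (simp add: zero_mat2 mat2_simps)
    show "cmat (blkC (mu_tilde_mat p)) ** mat2 t z z w + cmat (blkD (mu_tilde_mat p)) = mat2 0 1 (- (1 / of_nat p)) 0"
      unfolding mu_tilde_mat_def by (simp add: zero_mat2 mat2_simps)
    show "mat2 z w (- of_nat p * t) (- of_nat p * z) ** mat2 (0 / (1 / of_nat p)) (- 1 / (1 / of_nat p)) (- (- (1 / of_nat p)) / (1 / of_nat p)) (0 / (1 / of_nat p))
       = mat2 w (- of_nat p * z) (- of_nat p * z) (of_nat p ^ 2 * t)"
      unfolding mat2_mult using p by (simp add: power2_eq_square mult_ac)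
  qed (use p in simp_all)
  then show ?thesis by (simp add: power_one_over)
qed

lemma slash_mu_transl:
  assumes p: "p > 0"
  shows "slash 4 f (mu_mat p ** transl (mat2 0 0 0 a)) (mat2 t z z w)
    = f (mat2 ((w + of_real a) / of_nat p) (- z) (- z) (of_nat p * t))"
proof -
  define r where "r = sqrt (real p)"
  have r: "r > 0" "r * r = real p" using p by (auto simp: r_def)
  have pr: "real p / r = r" using r by (simp add: field_simps)
  define R where "R = complex_of_real r"
  have R: "R \<noteq> 0" "R * R = of_nat p" unfolding R_def using r by (simp_all flip: of_real_mult)
  have mu: "mu_mat p ** transl (mat2 0 0 0 a) = block_mat (mat2 0 (1 / r) (- r) 0) (mat2 0 (a / r) 0 0) 0 (mat2 0 r (- 1 / r) 0)"
    unfolding mu_mat_def r_def [symmetric] transl_def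
    by (simp add: block_mat_scaleR block_mat_mult mat_1_mat2 zero_mat2 mat2_simps pr)
  have "slash 4 f (mu_mat p ** transl (mat2 0 0 0 a)) (mat2 t z z w)
    = inverse (1 ^ 4) * f (mat2 ((w + of_real a) / of_nat p) (- z) (- z) (of_nat p * t))"
  proof (rule slash_mat2)
    show "transpose (mu_mat p ** transl (mat2 0 0 0 a)) ** symp_J ** (mu_mat p ** transl (mat2 0 0 0 a)) = symp_J"
      unfolding mu using r by (simp add: symp_simps)
    show "cmat (blkA (mu_mat p ** transl (mat2 0 0 0 a))) ** mat2 t z z w + cmat (blkB (mu_mat p ** transl (mat2 0 0 0 a)))
       = mat2 (z / R) ((w + of_real a) / R) (- R * t) (- R * z)"
      unfolding mu R_def by (simp add: mat2_simps add_divide_distrib)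
    show "cmat (blkC (mu_mat p ** transl (mat2 0 0 0 a))) ** mat2 t z z w + cmat (blkD (mu_mat p ** transl (mat2 0 0 0 a)))
       = mat2 0 R (- 1 / R) 0"
      unfolding mu R_def by (simp add: zero_mat2 mat2_simps)
    show "0 * 0 - R * (- 1 / R) = 1" using R by simp
    show "mat2 (z / R) ((w + of_real a) / R) (- R * t) (- R * z) ** mat2 (0 / 1) (- R / 1) (- (- 1 / R) / 1) (0 / 1)
       = mat2 ((w + of_real a) / of_nat p) (- z) (- z) (of_nat p * t)"
      unfolding mat2_mult R(2) [symmetric] using R(1) by (simp add: mult_ac)
  qed simp
  then show ?thesis by simp
qed

section \<open>The trace of the theta series\<close>

lemma summable_on_mult_Times_complex:
  fixes f :: "'a \<Rightarrow> complex" and g :: "'b \<Rightarrow> complex"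
  assumes "(\<lambda>x. norm (f x)) summable_on X" "(\<lambda>y. norm (g y)) summable_on Y"
  shows "(\<lambda>v. norm (case v of (x, y) \<Rightarrow> f x * g y)) summable_on X \<times> Y"
  using summable_on_mult_Times[OF assms] by (simp add: norm_mult case_prod_unfold)

lemma infsum_mult_Times:
  fixes f :: "'a \<Rightarrow> complex" and g :: "'b \<Rightarrow> complex"
  assumes "(\<lambda>x. norm (f x)) summable_on X" "(\<lambda>y. norm (g y)) summable_on Y"
  shows "(\<Sum>\<^sub>\<infinity>(x, y)\<in>X \<times> Y. f x * g y) = infsum f X * infsum g Y"
proof -
  have "(\<lambda>(x, y). f x * g y) summable_on X \<times> Y"
    by (rule abs_summable_summable[OF summable_on_mult_Times_complex[OF assms]])
  from infsum_Sigma_banach[OF this] show ?thesis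
    by (simp add: infsum_cmult_right' infsum_cmult_left')
qed

text \<open>Splits the two columns of an integer matrix along the rows of the two summands, so that
  each summand receives its own pair of vectors.\<close>

definition pair_columns ::
  "(('m \<Rightarrow> int) \<times> ('m \<Rightarrow> int)) \<times> (('n \<Rightarrow> int) \<times> ('n \<Rightarrow> int)) \<Rightarrow> int^2^('m::finite + 'n::finite)" where
  "pair_columns = (\<lambda>((x1, y1), (x2, y2)). (\<chi> r c. case r of
      Inl i \<Rightarrow> (if c = 1 then x1 i else y1 i) | Inr i \<Rightarrow> (if c = 1 then x2 i else y2 i)))"

lemma bij_pair_columns: "bij pair_columns"
proof (rule bij_betwI[where g = "\<lambda>N. ((\<lambda>i. N $ Inl i $ 1, \<lambda>i. N $ Inl i $ 2), (\<lambda>i. N $ Inr i $ 1, \<lambda>i. N $ Inr i $ 2))"])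
  show "pair_columns ((\<lambda>i. N $ Inl i $ 1, \<lambda>i. N $ Inl i $ 2), (\<lambda>i. N $ Inr i $ 1, \<lambda>i. N $ Inr i $ 2)) = N"
    for N :: "int^2^('m::finite + 'n::finite)"
    unfolding pair_columns_def vec_eq_iff by (auto simp: forall_2 split: sum.split)
qed (auto simp: pair_columns_def)

locale level_pairs = A: level_pair p A A' + B: level_pair p B B' for p A A' B B'
begin

definition quad_term :: "complex \<Rightarrow> complex \<Rightarrow> complex \<Rightarrow>
    ((4 \<Rightarrow> int) \<times> (4 \<Rightarrow> int)) \<times> ((4 \<Rightarrow> int) \<times> (4 \<Rightarrow> int)) \<Rightarrow> complex" where
  "quad_term t z w = (\<lambda>(u, v). A.pair_term t z w u * B.pair_term t z w v)"

definition quad_theta where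
  "quad_theta S t z w = (\<Sum>\<^sub>\<infinity>v\<in>S. quad_term t z w v)"

lemma quad_term_summable:
  assumes "siegel3 t z w"
  shows "(\<lambda>v. norm (quad_term t z w v)) summable_on X"
proof -
  have "(\<lambda>v. norm (quad_term t z w v)) summable_on UNIV \<times> UNIV"
    unfolding quad_term_def
    by (rule summable_on_mult_Times_complex[OF A.pair_term_summable[OF assms] B.pair_term_summable[OF assms]])
  then show ?thesis by (rule summable_on_subset_banach) simp
qed

lemma quad_theta_Times:
  assumes "siegel3 t z w"
  shows "quad_theta (X \<times> Y) t z w = A.pair_theta X t z w * B.pair_theta Y t z w"
  unfolding quad_theta_def quad_term_def A.pair_theta_def B.pair_theta_def
  by (rule infsum_mult_Times[OF A.pair_term_summable[OF assms] B.pair_term_summable[OF assms]])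

lemma quadratic_column_form:
  fixes M :: "real^4^4" and x y :: "4 \<Rightarrow> int"
  assumes "even_mat M"
  shows "(\<Sum>i\<in>UNIV. (\<Sum>j\<in>UNIV. of_int (x j) * complex_of_real (M $ j $ i)) * of_int (y i)) = of_int (dot x (int_act M y))"
proof -
  have "(\<Sum>i\<in>UNIV. (\<Sum>j\<in>UNIV. of_int (x j) * complex_of_real (M $ j $ i)) * of_int (y i))
     = (\<Sum>j\<in>UNIV. of_int (x j) * mvec M (\<lambda>i. complex_of_int (y i)) j)"
    unfolding mvec_def sum_distrib_left sum_distrib_right by (subst sum.swap) (simp add: mult_ac)
  then show ?thesis unfolding dot_def by (simp add: of_int_int_act[OF assms])
qed

text \<open>The trace decomposes along the two summands. The second columns pass through
  \<open>int_act\<close>, since second vectors are always recorded in dual coordinates.\<close>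

lemma theta_series_summand:
  fixes x1 y1 x2 y2 :: "4 \<Rightarrow> int"
  defines "N \<equiv> map_matrix complex_of_int (pair_columns ((x1, y1), (x2, y2)))"
  shows "e2pi (1/2 * trace (transpose N ** cmat (direct_sum_mat A B) ** N ** mat2 t z z w))
    = A.pair_term t z w (x1, int_act A y1) * B.pair_term t z w (x2, int_act B y2)"
proof -
  define K where "K = transpose N ** cmat (direct_sum_mat A B) ** N"
  have K: "K $ a $ b = of_int (dot (if a = 1 then x1 else y1) (int_act A (if b = 1 then x1 else y1))
      + dot (if a = 1 then x2 else y2) (int_act B (if b = 1 then x2 else y2)))" for a b
    unfolding K_def matrix_matrix_mult_def N_def transpose_def map_matrix_def pair_columns_def direct_sum_mat_def
      block_mat_def sum_UNIV_Plus of_int_add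
      quadratic_column_form[OF A.even_A, symmetric] quadratic_column_form[OF B.even_A, symmetric]
    by (simp add: if_distribR)
  have "trace (K ** mat2 t z z w) = K $ 1 $ 1 * t + (K $ 1 $ 2 + K $ 2 $ 1) * z + K $ 2 $ 2 * w"
    by (simp add: trace_def matrix_matrix_mult_def sum_2 algebra_simps)
  also have "\<dots> = 2 * ((of_int (half_form A x1) * t + of_int (dot x1 (int_act A y1)) * z + of_int (half_form A y1) * w)
     + (of_int (half_form B x2) * t + of_int (dot x2 (int_act B y2)) * z + of_int (half_form B y2) * w))"
    using dot_int_act_commute[OF A.even_A, of y1 x1] dot_int_act_commute[OF B.even_A, of y2 x2]
      half_form_double[OF A.even_A, of x1, symmetric] half_form_double[OF A.even_A, of y1, symmetric]
      half_form_double[OF B.even_A, of x2, symmetric] half_form_double[OF B.even_A, of y2, symmetric]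
      dot_commute[of "int_act A y1" x1] dot_commute[of "int_act B y2" x2]
    unfolding K by (simp add: algebra_simps)
  finally have tr: "trace (K ** mat2 t z z w)
    = 2 * ((of_int (half_form A x1) * t + of_int (dot x1 (int_act A y1)) * z + of_int (half_form A y1) * w)
     + (of_int (half_form B x2) * t + of_int (dot x2 (int_act B y2)) * z + of_int (half_form B y2) * w))" .
  have half: "1 / 2 * (2 * c) = c" for c :: complex by simp
  show ?thesis
    unfolding K_def [symmetric] A.pair_term_int_act B.pair_term_int_act e2pi_add [symmetric] tr half ..
qed

lemma theta_series_eq:
  assumes s: "siegel3 t z w"
  shows "theta_series (direct_sum_mat A B) (mat2 t z z w)
    = quad_theta ((UNIV \<times> range (int_act A)) \<times> (UNIV \<times> range (int_act B))) t z w"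
proof -
  define g :: "((4 \<Rightarrow> int) \<times> (4 \<Rightarrow> int)) \<times> ((4 \<Rightarrow> int) \<times> (4 \<Rightarrow> int)) \<Rightarrow> _"
    where "g = map_prod (\<lambda>(x, y). (x, int_act A y)) (\<lambda>(x, y). (x, int_act B y))"
  have inj: "inj g" unfolding g_def using A.inj_map_int_act B.inj_map_int_act by (rule prod.inj_map)
  have rng: "(UNIV \<times> range (int_act A)) \<times> (UNIV \<times> range (int_act B)) = range g"
    unfolding g_def by (auto simp: image_iff)
  have "theta_series (direct_sum_mat A B) (mat2 t z z w) = (\<Sum>\<^sub>\<infinity>v. quad_term t z w (g v))"
    unfolding theta_series_def infsum_reindex_bij_betw[OF bij_pair_columns, symmetric]
  proof (rule infsum_cong)
    fix v :: "((4 \<Rightarrow> int) \<times> (4 \<Rightarrow> int)) \<times> ((4 \<Rightarrow> int) \<times> (4 \<Rightarrow> int))"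
    obtain x1 y1 x2 y2 where v: "v = ((x1, y1), (x2, y2))" by (cases v) auto
    show "(let N' = map_matrix complex_of_int (pair_columns v)
       in e2pi (1 / 2 * trace (transpose N' ** cmat (direct_sum_mat A B) ** N' ** mat2 t z z w))) = quad_term t z w (g v)"
      unfolding v Let_def theta_series_summand by (simp add: g_def quad_term_def)
  qed
  then show ?thesis unfolding quad_theta_def rng infsum_reindex[OF inj] o_def .
qed

definition sum_form where
  "sum_form = (\<lambda>((x1, m1 :: 4 \<Rightarrow> int), (x2, m2 :: 4 \<Rightarrow> int)). half_form A x1 + half_form B x2)"

definition sum_dual_form where
  "sum_dual_form = (\<lambda>((x1 :: 4 \<Rightarrow> int, m1), (x2 :: 4 \<Rightarrow> int, m2)). half_form A' m1 + half_form B' m2)"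

definition sum_dot where
  "sum_dot = (\<lambda>((x1, m1), (x2, m2)). dot x1 m1 + dot x2 (m2 :: 4 \<Rightarrow> int))"

lemma quad_term_eq:
  fixes v :: "((4 \<Rightarrow> int) \<times> (4 \<Rightarrow> int)) \<times> ((4 \<Rightarrow> int) \<times> (4 \<Rightarrow> int))"
  shows "quad_term t z w v = e2pi (of_int (sum_form v) * t + of_int (sum_dot v) * z + of_int (sum_dual_form v) * w / of_nat p)"
  unfolding quad_term_def A.pair_term_def B.pair_term_def sum_form_def sum_dot_def sum_dual_form_def
  by (auto simp: e2pi_add [symmetric] algebra_simps add_divide_distrib intro!: arg_cong[of _ _ e2pi] split: prod.split)

text \<open>A finite sum of phases filters the index set by a congruence; both kinds of translation
  sums in the trace reduce to this.\<close>

lemma sum_phases: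
  assumes s: "siegel3 t z w"
  shows "(\<Sum>j<p. \<Sum>\<^sub>\<infinity>v\<in>S. quad_term t z w v * e2pi (of_int (int j * h v) / of_nat p))
    = of_nat p * quad_theta {v \<in> S. int p dvd h v} t z w"
proof -
  have "(\<lambda>v. quad_term t z w v * e2pi (of_int (int j * h v) / of_nat p)) summable_on S" for j
  proof (rule abs_summable_summable)
    have "norm (e2pi (of_int (int j * h v) / of_nat p)) = 1" for v
      unfolding norm_e2pi by (simp add: Im_divide_of_nat)
    then show "(\<lambda>v. quad_term t z w v * e2pi (of_int (int j * h v) / of_nat p)) abs_summable_on S"
      using quad_term_summable[OF s, of S] by (simp only: norm_mult mult_1_right)
  qed
  then have "(\<Sum>j<p. \<Sum>\<^sub>\<infinity>v\<in>S. quad_term t z w v * e2pi (of_int (int j * h v) / of_nat p))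
     = (\<Sum>\<^sub>\<infinity>v\<in>S. \<Sum>j<p. quad_term t z w v * e2pi (of_int (int j * h v) / of_nat p))"
    by (subst infsum_finite_sum) auto
  also have "\<dots> = (\<Sum>\<^sub>\<infinity>v\<in>{v \<in> S. int p dvd h v}. of_nat p * quad_term t z w v)"
    unfolding sum_distrib_left [symmetric] sum_e2pi_residues[OF A.p_pos(1)] by (rule infsum_cong_neutral) auto
  finally show ?thesis unfolding infsum_cmult_right' quad_theta_def .
qed

lemma sum_translates_first:
  assumes s: "siegel3 t z w"
  shows "(\<Sum>\<beta><p. quad_theta S (t + of_nat \<beta> / of_nat p) z w) = of_nat p * quad_theta {v \<in> S. int p dvd sum_form v} t z w"
proof -
  have "quad_term (t + of_nat \<beta> / of_nat p) z w v = quad_term t z w v * e2pi (of_int (int \<beta> * sum_form v) / of_nat p)" for \<beta> v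
    unfolding quad_term_eq e2pi_add [symmetric] using A.p_pos
    by (intro arg_cong[of _ _ e2pi]) (simp add: field_simps)
  then show ?thesis unfolding sum_phases[OF s, symmetric] by (simp only: quad_theta_def)
qed

lemma sum_translates_last:
  assumes s: "siegel3 t z w"
  shows "(\<Sum>\<alpha><p. quad_theta S t z (w + of_nat \<alpha>)) = of_nat p * quad_theta {v \<in> S. int p dvd sum_dual_form v} t z w"
proof -
  have "quad_term t z (w + of_nat \<alpha>) v = quad_term t z w v * e2pi (of_int (int \<alpha> * sum_dual_form v) / of_nat p)" for \<alpha> v
    unfolding quad_term_eq e2pi_add [symmetric] using A.p_pos
    by (intro arg_cong[of _ _ e2pi]) (simp add: field_simps)
  then show ?thesis unfolding sum_phases[OF s, symmetric] by (simp only: quad_theta_def)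
qed

text \<open>Each summand contributes -w^2 / p; the product cancels the automorphy factor w^4 and
  leaves 1 / p^2.\<close>

lemma slash_E1_theta:
  assumes s: "siegel3 t z w"
  shows "slash 4 (theta_series (direct_sum_mat A B)) E1_mat (mat2 t z z w) = quad_theta UNIV t z w / of_nat p ^ 2"
proof -
  have w0: "w \<noteq> 0" using s by (auto simp: siegel3_def)
  have U: "quad_theta UNIV t z w = A.pair_theta UNIV t z w * B.pair_theta UNIV t z w"
    using quad_theta_Times[OF s, of UNIV UNIV] by simp
  have e: "inverse (w ^ 4) * ((- (w\<^sup>2 / of_nat p) * a) * (- (w\<^sup>2 / of_nat p) * b)) = a * b / of_nat p ^ 2" for a b
    using w0 by (simp add: field_simps power2_eq_square power4_eq_xxxx)
  show ?thesis
    unfolding slash_E1[OF w0] theta_series_eq[OF siegel3_partial_inversion[OF s]]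
      quad_theta_Times[OF siegel3_partial_inversion[OF s]] A.pair_theta_partial_inversion[OF s]
      B.pair_theta_partial_inversion[OF s] e U ..
qed

lemma slash_F_theta:
  assumes s: "siegel3 t z w"
  shows "slash 4 (theta_series (direct_sum_mat A B)) (F_mat p) (mat2 (w / of_nat p) (- z) (- z) (of_nat p * t))
    = quad_theta ((range (int_act A') \<times> UNIV) \<times> (range (int_act B') \<times> UNIV)) t z w"
proof -
  let ?P = "of_nat p :: complex"
  have P0: "?P \<noteq> 0" using A.p_pos by simp
  \<comment> \<open>These are the entries of p times the argument, the matrix that F_p actually
    inverts.\<close>
  define T Z W where "T = w" "Z = - ?P * z" "W = ?P\<^sup>2 * t"
  have s': "siegel3 T Z W"
  proof -
    have "Im Z = - real p * Im z" "Im W = real p ^ 2 * Im t"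
      unfolding T_Z_W_def by (simp_all add: power2_eq_square)
    then show ?thesis using s A.p_pos unfolding siegel3_def T_Z_W_def(1)
      by (simp add: power_mult_distrib mult_ac)
  qed
  define D where "D = T * W - Z\<^sup>2"
  define d where "d = w / ?P * (?P * t) - (- z)\<^sup>2"
  have Dd: "D = ?P\<^sup>2 * d" unfolding D_def d_def T_Z_W_def using P0 by (simp add: power2_eq_square algebra_simps)
  have D0: "D \<noteq> 0"
  proof -
    have "siegel3 (- 1 / T) (- Z / T) (W - Z\<^sup>2 / T)"
      using siegel3_partial_inversion[of W Z T] s' by (simp add: siegel3_swap)
    then have "W - Z\<^sup>2 / T \<noteq> 0" by (auto simp: siegel3_def)
    moreover have "T \<noteq> 0" using s' by (auto simp: siegel3_def)
    ultimately show ?thesis unfolding D_def by (simp add: field_simps)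
  qed
  have d0: "d \<noteq> 0" using D0 Dd by auto
  have a1: "- (?P * t) / (?P * d) = - W / D" unfolding Dd T_Z_W_def using P0 by simp
  have a2: "- z / (?P * d) = Z / D" unfolding Dd T_Z_W_def using P0 by (simp add: power2_eq_square)
  have a3: "- (w / ?P) / (?P * d) = - T / D" unfolding Dd T_Z_W_def by (simp add: power2_eq_square mult_ac)
  have sD: "siegel3 (- W / D) (Z / D) (- T / D)"
  proof -
    have T0: "T \<noteq> 0" using s' by (auto simp: siegel3_def)
    have s1: "siegel3 (- 1 / T) (- Z / T) (W - Z\<^sup>2 / T)"
      using siegel3_partial_inversion[of W Z T] s' by (simp add: siegel3_swap)
    have V: "W - Z\<^sup>2 / T = D / T" unfolding D_def using T0 by (simp add: field_simps)
    have v1: "- W / D = - 1 / T - (- Z / T)\<^sup>2 / (D / T)"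
    proof -
      have "- 1 / T - (- Z / T)\<^sup>2 / (D / T) = - (D + Z\<^sup>2) / (T * D)"
        using T0 D0 by (simp add: field_simps power2_eq_square)
      also have "D + Z\<^sup>2 = T * W" by (simp add: D_def)
      also have "- (T * W) / (T * D) = - W / D" using T0 by simp
      finally show ?thesis by (rule sym)
    qed
    have v2: "Z / D = - (- Z / T) / (D / T)" and v3: "- T / D = - 1 / (D / T)" using T0 D0 by simp_all
    show ?thesis
      using siegel3_partial_inversion[OF s1] unfolding V v1 [symmetric] v2 [symmetric] v3 [symmetric] .
  qed
  have e: "inverse ((?P * d) ^ 4) * ((D\<^sup>2 / ?P\<^sup>2 * a) * (D\<^sup>2 / ?P\<^sup>2 * b)) = a * b" for a b
    unfolding Dd using P0 d0 by (simp add: field_simps power2_eq_square power4_eq_xxxx)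
  show ?thesis
    unfolding slash_F[OF A.p_pos(1) d_def d0] a1 a2 a3 theta_series_eq[OF sD] quad_theta_Times[OF sD]
      A.pair_theta_full_inversion[OF s', folded D_def] B.pair_theta_full_inversion[OF s', folded D_def] e
    unfolding T_Z_W_def A.pair_theta_dual_scaled[OF s] B.pair_theta_dual_scaled[OF s] quad_theta_Times[OF s] ..
qed

text \<open>The range of \<open>int_act A\<close> is the lattice seen in dual coordinates, and the
  range of \<open>int_act A'\<close> is p times the dual lattice seen in lattice coordinates. Each
  set indexes one of the four terms after its translations have been summed.\<close>

definition "S1 = {v \<in> (UNIV \<times> range (int_act A)) \<times> (UNIV \<times> range (int_act B)). int p dvd sum_form v}"
definition "S2 = (range (int_act A') \<times> range (int_act A)) \<times> (range (int_act B') \<times> range (int_act B))"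
definition "S3 = {v. int p dvd sum_form v \<and> int p dvd sum_dual_form v}"
definition "S4 = {v \<in> (range (int_act A') \<times> UNIV) \<times> (range (int_act B') \<times> UNIV). int p dvd sum_dual_form v}"

text \<open>Origin of the weights: p from the sum over \<beta>; p^4 / p^2 for mu tilde, with p^4 its
  automorphy factor; p * p / p^2 for the double sum; p from the sum over \<alpha>.\<close>

theorem trace_op_theta:
  assumes s: "siegel3 t z w"
  shows "trace_op 4 p (theta_series (direct_sum_mat A B)) (mat2 t z z w)
    = of_nat p * quad_theta S1 t z w + of_nat p ^ 2 * quad_theta S2 t z w + quad_theta S3 t z w + of_nat p * quad_theta S4 t z w"
proof -
  let ?f = "theta_series (direct_sum_mat A B)" and ?P = "of_nat p :: complex"
  have P0: "?P \<noteq> 0" using A.p_pos by simp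
  have sh: "siegel3 (t + of_nat \<beta> / ?P) z (w + of_nat \<alpha>)" for \<alpha> \<beta>
    using s unfolding siegel3_def by (simp add: Im_divide_of_nat)
  have r: "complex_of_real (real \<beta> / real p) = of_nat \<beta> / ?P" for \<beta> by simp
  have t1: "(\<Sum>\<beta><p. slash 4 ?f (transl (mat2 (real \<beta> / real p) 0 0 0)) (mat2 t z z w)) = ?P * quad_theta S1 t z w"
    unfolding slash_transl r S1_def sum_translates_first[OF s, symmetric]
    using theta_series_eq[OF sh[of _ 0]] by simp
  have t2: "slash 4 (slash 4 ?f E1_mat) (mu_tilde_mat p) (mat2 t z z w) = ?P ^ 2 * quad_theta S2 t z w"
  proof -
    have s': "siegel3 w (- ?P * z) (?P\<^sup>2 * t)"
    proof -
      have "Im (- ?P * z) = - real p * Im z" "Im (?P\<^sup>2 * t) = real p ^ 2 * Im t"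
        by (simp_all add: power2_eq_square)
      then show ?thesis using s A.p_pos unfolding siegel3_def by (simp add: power_mult_distrib mult_ac)
    qed
    have "quad_theta UNIV w (- ?P * z) (?P\<^sup>2 * t) = quad_theta S2 t z w"
      unfolding S2_def quad_theta_Times[OF s] A.pair_theta_swap_scaled [symmetric] B.pair_theta_swap_scaled [symmetric]
      using quad_theta_Times[OF s', of UNIV UNIV] by simp
    then show ?thesis
      unfolding slash_mu_tilde[OF A.p_pos(1)] slash_E1_theta[OF s'] using P0
      by (simp add: power2_eq_square power4_eq_xxxx)
  qed
  have t3: "(\<Sum>\<alpha><p. \<Sum>\<beta><p. slash 4 (slash 4 ?f E1_mat) (transl (mat2 (real \<beta> / real p) 0 0 (real \<alpha>))) (mat2 t z z w))
     = quad_theta S3 t z w"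
  proof -
    have sw: "siegel3 t z (w + of_nat \<alpha>)" for \<alpha> using s unfolding siegel3_def by simp
    have "(\<Sum>\<beta><p. slash 4 (slash 4 ?f E1_mat) (transl (mat2 (real \<beta> / real p) 0 0 (real \<alpha>))) (mat2 t z z w))
        = quad_theta {v. int p dvd sum_form v} t z (w + of_nat \<alpha>) / ?P" for \<alpha>
    proof -
      have "(\<Sum>\<beta><p. slash 4 (slash 4 ?f E1_mat) (transl (mat2 (real \<beta> / real p) 0 0 (real \<alpha>))) (mat2 t z z w))
        = (\<Sum>\<beta><p. quad_theta UNIV (t + of_nat \<beta> / ?P) z (w + of_nat \<alpha>)) / ?P ^ 2"
        unfolding slash_transl r of_real_of_nat_eq slash_E1_theta[OF sh] sum_divide_distrib ..
      then show ?thesis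
        unfolding sum_translates_first[OF sw] using P0 by (simp add: power2_eq_square)
    qed
    then have "(\<Sum>\<alpha><p. \<Sum>\<beta><p. slash 4 (slash 4 ?f E1_mat) (transl (mat2 (real \<beta> / real p) 0 0 (real \<alpha>))) (mat2 t z z w))
       = (\<Sum>\<alpha><p. quad_theta {v. int p dvd sum_form v} t z (w + of_nat \<alpha>)) / ?P"
      by (simp add: sum_divide_distrib)
    then show ?thesis unfolding sum_translates_last[OF s] S3_def using P0 by simp
  qed
  have t4: "(\<Sum>\<alpha><p. slash 4 (slash 4 ?f (F_mat p)) (mu_mat p ** transl (mat2 0 0 0 (real \<alpha>))) (mat2 t z z w)) = ?P * quad_theta S4 t z w"
  proof -
    have sw: "siegel3 t z (w + of_nat \<alpha>)" for \<alpha> using s unfolding siegel3_def by simp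
    show ?thesis
      unfolding slash_mu_transl[OF A.p_pos(1)] of_real_of_nat_eq slash_F_theta[OF sw] sum_translates_last[OF s] S4_def ..
  qed
  show ?thesis unfolding trace_op_def t1 t2 t3 t4 ..
qed

end

section \<open>Fourier expansions\<close>

text \<open>Averaging against characters modulo n selects the terms with l T congruent to k modulo
  n. For large n the unwanted ones avoid any given finite set, so they form a small tail.\<close>

lemma infsum_phase_isolation:
  fixes b :: "'a \<Rightarrow> complex" and l :: "'a \<Rightarrow> int"
  assumes sm: "b summable_on I"
    and zero: "\<And>n j. n > 0 \<Longrightarrow> (\<Sum>\<^sub>\<infinity>T\<in>I. b T * e2pi (of_int (int j * l T) / of_nat n)) = 0"
  shows "(\<Sum>\<^sub>\<infinity>T\<in>{T \<in> I. l T = k}. b T) = 0"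
proof -
  have asm: "(\<lambda>T. norm (b T)) summable_on X" if "X \<subseteq> I" for X
    by (rule summable_on_iff_abs_summable_on_complex[THEN iffD1, OF summable_on_subset_banach[OF sm that]])
  have res: "(\<Sum>\<^sub>\<infinity>T\<in>{T \<in> I. int n dvd l T - k}. b T) = 0" if n: "n > 0" for n :: nat
  proof -
    have tm: "e2pi (- of_int (int j * k) / of_nat n) * (b T * e2pi (of_int (int j * l T) / of_nat n))
       = b T * e2pi (of_int (int j * (l T - k)) / of_nat n)" for j T
      unfolding mult.left_commute[of _ "b T"] e2pi_add [symmetric]
      by (intro arg_cong2[of _ _ _ _ "(*)"] refl arg_cong[of _ _ e2pi]) (simp add: algebra_simps diff_divide_distrib)
    have nrm: "norm (e2pi (of_int i / of_nat n)) = 1" for i unfolding norm_e2pi by (simp add: Im_divide_of_nat)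
    have s1: "(\<lambda>T. b T * e2pi (of_int (int j * (l T - k)) / of_nat n)) summable_on I" for j
      by (rule abs_summable_summable) (simp only: norm_mult nrm mult_1_right asm[OF subset_refl])
    have "0 = (\<Sum>j<n. \<Sum>\<^sub>\<infinity>T\<in>I. b T * e2pi (of_int (int j * (l T - k)) / of_nat n))"
      unfolding tm [symmetric] infsum_cmult_right' zero[OF n] by simp
    also have "\<dots> = (\<Sum>\<^sub>\<infinity>T\<in>I. \<Sum>j<n. b T * e2pi (of_int (int j * (l T - k)) / of_nat n))"
      by (rule infsum_finite_sum[symmetric]) (rule finite_lessThan, rule s1)
    also have "\<dots> = (\<Sum>\<^sub>\<infinity>T\<in>{T \<in> I. int n dvd l T - k}. of_nat n * b T)"
      unfolding sum_distrib_left [symmetric] sum_e2pi_residues[OF n] by (rule infsum_cong_neutral) auto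
    finally show ?thesis unfolding infsum_cmult_right' using n by simp
  qed
  define s where "s = (\<Sum>\<^sub>\<infinity>T\<in>{T \<in> I. l T = k}. b T)"
  have "norm s \<le> \<epsilon>" if \<epsilon>: "\<epsilon> > 0" for \<epsilon> :: real
  proof -
    have "((\<lambda>T. norm (b T)) has_sum infsum (\<lambda>T. norm (b T)) I) I" using asm by simp
    then have "\<forall>\<^sub>F X in finite_subsets_at_top I. dist (\<Sum>T\<in>X. norm (b T)) (infsum (\<lambda>T. norm (b T)) I) < \<epsilon>"
      unfolding has_sum_def using \<epsilon> by (rule tendstoD)
    then obtain F where F: "finite F" "F \<subseteq> I" "dist (\<Sum>T\<in>F. norm (b T)) (infsum (\<lambda>T. norm (b T)) I) < \<epsilon>"
      unfolding eventually_finite_subsets_at_top by blast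
    have tail: "infsum (\<lambda>T. norm (b T)) (I - F) < \<epsilon>"
      using F infsum_Diff[OF asm[OF subset_refl] asm[OF F(2)] F(2)] by (simp add: dist_real_def)
    \<comment> \<open>This exceeds every |l T - k| on F, so a term of F with l T congruent to k
      modulo n already has l T = k.\<close>
    define n where "n = Suc (nat (\<Sum>T\<in>F. \<bar>l T - k\<bar>))"
    have big: "\<bar>l T - k\<bar> < int n" if "T \<in> F" for T
    proof -
      have "\<bar>l T - k\<bar> \<le> (\<Sum>T\<in>F. \<bar>l T - k\<bar>)" using that F(1) by (intro member_le_sum) auto
      then show ?thesis unfolding n_def by linarith
    qed
    define X where "X = {T \<in> I. int n dvd l T - k \<and> l T \<noteq> k}"
    have XF: "X \<subseteq> I - F"
    proof
      fix T assume T: "T \<in> X"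
      then have "\<bar>int n\<bar> \<le> \<bar>l T - k\<bar>" unfolding X_def by (intro dvd_imp_le_int) auto
      then show "T \<in> I - F" using T big[of T] unfolding X_def by auto
    qed
    have un: "{T \<in> I. int n dvd l T - k} = {T \<in> I. l T = k} \<union> X" unfolding X_def by auto
    have sb: "b summable_on Y" if "Y \<subseteq> I" for Y using sm that by (rule summable_on_subset_banach)
    have "n > 0" by (simp add: n_def)
    from res[OF this] have "0 = infsum b ({T \<in> I. l T = k} \<union> X)" unfolding un by simp
    also have "\<dots> = s + infsum b X"
      unfolding s_def by (rule infsum_Un_disjoint) (auto intro!: sb simp: X_def)
    finally have "0 = s + infsum b X" .
    then have "norm s = norm (infsum b X)" by (metis add_eq_0_iff norm_minus_cancel)
    also have "\<dots> \<le> infsum (\<lambda>T. norm (b T)) X"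
      using XF by (intro norm_infsum_bound asm) auto
    also have "\<dots> \<le> infsum (\<lambda>T. norm (b T)) (I - F)"
      using XF by (intro infsum_mono2 asm) auto
    finally show ?thesis using tail by simp
  qed
  then have "norm s \<le> 0" by (rule field_le_epsilon[of _ 0, simplified])
  then show ?thesis unfolding s_def by simp
qed

lemma finite_if_summable_const:
  fixes c :: complex
  assumes "(\<lambda>v. c) summable_on X" "c \<noteq> 0"
  shows "finite X"
proof (rule ccontr)
  assume inf: "infinite X"
  have sm: "(\<lambda>v. norm c) summable_on X"
    using assms(1) by (rule summable_on_iff_abs_summable_on_complex[THEN iffD1])
  obtain N :: nat where N: "infsum (\<lambda>v. norm c) X < real N * norm c"
    using reals_Archimedean3[of "norm c" ] assms(2) by auto
  obtain F where F: "finite F" "card F = N" "F \<subseteq> X" using infinite_arbitrarily_large[OF inf] by blast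
  have "(\<Sum>v\<in>F. norm c) \<le> infsum (\<lambda>v. norm c) X"
    using F by (intro finite_sum_le_infsum sm) auto
  with N F show False by simp
qed

text \<open>Grouping by index. Summability of a nonzero constant forces the fibres to be finite; on
  an infinite fibre \<open>card\<close> would be the default 0.\<close>

lemma has_sum_fibres:
  fixes g :: "'b \<Rightarrow> complex"
  assumes sm: "(\<lambda>v. g (\<tau> v)) summable_on S" and nz: "\<And>T. g T \<noteq> 0" and im: "\<tau> ` S \<subseteq> I"
  shows "((\<lambda>T. of_nat (card {v \<in> S. \<tau> v = T}) * g T) has_sum (\<Sum>\<^sub>\<infinity>v\<in>S. g (\<tau> v))) I"
proof (rule has_sum_Sigma')
  have bij: "bij_betw (\<lambda>v. (\<tau> v, v)) S (Sigma I (\<lambda>T. {v \<in> S. \<tau> v = T}))"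
    using im by (intro bij_betwI[where g = snd]) auto
  show "((\<lambda>(T, v). g T) has_sum (\<Sum>\<^sub>\<infinity>v\<in>S. g (\<tau> v))) (Sigma I (\<lambda>T. {v \<in> S. \<tau> v = T}))"
    unfolding has_sum_reindex_bij_betw[OF bij, symmetric] using sm by simp
  fix T
  have "(\<lambda>v. g (\<tau> v)) summable_on {v \<in> S. \<tau> v = T}"
    using sm by (rule summable_on_subset_banach) auto
  then have "(\<lambda>v. g T) summable_on {v \<in> S. \<tau> v = T}"
    by (rule summable_on_cong[THEN iffD1, rotated]) auto
  then have "finite {v \<in> S. \<tau> v = T}" by (rule finite_if_summable_const[OF _ nz])
  then show "((\<lambda>v. case (T, v) of (T, v) \<Rightarrow> g T) has_sum of_nat (card {v \<in> S. \<tau> v = T}) * g T) {v \<in> S. \<tau> v = T}"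
    using has_sum_finite[of "{v \<in> S. \<tau> v = T}" "\<lambda>v. g T"] by simp
qed

section \<open>The index set of paramodular Fourier expansions\<close>

lemma transl_in_paramodular:
  assumes p: "p > 0"
  shows "transl (mat2 a b b c) \<in> paramodular p \<longleftrightarrow> real p * a \<in> \<int> \<and> b \<in> \<int> \<and> c \<in> \<int>"
proof -
  have sy: "transpose (transl (mat2 a b b c)) ** symp_J ** transl (mat2 a b b c) = symp_J"
    unfolding transl_def by (simp add: symp_simps)
  have ex1: "\<exists>m::int. x = 0 * of_int m" if "x = 0" for x :: real using that by simp
  have int1: "(\<exists>m::int. x = of_int m) \<longleftrightarrow> x \<in> \<int>" for x :: real by (auto elim: Ints_cases)
  have intp: "(\<exists>m::int. a = of_int m / real p) \<longleftrightarrow> real p * a \<in> \<int>"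
    unfolding int1 [symmetric] using p by (auto simp: field_simps)
  have z: "\<exists>m::int. m = 0" "\<exists>m::int. 1 = real_of_int m" by (auto intro: exI[of _ 1])
  have all: "(\<forall>i j. Q i j) \<longleftrightarrow> (\<forall>i j. Q (Inl i) (Inl j) \<and> Q (Inl i) (Inr j) \<and> Q (Inr i) (Inl j) \<and> Q (Inr i) (Inr j))"
    for Q :: "2 + 2 \<Rightarrow> 2 + 2 \<Rightarrow> bool" by (metis sum.exhaust)
  show ?thesis
    by (simp only: paramodular_def mem_Collect_eq sy simp_thms all forall_2)
      (use p in \<open>simp add: transl_def paramodular_shape_def block_mat_def mat_1_mat2 z int1 intp\<close>)
qed

lemma symmetric_mat2:
  fixes T :: "'a::zero^2^2"
  assumes "transpose T = T"
  shows "T = mat2 (T $ 1 $ 1) (T $ 1 $ 2) (T $ 1 $ 2) (T $ 2 $ 2)"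
  by (rule mat2_eqI) (simp_all add: arg_cong[OF assms, of "\<lambda>M. M $ 1 $ 2", symmetric] transpose_def)

lemma trace_mat2_mult: "trace (mat2 a b c d ** mat2 e f g h) = a * e + b * g + (c * f + d * (h::'a::comm_semiring_1))"
  by (simp add: trace_def mat2_mult sum_2)

text \<open>The translations form a lattice whose upper left entry lies in (1/p) Z and whose other
  entries are integral; testing against three generators yields its dual.\<close>

lemma fourier_index_paramodular:
  assumes p: "p > 0"
  shows "T \<in> fourier_index (paramodular p) \<longleftrightarrow> pos_semidef_mat T \<and> T $ 1 $ 1 / real p \<in> \<int> \<and> 2 * T $ 1 $ 2 \<in> \<int> \<and> T $ 2 $ 2 \<in> \<int>"
proof (cases "pos_semidef_mat T")
  case True
  define a b c where "a = T $ 1 $ 1" "b = T $ 1 $ 2" "c = T $ 2 $ 2"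
  have T: "T = mat2 a b b c"
    unfolding a_b_c_def using True by (intro symmetric_mat2) (simp add: pos_semidef_mat_def)
  have tr: "trace (T ** mat2 x y y z) = a * x + 2 * b * y + c * z" for x y z
    unfolding T trace_mat2_mult by simp
  have "(\<forall>S. transpose S = S \<and> transl S \<in> paramodular p \<longrightarrow> trace (T ** S) \<in> \<int>)
    \<longleftrightarrow> a / real p \<in> \<int> \<and> 2 * b \<in> \<int> \<and> c \<in> \<int>" (is "?L \<longleftrightarrow> ?R")
  proof
    assume L: ?L
    have "trace (T ** mat2 (1 / real p) 0 0 0) \<in> \<int>" "trace (T ** mat2 0 1 1 0) \<in> \<int>" "trace (T ** mat2 0 0 0 1) \<in> \<int>"
      using L p by (auto simp: mat2_transpose transl_in_paramodular)
    then show ?R unfolding tr by simp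
  next
    assume R: ?R
    show ?L
    proof (intro allI impI, elim conjE)
      fix S :: "real^2^2" assume S: "transpose S = S" "transl S \<in> paramodular p"
      define x y z where "x = S $ 1 $ 1" "y = S $ 1 $ 2" "z = S $ 2 $ 2"
      have S2: "S = mat2 x y y z" unfolding x_y_z_def by (rule symmetric_mat2[OF S(1)])
      have i: "real p * x \<in> \<int>" "y \<in> \<int>" "z \<in> \<int>"
        using S(2) unfolding S2 transl_in_paramodular[OF p] by auto
      have "trace (T ** S) = (a / real p) * (real p * x) + 2 * b * y + c * z" unfolding S2 tr using p by simp
      also have "\<dots> \<in> \<int>" using R i
        by (elim conjE) (intro Ints_add Ints_mult[of "a / real p" "real p * x"] Ints_mult[of "2 * b" y] Ints_mult[of c z])
      finally show "trace (T ** S) \<in> \<int>" .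
    qed
  qed
  then show ?thesis using True unfolding fourier_index_def a_b_c_def by simp
next
  case False
  then show ?thesis unfolding fourier_index_def by simp
qed

lemma siegel_upper_half_mat2:
  assumes "\<Omega> \<in> siegel_upper_half"
  obtains t z w where "\<Omega> = mat2 t z z w" "siegel3 t z w"
proof -
  define t z w where "t = \<Omega> $ 1 $ 1" "z = \<Omega> $ 1 $ 2" "w = \<Omega> $ 2 $ 2"
  have O: "\<Omega> = mat2 t z z w"
    unfolding t_z_w_def using assms by (intro symmetric_mat2) (simp add: siegel_upper_half_def)
  have pd: "pos_def_mat (mat2 (Im t) (Im z) (Im z) (Im w))"
  proof -
    have "map_matrix Im \<Omega> = mat2 (Im t) (Im z) (Im z) (Im w)"
      unfolding O by (rule mat2_eqI) (simp_all add: map_matrix_def)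
    then show ?thesis using assms unfolding siegel_upper_half_def by simp
  qed
  have q: "r * (r * Im t + s * Im z) + s * (r * Im z + s * Im w) > 0" if "r \<noteq> 0 \<or> s \<noteq> 0" for r s :: real
  proof -
    have "(vector [r, s] :: real^2) \<noteq> 0" using that by (auto simp: vec_eq_iff forall_2)
    then have "(vector [r, s] :: real^2) \<bullet> (mat2 (Im t) (Im z) (Im z) (Im w) *v vector [r, s]) > 0"
      using pd unfolding pos_def_mat_def by blast
    then show ?thesis by (simp add: inner_vec_def matrix_vector_mult_def sum_2 mult_ac)
  qed
  have 1: "Im t > 0" "Im w > 0" using q[of 1 0] q[of 0 1] by simp_all
  \<comment> \<open>At the vector (Im z, - Im t) the form takes the value Im t times its
    determinant.\<close>
  have "0 < Im t * (Im t * Im w - (Im z)\<^sup>2)" using q[of "Im z" "- Im t"] 1 by (simp add: power2_eq_square algebra_simps)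
  then have "(Im z)\<^sup>2 < Im t * Im w" using 1 by (simp add: zero_less_mult_iff)
  with 1 have "siegel3 t z w" unfolding siegel3_def by blast
  with O that show ?thesis by blast
qed

lemma real_translate_in_siegel:
  "mat2 (\<i> + of_real a) (of_real b) (of_real b) (\<i> + of_real c) \<in> siegel_upper_half"
proof -
  have "map_matrix Im (mat2 (\<i> + of_real a) (of_real b) (of_real b) (\<i> + of_real c)) = mat 1"
    unfolding mat_1_mat2 by (rule mat2_eqI) (simp_all add: map_matrix_def)
  then show ?thesis
    unfolding siegel_upper_half_def by (simp add: mat2_transpose pos_def_mat_def transpose_mat)
qed

text \<open>On the translates of i times the identity by real symmetric matrices, the difference of
  two expansions is a trigonometric series with sum 0. Isolating the three integer coordinates of
  the index one after another leaves a single term.\<close>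

lemma fourier_expansion_unique:
  assumes p: "p > 0"
    and ha: "has_fourier_expansion (paramodular p) F a" and hb: "has_fourier_expansion (paramodular p) F b"
    and T0: "T0 \<in> fourier_index (paramodular p)"
  shows "a T0 = b T0"
proof -
  define I where "I = fourier_index (paramodular p)"
  \<comment> \<open>On the index set these floors are exact; the off-diagonal entry is doubled
    because it may be half-integral.\<close>
  define l1 l2 l3 :: "real^2^2 \<Rightarrow> int" where "l1 T = \<lfloor>T $ 1 $ 1\<rfloor>" "l2 T = \<lfloor>2 * T $ 1 $ 2\<rfloor>" "l3 T = \<lfloor>T $ 2 $ 2\<rfloor>" for T
  have Tl: "T = mat2 (of_int (l1 T)) (of_int (l2 T) / 2) (of_int (l2 T) / 2) (of_int (l3 T))" if "T \<in> I" for T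
  proof -
    have idx: "pos_semidef_mat T" "T $ 1 $ 1 / real p \<in> \<int>" "2 * T $ 1 $ 2 \<in> \<int>" "T $ 2 $ 2 \<in> \<int>"
      using that unfolding I_def fourier_index_paramodular[OF p] by auto
    have "T $ 1 $ 1 \<in> \<int>" using Ints_mult[OF idx(2) Ints_of_nat[of p]] p by simp
    then have e: "T $ 1 $ 1 = of_int (l1 T)" "T $ 1 $ 2 = of_int (l2 T) / 2" "T $ 2 $ 2 = of_int (l3 T)"
      using idx unfolding l1_l2_l3_def by (auto simp: floor_of_int elim!: Ints_cases)
    have "T = mat2 (T $ 1 $ 1) (T $ 1 $ 2) (T $ 1 $ 2) (T $ 2 $ 2)"
      using idx(1) by (intro symmetric_mat2) (simp add: pos_semidef_mat_def)
    then show ?thesis unfolding e .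
  qed
  define E where "E t z w T = (a T - b T) * e2pi (of_int (l1 T) * t + of_int (l2 T) * z + of_int (l3 T) * w)" for t z w T
  have hs: "(E (\<i> + of_real r1) (of_real r2) (\<i> + of_real r3) has_sum 0) I" for r1 r2 r3 :: real
  proof -
    let ?O = "mat2 (\<i> + of_real r1) (of_real r2) (of_real r2) (\<i> + of_real r3)"
    have fa: "((\<lambda>T. a T * e2pi (trace (cmat T ** ?O))) has_sum F ?O) I"
      and fb: "((\<lambda>T. b T * e2pi (trace (cmat T ** ?O))) has_sum F ?O) I"
      using ha hb real_translate_in_siegel unfolding has_fourier_expansion_def I_def by auto
    from has_sum_add[OF fa has_sum_cmult_right[OF fb, of "-1"]] have "((\<lambda>T. (a T - b T) * e2pi (trace (cmat T ** ?O))) has_sum 0) I" by (simp add: left_diff_distrib)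
    moreover have "trace (cmat T ** ?O) = of_int (l1 T) * (\<i> + of_real r1) + of_int (l2 T) * of_real r2 + of_int (l3 T) * (\<i> + of_real r3)"
      if "T \<in> I" for T
      by (subst Tl[OF that]) (simp add: cmat_mat2 trace_mat2_mult)
    ultimately show ?thesis unfolding E_def by (subst has_sum_cong) auto
  qed
  have shift: "E t z w T * e2pi (of_int (int j * l1 T) / of_nat n) = E (t + of_real (real j / real n)) z w T"
    "E t z w T * e2pi (of_int (int j * l2 T) / of_nat n) = E t (z + of_real (real j / real n)) w T"
    "E t z w T * e2pi (of_int (int j * l3 T) / of_nat n) = E t z (w + of_real (real j / real n)) T" for t z w T j n
    unfolding E_def mult.assoc e2pi_add [symmetric]
    by (intro arg_cong2[of _ _ _ _ "(*)"] refl arg_cong[of _ _ e2pi], simp add: algebra_simps)+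
  have sm: "E (\<i> + of_real r1) (of_real r2) (\<i> + of_real r3) summable_on X" if "X \<subseteq> I" for r1 r2 r3 X
    using hs[of r1 r2 r3] that by (meson has_sum_imp_summable summable_on_subset_banach)
  define I1 where "I1 = {T \<in> I. l1 T = l1 T0}"
  define I2 where "I2 = {T \<in> I1. l2 T = l2 T0}"
  define I3 where "I3 = {T \<in> I2. l3 T = l3 T0}"
  have 1: "(\<Sum>\<^sub>\<infinity>T\<in>I1. E \<i> (of_real r2) (\<i> + of_real r3) T) = 0" for r2 r3
    unfolding I1_def
  proof (rule infsum_phase_isolation)
    show "E \<i> (of_real r2) (\<i> + of_real r3) summable_on I" using sm[of I 0 r2 r3] by simp
    show "(\<Sum>\<^sub>\<infinity>T\<in>I. E \<i> (of_real r2) (\<i> + of_real r3) T * e2pi (of_int (int j * l1 T) / of_nat n)) = 0" for n j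
      unfolding shift by (rule infsumI[OF hs])
  qed
  have 2: "(\<Sum>\<^sub>\<infinity>T\<in>I2. E \<i> (of_real 0) (\<i> + of_real r3) T) = 0" for r3
    unfolding I2_def
  proof (rule infsum_phase_isolation)
    show "E \<i> (of_real 0) (\<i> + of_real r3) summable_on I1" using sm[of I1 0 0 r3] by (simp add: I1_def)
    show "(\<Sum>\<^sub>\<infinity>T\<in>I1. E \<i> (of_real 0) (\<i> + of_real r3) T * e2pi (of_int (int j * l2 T) / of_nat n)) = 0" for n j
      unfolding shift of_real_add [symmetric] by (rule 1)
  qed
  have 3: "(\<Sum>\<^sub>\<infinity>T\<in>I3. E \<i> (of_real 0) \<i> T) = 0"
    unfolding I3_def
  proof (rule infsum_phase_isolation)
    show "E \<i> (of_real 0) \<i> summable_on I2" using sm[of I2 0 0 0] by (simp add: I1_def I2_def)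
    show "(\<Sum>\<^sub>\<infinity>T\<in>I2. E \<i> (of_real 0) \<i> T * e2pi (of_int (int j * l3 T) / of_nat n)) = 0" for n j
      unfolding shift by (rule 2)
  qed
  have "I3 = {T0}"
  proof
    show "{T0} \<subseteq> I3" using T0 unfolding I3_def I2_def I1_def I_def by simp
    show "I3 \<subseteq> {T0}"
    proof
      fix T assume T: "T \<in> I3"
      then have "T \<in> I" "l1 T = l1 T0" "l2 T = l2 T0" "l3 T = l3 T0" unfolding I3_def I2_def I1_def by auto
      then show "T \<in> {T0}" using Tl[of T] Tl[of T0] T0 unfolding I_def by simp
    qed
  qed
  with 3 have "E \<i> (of_real 0) \<i> T0 = 0" by simp
  then show ?thesis unfolding E_def by (simp add: e2pi_def)
qed

section \<open>Counting modulo four\<close>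

definition neg_pair :: "('n \<Rightarrow> int) \<times> ('n \<Rightarrow> int) \<Rightarrow> ('n \<Rightarrow> int) \<times> ('n \<Rightarrow> int)" where
  "neg_pair = (\<lambda>(x, m). (\<lambda>i. - x i, \<lambda>i. - m i))"

definition zero_pair :: "('n \<Rightarrow> int) \<times> ('n \<Rightarrow> int)" where
  "zero_pair = (\<lambda>i. 0, \<lambda>i. 0)"

lemma neg_pair_neg_pair [simp]: "neg_pair (neg_pair u) = u"
  by (simp add: neg_pair_def case_prod_unfold)

lemma neg_pair_eq_self: "neg_pair u = u \<longleftrightarrow> u = zero_pair"
proof -
  have "- k = k \<longleftrightarrow> k = (0::int)" for k by auto
  then show ?thesis by (cases u) (simp add: neg_pair_def zero_pair_def fun_eq_iff)
qed

lemma neg_pair_class: "x \<in> {u, neg_pair u} \<Longrightarrow> {u, neg_pair u} = {x, neg_pair x}"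
  by (elim insertE) (simp_all add: insert_commute)

text \<open>The two sign changes commute, and their orbits have exactly four elements when both
  components are nonzero.\<close>

lemma four_dvd_card_sign_changes:
  fixes X :: "((('m \<Rightarrow> int) \<times> ('m \<Rightarrow> int)) \<times> (('n \<Rightarrow> int) \<times> ('n \<Rightarrow> int))) set"
  assumes fin: "finite X"
    and c1: "\<And>u v. (u, v) \<in> X \<Longrightarrow> (neg_pair u, v) \<in> X" and c2: "\<And>u v. (u, v) \<in> X \<Longrightarrow> (u, neg_pair v) \<in> X"
    and nz: "\<And>u v. (u, v) \<in> X \<Longrightarrow> u \<noteq> zero_pair \<and> v \<noteq> zero_pair"
  shows "4 dvd card X"
proof -
  define orb where "orb = (\<lambda>(u :: ('m \<Rightarrow> int) \<times> ('m \<Rightarrow> int), v :: ('n \<Rightarrow> int) \<times> ('n \<Rightarrow> int)). {u, neg_pair u} \<times> {v, neg_pair v})"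
  have c12: "(neg_pair u, neg_pair v) \<in> X" if "(u, v) \<in> X" for u v using c1 c2 that by blast
  have U: "\<Union> (orb ` X) = X"
  proof
    show "\<Union> (orb ` X) \<subseteq> X"
    proof clarify
      fix x y u v assume uv: "(u, v) \<in> X" "(x, y) \<in> orb (u, v)"
      then have "(x = u \<or> x = neg_pair u) \<and> (y = v \<or> y = neg_pair v)" by (simp add: orb_def) blast
      then show "(x, y) \<in> X" using uv(1) c1[OF uv(1)] c2[OF uv(1)] c12[OF uv(1)] by (elim conjE disjE) simp_all
    qed
    show "X \<subseteq> \<Union> (orb ` X)" unfolding orb_def by (intro subsetI UN_I) auto
  qed
  have "4 dvd card (\<Union> (orb ` X))"
  proof (rule dvd_partition)
    show "finite (\<Union> (orb ` X))" unfolding U by (rule fin)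
    show "\<forall>c\<in>orb ` X. 4 dvd card c"
    proof clarify
      fix u v assume "(u, v) \<in> X"
      then have "u \<noteq> neg_pair u" "v \<noteq> neg_pair v" using nz neg_pair_eq_self by metis+
      then have "card {u, neg_pair u} = 2" "card {v, neg_pair v} = 2" by simp_all
      then have "card (orb (u, v)) = 2 * 2" by (simp only: orb_def prod.case card_cartesian_product)
      then show "4 dvd card (orb (u, v))" by simp
    qed
    have eq: "orb a = orb b" if "x \<in> orb a" "x \<in> orb b" for x a b
    proof -
      obtain u v u' v' x1 x2 where e: "a = (u, v)" "b = (u', v')" "x = (x1, x2)"
        by (metis surj_pair)
      have "x1 \<in> {u, neg_pair u}" "x2 \<in> {v, neg_pair v}" "x1 \<in> {u', neg_pair u'}" "x2 \<in> {v', neg_pair v'}"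
        using that unfolding e orb_def prod.case mem_Times_iff fst_conv snd_conv by blast+
      then show ?thesis
        unfolding e orb_def prod.case using neg_pair_class by metis
    qed
    then show "\<forall>c1\<in>orb ` X. \<forall>c2\<in>orb ` X. c1 \<noteq> c2 \<longrightarrow> c1 \<inter> c2 = {}" by blast
  qed
  then show ?thesis unfolding U .
qed

lemma half_form_zero [simp]: "half_form A (\<lambda>i. 0) = 0"
  by (simp add: half_form_def dot_def)

lemma zero_in_range_int_act: "(\<lambda>i. 0) \<in> range (int_act A)"
  by (rule range_eqI[of _ _ "\<lambda>i. 0"]) (simp add: int_act_def fun_eq_iff)

lemma range_int_act_uminus: "(\<lambda>i. - x i) \<in> range (int_act A) \<longleftrightarrow> x \<in> range (int_act A)"
proof -
  have 1: "(\<lambda>i. - x i) \<in> range (int_act A)" if "x \<in> range (int_act A)" for x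
    using that by (auto simp: int_act_uminus [symmetric])
  show ?thesis using 1[of x] 1[of "\<lambda>i. - x i"] by auto
qed

context level_pair
begin

lemma half_form_nonneg: "half_form A x \<ge> 0"
proof -
  have "qform A (\<lambda>i. real_of_int (x i)) \<ge> 0"
    using pos_A unfolding pos_def_mat_qform
    by (cases "(\<lambda>i. real_of_int (x i)) = (\<lambda>i. 0)") (auto simp: qform_def intro: less_imp_le)
  then show ?thesis unfolding qform_of_int[OF even_A] by simp
qed

text \<open>This is \<open>dot_bound\<close> with the weight |r| / |s|; it makes the index matrices
  positive semidefinite.\<close>

lemma pair_form_nonneg:
  fixes r s :: real
  shows "of_int (half_form A x) * r\<^sup>2 + of_int (dot x m) * (r * s) + of_int (half_form A' m) / real p * s\<^sup>2 \<ge> 0"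
proof (cases "r = 0 \<or> s = 0")
  case True
  then show ?thesis
    using half_form_nonneg[of x] level_pair.half_form_nonneg[OF dual_level_pair, of m] by auto
next
  case False
  define l where "l = \<bar>r\<bar> / \<bar>s\<bar>"
  have l: "l > 0" using False by (simp add: l_def)
  have "\<bar>real_of_int (dot x m)\<bar> * (\<bar>r\<bar> * \<bar>s\<bar>) \<le> (l * of_int (half_form A x) + of_int (half_form A' m) / (l * real p)) * (\<bar>r\<bar> * \<bar>s\<bar>)"
    by (intro mult_right_mono dot_bound[OF l]) auto
  also have "\<dots> = of_int (half_form A x) * (l * (\<bar>r\<bar> * \<bar>s\<bar>)) + of_int (half_form A' m) / real p * (\<bar>r\<bar> * \<bar>s\<bar> / l)"
    by (simp add: algebra_simps)
  also have "l * (\<bar>r\<bar> * \<bar>s\<bar>) = r\<^sup>2" using False by (simp add: l_def power2_eq_square)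
  also have "\<bar>r\<bar> * \<bar>s\<bar> / l = s\<^sup>2" using False by (simp add: l_def power2_eq_square)
  finally have "\<bar>real_of_int (dot x m) * (r * s)\<bar> \<le> of_int (half_form A x) * r\<^sup>2 + of_int (half_form A' m) / real p * s\<^sup>2"
    by (simp add: abs_mult)
  then show ?thesis by linarith
qed

end

context level_pairs
begin

interpretation dA: level_pair p A' A by (rule A.dual_level_pair)
interpretation dB: level_pair p B' B by (rule B.dual_level_pair)

definition index_mat :: "((4 \<Rightarrow> int) \<times> (4 \<Rightarrow> int)) \<times> ((4 \<Rightarrow> int) \<times> (4 \<Rightarrow> int)) \<Rightarrow> real^2^2" where
  "index_mat v = mat2 (of_int (sum_form v)) (of_int (sum_dot v) / 2) (of_int (sum_dot v) / 2) (of_int (sum_dual_form v) / real p)"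

lemma quad_term_trace: "quad_term t z w v = e2pi (trace (cmat (index_mat v) ** mat2 t z z w))"
  unfolding quad_term_eq index_mat_def cmat_mat2 trace_mat2_mult
  by (intro arg_cong[of _ _ e2pi]) (simp add: field_simps)

text \<open>On the ranges a form is p times the complementary form, so the divisibilities absent
  from the definitions are automatic.\<close>

lemma S_subsets: "S1 \<subseteq> S3" "S2 \<subseteq> S3" "S4 \<subseteq> S3"
  unfolding S1_def S2_def S3_def S4_def sum_form_def sum_dual_form_def
  by (auto simp: A.half_form_int_act B.half_form_int_act dA.half_form_int_act dB.half_form_int_act)

text \<open>\<open>S3\<close> supplies both divisibilities: one for the factor p in the upper left
  entry, the other to cancel the denominator in the lower right. Semidefiniteness is inherited from
  the two summands.\<close>

lemma index_mat_in_index: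
  assumes "v \<in> S3"
  shows "index_mat v \<in> fourier_index (paramodular p)"
proof -
  obtain j k where jk: "sum_form v = int p * j" "sum_dual_form v = int p * k"
    using assms unfolding S3_def by blast
  obtain x1 m1 x2 m2 where v: "v = ((x1, m1), (x2, m2))" by (cases v) auto
  have "pos_semidef_mat (index_mat v)"
    unfolding pos_semidef_mat_def
  proof (intro conjI allI)
    show "transpose (index_mat v) = index_mat v" by (simp add: index_mat_def mat2_transpose)
    fix y :: "real^2"
    have "y \<bullet> (index_mat v *v y)
       = of_int (sum_form v) * (y $ 1)\<^sup>2 + of_int (sum_dot v) * (y $ 1 * y $ 2) + of_int (sum_dual_form v) / real p * (y $ 2)\<^sup>2"
      unfolding index_mat_def inner_vec_def matrix_vector_mult_def
      by (simp add: sum_2 power2_eq_square algebra_simps)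
    also have "\<dots> = (of_int (half_form A x1) * (y $ 1)\<^sup>2 + of_int (dot x1 m1) * (y $ 1 * y $ 2) + of_int (half_form A' m1) / real p * (y $ 2)\<^sup>2)
       + (of_int (half_form B x2) * (y $ 1)\<^sup>2 + of_int (dot x2 m2) * (y $ 1 * y $ 2) + of_int (half_form B' m2) / real p * (y $ 2)\<^sup>2)"
      unfolding v sum_form_def sum_dot_def sum_dual_form_def by (simp add: algebra_simps add_divide_distrib)
    also have "\<dots> \<ge> 0" by (intro add_nonneg_nonneg[OF A.pair_form_nonneg B.pair_form_nonneg])
    finally show "0 \<le> y \<bullet> (index_mat v *v y)" .
  qed
  then show ?thesis
    unfolding fourier_index_paramodular[OF A.p_pos(1)] using A.p_pos by (simp add: index_mat_def jk)
qed

definition fibre where "fibre S T = {v \<in> S. index_mat v = T}"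

definition trace_coeff :: "real^2^2 \<Rightarrow> nat" where
  "trace_coeff T = p * card (fibre S1 T) + p ^ 2 * card (fibre S2 T) + card (fibre S3 T) + p * card (fibre S4 T)"

lemma fourier_expansion_trace:
  "has_fourier_expansion (paramodular p) (trace_op 4 p (theta_series (direct_sum_mat A B))) (\<lambda>T. of_nat (trace_coeff T))"
  unfolding has_fourier_expansion_def
proof
  fix \<Omega> assume "\<Omega> \<in> siegel_upper_half"
  then obtain t z w where O: "\<Omega> = mat2 t z z w" and s: "siegel3 t z w" by (rule siegel_upper_half_mat2)
  define g where "g T = e2pi (trace (cmat T ** \<Omega>))" for T
  have "((\<lambda>T. of_nat (card (fibre S T)) * g T) has_sum quad_theta S t z w) (fourier_index (paramodular p))" if "S \<subseteq> S3" for S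
    unfolding quad_theta_def quad_term_trace O [symmetric] g_def [symmetric] fibre_def
  proof (rule has_sum_fibres)
    show "(\<lambda>v. g (index_mat v)) summable_on S"
      unfolding g_def O quad_term_trace [symmetric] by (rule abs_summable_summable[OF quad_term_summable[OF s]])
    show "g T \<noteq> 0" for T by (simp add: g_def e2pi_def)
    show "index_mat ` S \<subseteq> fourier_index (paramodular p)" using that index_mat_in_index by blast
  qed
  note hs = this[OF S_subsets(1)] this[OF S_subsets(2)] this[OF subset_refl] this[OF S_subsets(3)]
  have "((\<lambda>T. of_nat p * (of_nat (card (fibre S1 T)) * g T) + of_nat p ^ 2 * (of_nat (card (fibre S2 T)) * g T)
      + of_nat (card (fibre S3 T)) * g T + of_nat p * (of_nat (card (fibre S4 T)) * g T)) has_sum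
      of_nat p * quad_theta S1 t z w + of_nat p ^ 2 * quad_theta S2 t z w + quad_theta S3 t z w + of_nat p * quad_theta S4 t z w)
     (fourier_index (paramodular p))"
    by (intro has_sum_add has_sum_cmult_right hs)
  moreover have "trace_op 4 p (theta_series (direct_sum_mat A B)) \<Omega> = of_nat p * quad_theta S1 t z w
      + of_nat p ^ 2 * quad_theta S2 t z w + quad_theta S3 t z w + of_nat p * quad_theta S4 t z w"
    unfolding O by (rule trace_op_theta[OF s])
  moreover have "of_nat (trace_coeff T) * g T = of_nat p * (of_nat (card (fibre S1 T)) * g T)
      + of_nat p ^ 2 * (of_nat (card (fibre S2 T)) * g T)
      + of_nat (card (fibre S3 T)) * g T + of_nat p * (of_nat (card (fibre S4 T)) * g T)" for T
    unfolding trace_coeff_def by (simp add: algebra_simps)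
  ultimately show "((\<lambda>T. of_nat (trace_coeff T) * e2pi (trace (cmat T ** \<Omega>))) has_sum
      trace_op 4 p (theta_series (direct_sum_mat A B)) \<Omega>) (fourier_index (paramodular p))"
    unfolding g_def [symmetric] by (simp only:)
qed

text \<open>At i times the identity the summand is a nonzero constant on the fibre, while the series
  converges.\<close>

lemma finite_fibre: "finite (fibre S T)"
proof -
  have s: "siegel3 \<i> 0 \<i>" by (simp add: siegel3_def)
  define c where "c = e2pi (trace (cmat T ** mat2 \<i> 0 0 \<i>))"
  have "quad_term \<i> 0 \<i> summable_on fibre S T"
    by (rule abs_summable_summable[OF quad_term_summable[OF s]])
  moreover have "quad_term \<i> 0 \<i> v = c" if "v \<in> fibre S T" for v
    using that unfolding quad_term_trace c_def fibre_def by simp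
  ultimately have "(\<lambda>v. c) summable_on fibre S T" by (simp cong: summable_on_cong)
  then show ?thesis by (rule finite_if_summable_const) (simp add: c_def e2pi_def)
qed

lemma sum_forms_neg_pair:
  "sum_form (neg_pair u, v) = sum_form (u, v)" "sum_form (u, neg_pair v) = sum_form (u, v)"
  "sum_dual_form (neg_pair u, v) = sum_dual_form (u, v)" "sum_dual_form (u, neg_pair v) = sum_dual_form (u, v)"
  "sum_dot (neg_pair u, v) = sum_dot (u, v)" "sum_dot (u, neg_pair v) = sum_dot (u, v)"
  unfolding sum_form_def sum_dual_form_def sum_dot_def neg_pair_def
  by (auto simp: half_form_uminus A.even_A A.even_A' B.even_A B.even_A' dot_def split: prod.split)

lemma index_mat_neg_pair: "index_mat (neg_pair u, v) = index_mat (u, v)" "index_mat (u, neg_pair v) = index_mat (u, v)"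
  unfolding index_mat_def sum_forms_neg_pair by simp_all

lemma S_neg_pair:
  assumes "S \<in> {S1, S2, S3, S4}" "(u, v) \<in> S"
  shows "(neg_pair u, v) \<in> S" "(u, neg_pair v) \<in> S"
proof -
  obtain x1 m1 x2 m2 where uv: "u = (x1, m1)" "v = (x2, m2)" by (cases u; cases v) auto
  note sf = sum_forms_neg_pair[of u v, unfolded uv neg_pair_def prod.case]
  from assms(1) have "(neg_pair u, v) \<in> S \<and> (u, neg_pair v) \<in> S"
    unfolding uv neg_pair_def prod.case
    by (elim insertE emptyE)
      (use assms(2) in \<open>simp_all only: uv S1_def S2_def S3_def S4_def mem_Collect_eq mem_Times_iff fst_conv snd_conv
         UNIV_I simp_thms range_int_act_uminus sf\<close>)
  then show "(neg_pair u, v) \<in> S" "(u, neg_pair v) \<in> S" by auto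
qed

text \<open>By anisotropy the four index sets agree on the vectors supported on one of the two summands.\<close>

lemma S_agree_on_degenerate:
  assumes v: "v \<in> S3" and d: "fst v = zero_pair \<or> snd v = zero_pair"
  shows "v \<in> S1" "v \<in> S2" "v \<in> S4"
proof -
  obtain x1 m1 x2 m2 where v2: "v = ((x1, m1), (x2, m2))" by (cases v) auto
  have dv: "int p dvd half_form A x1 + half_form B x2" "int p dvd half_form A' m1 + half_form B' m2"
    using v unfolding v2 S3_def sum_form_def sum_dual_form_def by auto
  \<comment> \<open>The zero summand drops out of both congruences. Anisotropy then puts the second
    vector into the lattice, and the same fact with the two matrices exchanged treats the first
    vector.\<close>
  have "x1 \<in> range (int_act A') \<and> m1 \<in> range (int_act A) \<and> x2 \<in> range (int_act B') \<and> m2 \<in> range (int_act B)"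
  proof (cases "fst v = zero_pair")
    case True
    then have z: "x1 = (\<lambda>i. 0)" "m1 = (\<lambda>i. 0)" unfolding v2 by (auto simp: zero_pair_def)
    then show ?thesis
      using dv dB.dual_anisotropic[of x2] B.dual_anisotropic[of m2] by (simp add: zero_in_range_int_act)
  next
    case False
    then have z: "x2 = (\<lambda>i. 0)" "m2 = (\<lambda>i. 0)" using d unfolding v2 by (auto simp: zero_pair_def)
    then show ?thesis
      using dv dA.dual_anisotropic[of x1] A.dual_anisotropic[of m1] by (simp add: zero_in_range_int_act)
  qed
  then show "v \<in> S1" "v \<in> S2" "v \<in> S4"
    using v unfolding v2 S1_def S2_def S3_def S4_def by auto
qed

lemma four_dvd_trace_coeff:
  assumes "odd p"
  shows "4 dvd trace_coeff T"
proof -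
  \<comment> \<open>The pairs on which some sign change has a fixed point; by
    \<open>S_agree_on_degenerate\<close> the same set occurs in the fibres of all four index
    sets.\<close>
  define C where "C = {v \<in> fibre S3 T. fst v = zero_pair \<or> snd v = zero_pair}"
  have card: "\<exists>k. card (fibre S T) = 4 * k + card C" if S: "S \<in> {S1, S2, S3, S4}" for S
  proof -
    define D where "D = {v \<in> fibre S T. fst v \<noteq> zero_pair \<and> snd v \<noteq> zero_pair}"
    have CS: "C = {v \<in> fibre S T. fst v = zero_pair \<or> snd v = zero_pair}"
    proof -
      have "v \<in> S \<longleftrightarrow> v \<in> S3" if d: "fst v = zero_pair \<or> snd v = zero_pair" for v
      proof
        show "v \<in> S3" if "v \<in> S" using S that S_subsets by (elim insertE) auto
        show "v \<in> S" if v: "v \<in> S3" using S v S_agree_on_degenerate[OF v d] by (elim insertE) simp_all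
      qed
      then show ?thesis unfolding C_def fibre_def by blast
    qed
    have "card (fibre S T) = card (D \<union> C)" unfolding CS D_def by (rule arg_cong[of _ _ card]) auto
    also have "\<dots> = card D + card C"
      using finite_fibre by (intro card_Un_disjoint) (auto simp: D_def CS)
    finally have c: "card (fibre S T) = card D + card C" .
    have "4 dvd card D"
    proof (rule four_dvd_card_sign_changes)
      show "finite D" using finite_fibre unfolding D_def by simp
      have nz: "neg_pair u = zero_pair \<longleftrightarrow> u = zero_pair" for u :: "(4 \<Rightarrow> int) \<times> (4 \<Rightarrow> int)"
        by (metis neg_pair_eq_self neg_pair_neg_pair)
      fix u v assume uv: "(u, v) \<in> D"
      then show "(neg_pair u, v) \<in> D" "(u, neg_pair v) \<in> D"
        using S_neg_pair[OF S, of u v] unfolding D_def fibre_def by (simp_all add: nz index_mat_neg_pair)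
      show "u \<noteq> zero_pair \<and> v \<noteq> zero_pair" using uv unfolding D_def by simp
    qed
    then show ?thesis unfolding c by (auto simp: dvd_def)
  qed
  obtain k1 where k1: "card (fibre S1 T) = 4 * k1 + card C" using card[of S1] by blast
  obtain k2 where k2: "card (fibre S2 T) = 4 * k2 + card C" using card[of S2] by blast
  obtain k3 where k3: "card (fibre S3 T) = 4 * k3 + card C" using card[of S3] by blast
  obtain k4 where k4: "card (fibre S4 T) = 4 * k4 + card C" using card[of S4] by blast
  obtain q where q: "p = 2 * q + 1" using assms by (rule oddE)
  \<comment> \<open>The weights add up to p + p^2 + 1 + p = (p + 1)^2, and p + 1 is even.\<close>
  have "trace_coeff T = 4 * (p * k1 + p ^ 2 * k2 + k3 + p * k4) + (p + 1) ^ 2 * card C"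
    unfolding trace_coeff_def k1 k2 k3 k4 by (simp add: power2_eq_square algebra_simps)
  moreover have "(p + 1) ^ 2 = 4 * (q + 1) ^ 2" unfolding q by (simp add: power2_eq_square algebra_simps)
  ultimately show ?thesis by simp
qed

end

lemma level_pair_matrix_inv:
  fixes A :: "real^4^4"
  assumes "prime p" "even_mat A" "pos_def_mat A" "det A = real p ^ 2" "even_mat (real p *\<^sub>R matrix_inv A)"
  shows "level_pair p A (real p *\<^sub>R matrix_inv A)"
proof
  have "A ** (real p *\<^sub>R matrix_inv A) = real p *\<^sub>R (A ** matrix_inv A)"
    by (simp add: vec_eq_iff matrix_matrix_mult_def sum_distrib_left mult_ac)
  then show "A ** (real p *\<^sub>R matrix_inv A) = real p *\<^sub>R mat 1"
    using matrix_inv_inverse(1)[OF pos_def_invertible[OF assms(3)]] by simp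
qed (use assms in auto)

theorem theorem3p13:
  fixes p :: nat and A B :: "real^4^4" and F :: "complex^2^2 \<Rightarrow> complex"
  assumes "prime p" and "odd p"
    and "even_mat A" and "pos_def_mat A" and "det A = real p ^ 2"
    and "even_mat (real p *\<^sub>R matrix_inv A)"
    and "even_mat B" and "pos_def_mat B" and "det B = real p ^ 2"
    and "even_mat (real p *\<^sub>R matrix_inv B)"
    and "F = trace_op 4 p (theta_series (direct_sum_mat A B))"
  shows "(\<exists>a. has_fourier_expansion (paramodular p) F a) \<and>
    (\<forall>a. has_fourier_expansion (paramodular p) F a \<longrightarrow>
       (\<forall>T\<in>fourier_index (paramodular p). \<exists>m::int. a T = of_int (4 * m)))"
proof -
  interpret level_pairs p A "real p *\<^sub>R matrix_inv A" B "real p *\<^sub>R matrix_inv B"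
    using level_pair_matrix_inv[of p A] level_pair_matrix_inv[of p B] assms by (simp add: level_pairs_def)
  have ex: "has_fourier_expansion (paramodular p) F (\<lambda>T. of_nat (trace_coeff T))"
    unfolding assms(11) by (rule fourier_expansion_trace)
  have "\<exists>m::int. a T = of_int (4 * m)"
    if "has_fourier_expansion (paramodular p) F a" "T \<in> fourier_index (paramodular p)" for a T
  proof -
    \<comment> \<open>Uniqueness passes the divisibility from the explicit coefficients to those of
      an arbitrary expansion.\<close>
    have "a T = of_nat (trace_coeff T)"
      using fourier_expansion_unique[OF A.p_pos(1) that(1) ex that(2)] .
    moreover obtain k where "trace_coeff T = 4 * k" using four_dvd_trace_coeff[OF assms(2)] by blast
    ultimately have "a T = of_int (4 * int k)" by simp
    then show ?thesis ..
  qed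
  with ex show ?thesis by blast
qed

end
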